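(* Let $m$ and $n$ be natural numbers with $2\leqslant m\leqslant n$ and let $V$ be an isometry from $m$ qubits to $n$ qubits. There exists a decomposition of $V$ in terms of single-qubit gates and C-NOT gates such that the number of C-NOT gates used satisfies $$N_{\mathrm{iso}}(m,n)\leqslant \frac{23}{144}\left(4^m+2\cdot 4^n\right)-2^{m-1}-2^n+\frac13(m-n+4).$$
   Context: An $m$ to $n$ isometry is a $2^n\times 2^m$ complex matrix $V$ with $V^\dagger V=I$. A decomposition of $V$ in terms of single-qubit and C-NOT gates is a quantum circuit on $n$ qubits made of arbitrary single-qubit unitaries and C-NOT gates whose unitary $U$ satisfies $UI_{2^n\times 2^m}=V$ up to a global phase, where $I_{2^n\times2^m}$ is the first $2^m$ columns of the $2^n\times2^n$ identity. *)

theory Defs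
  imports "Jordan_Normal_Form.Schur_Decomposition"
begin

text \<open>Basis states of n qubits are indexed by 0..<2^n; qubit k corresponds to bit k
  of the index.\<close>

definition qbit :: "nat \<Rightarrow> nat \<Rightarrow> nat" where
  "qbit i k = (i div 2 ^ k) mod 2"

definition flip_bit :: "nat \<Rightarrow> nat \<Rightarrow> nat" where
  "flip_bit j t = (if qbit j t = 0 then j + 2 ^ t else j - 2 ^ t)"

datatype gate = SQ nat "complex mat" | CNOT nat nat

definition single_qubit_mat :: "nat \<Rightarrow> nat \<Rightarrow> complex mat \<Rightarrow> complex mat" where
  "single_qubit_mat n k u = mat (2 ^ n) (2 ^ n)
     (\<lambda>(i, j). if (\<forall>l. l \<noteq> k \<longrightarrow> qbit i l = qbit j l) then u $$ (qbit i k, qbit j k) else 0)"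

definition cnot_mat :: "nat \<Rightarrow> nat \<Rightarrow> nat \<Rightarrow> complex mat" where
  "cnot_mat n c t = mat (2 ^ n) (2 ^ n)
     (\<lambda>(i, j). if i = (if qbit j c = 1 then flip_bit j t else j) then 1 else 0)"

fun gate_mat :: "nat \<Rightarrow> gate \<Rightarrow> complex mat" where
  "gate_mat n (SQ k u) = single_qubit_mat n k u"
| "gate_mat n (CNOT c t) = cnot_mat n c t"

fun valid_gate :: "nat \<Rightarrow> gate \<Rightarrow> bool" where
  "valid_gate n (SQ k u) \<longleftrightarrow> k < n \<and> u \<in> carrier_mat 2 2 \<and> mat_adjoint u * u = 1\<^sub>m 2"
| "valid_gate n (CNOT c t) \<longleftrightarrow> c < n \<and> t < n \<and> c \<noteq> t"

fun is_cnot :: "gate \<Rightarrow> bool" where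
  "is_cnot (CNOT _ _) = True"
| "is_cnot (SQ _ _) = False"

definition circuit_unitary :: "nat \<Rightarrow> gate list \<Rightarrow> complex mat" where
  "circuit_unitary n gs = foldl (\<lambda>U g. gate_mat n g * U) (1\<^sub>m (2 ^ n)) gs"

definition cnot_count :: "gate list \<Rightarrow> nat" where
  "cnot_count gs = length (filter is_cnot gs)"

definition iso_embed :: "nat \<Rightarrow> nat \<Rightarrow> complex mat" where
  "iso_embed n m = mat (2 ^ n) (2 ^ m) (\<lambda>(i, j). if i = j then 1 else 0)"

definition is_isometry :: "nat \<Rightarrow> nat \<Rightarrow> complex mat \<Rightarrow> bool" where
  "is_isometry m n V \<longleftrightarrow> V \<in> carrier_mat (2 ^ n) (2 ^ m) \<and> mat_adjoint V * V = 1\<^sub>m (2 ^ m)"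

definition decomposes :: "nat \<Rightarrow> nat \<Rightarrow> gate list \<Rightarrow> complex mat \<Rightarrow> bool" where
  "decomposes m n gs V \<longleftrightarrow> (\<forall>g\<in>set gs. valid_gate n g) \<and>
     (\<exists>c. cmod c = 1 \<and> circuit_unitary n gs * iso_embed n m = c \<cdot>\<^sub>m V)"

end

theory Submission
  imports Defs "Jordan_Normal_Form.Spectral_Radius"
begin

text \<open>Acting with the top qubit as a multiplexer, the cosine-sine decomposition writes a unitary as
  a multiplexed y-rotation between two multiplexed unitaries, and diagonalizing A0 A1* turns each of
  the latter (blocks A0 and A1) into a multiplexed z-rotation between two unitaries on one qubit fewer.
  If the top qubit starts in state 0, the first multiplexed unitary reduces to a single smaller
  isometry. A two-qubit unitary needs three CNOTs but only two up to a diagonal; a diagonal on the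
  lower qubits commutes with the multiplexed rotations and is absorbed by the preceding block, so
  that only the very first two-qubit block costs three. One more CNOT per y-rotation is saved because its last
  controlled-Z is diagonal as well. This gives d(n+1) = 4 d(n) + 3 2^n - 1 with d(2) = 2 up to a
  diagonal, d(n) + 1 exactly, and f(m, n+1) = f(m, n) + 2 d(n) + 2^(n+1) - 1 for isometries.\<close>

section \<open>Unitary matrices\<close>

text \<open>The constants solve the recursions exactly: d(n) = 23/48 4^n - 3/2 2^n + 1/3, where 3/2
  and 1/3 come from the inhomogeneous terms and 23/48 is fixed by d(2) = 2. Adding the increments of
  f, starting from f(m, m) = d(m) + 1, gives the bound. The obstacle is therefore the value d(2) =
  2. In a suitable basis of Bell states the real rotations in SO(4) act as pairs of single-qubit
  unitaries, so that for a two-qubit unitary X of determinant one, written in this basis, the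
  spectrum of X X^T decides the cost. Two CNOTs reach the spectra that consist of conjugate pairs,
  which leaves a single real condition: the trace must be real. One free angle in a diagonal is
  enough to meet it. Matrix products are read from right to left in time, so a diagonal split off on
  the right belongs to the start of a circuit and can be handed to the block applied before
  it.\<close>

lemma dim_mat_adjoint [simp]:
  "dim_row (mat_adjoint A) = dim_col A" "dim_col (mat_adjoint A) = dim_row A"
  by (auto simp: mat_adjoint_def)

lemma mat_adjoint_carrier [simp]:
  "A \<in> carrier_mat n m \<Longrightarrow> mat_adjoint A \<in> carrier_mat m n"
  by (auto intro!: carrier_matI)

lemma index_mat_adjoint [simp]:
  fixes A :: "complex mat"
  assumes "i < dim_col A" "j < dim_row A"
  shows "mat_adjoint A $$ (i, j) = cnj (A $$ (j, i))"
  using assms by (simp add: mat_adjoint_def mat_of_rows_def conjugate_complex_def)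

lemma mult_carrier_square [simp]:
  "A \<in> carrier_mat n n \<Longrightarrow> B \<in> carrier_mat n n \<Longrightarrow> A * B \<in> carrier_mat n n"
  by (rule mult_carrier_mat)

lemma index_mult_mat_sum:
  assumes "i < dim_row A" "j < dim_col B" "dim_col A = dim_row B"
  shows "(A * B) $$ (i, j) = (\<Sum>k<dim_row B. A $$ (i, k) * B $$ (k, j))"
  using assms by (simp add: scalar_prod_def atLeast0LessThan)

lemma mat_adjoint_mult:
  fixes A B :: "complex mat"
  assumes "A \<in> carrier_mat n m" "B \<in> carrier_mat m k"
  shows "mat_adjoint (A * B) = mat_adjoint B * mat_adjoint A"
  using assms
  by (intro eq_matI) (auto simp: index_mult_mat_sum mult.commute simp del: index_mult_mat(1))

lemma mat_adjoint_adjoint [simp]: "mat_adjoint (mat_adjoint A) = (A :: complex mat)"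
  by (intro eq_matI) auto

lemma mat_adjoint_one [simp]: "mat_adjoint (1\<^sub>m n) = (1\<^sub>m n :: complex mat)"
  by (intro eq_matI) auto

lemma mat_adjoint_diag [simp]: "mat_adjoint (mat_diag n f) = mat_diag n (\<lambda>i. cnj (f i))"
  by (intro eq_matI) (auto simp: mat_diag_def)

lemma mat_adjoint_smult: "mat_adjoint (c \<cdot>\<^sub>m A) = cnj c \<cdot>\<^sub>m mat_adjoint (A :: complex mat)"
  by (intro eq_matI) auto

definition unitary :: "nat \<Rightarrow> complex mat \<Rightarrow> bool" where
  "unitary n U \<longleftrightarrow> U \<in> carrier_mat n n \<and> mat_adjoint U * U = 1\<^sub>m n"

lemma unitary_carrier [simp, dest]: "unitary n U \<Longrightarrow> U \<in> carrier_mat n n"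
  by (simp add: unitary_def)

lemma unitary_left: "unitary n U \<Longrightarrow> mat_adjoint U * U = 1\<^sub>m n"
  by (simp add: unitary_def)

lemma unitary_right: "unitary n U \<Longrightarrow> U * mat_adjoint U = 1\<^sub>m n"
  unfolding unitary_def
  by (metis mat_adjoint_carrier mat_mult_left_right_inverse)

lemma unitary_cancel_left:
  assumes "unitary n U" "A \<in> carrier_mat n m"
  shows "mat_adjoint U * (U * A) = A"
  using assms by (simp add: assoc_mult_mat[of _ n n _ n _ m, symmetric] unitary_left)

lemma unitary_cancel_right:
  assumes "unitary n U" "A \<in> carrier_mat n m"
  shows "U * (mat_adjoint U * A) = A"
  using assms by (simp add: assoc_mult_mat[of _ n n _ n _ m, symmetric] unitary_right)

lemma unitary_adjoint: "unitary n U \<Longrightarrow> unitary n (mat_adjoint U)"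
  by (metis unitary_def mat_adjoint_adjoint mat_adjoint_carrier unitary_right)

lemma unitary_one [simp]: "unitary n (1\<^sub>m n)"
  by (simp add: unitary_def)

lemma unitary_mult:
  assumes "unitary n U" "unitary n V"
  shows "unitary n (U * V)"
proof -
  have "mat_adjoint (U * V) * (U * V) = mat_adjoint V * (mat_adjoint U * (U * V))"
    using assms by (simp add: mat_adjoint_mult[of _ n n _ n] assoc_mult_mat[of _ n n _ n _ n])
  also have "\<dots> = 1\<^sub>m n"
    using assms by (simp add: unitary_cancel_left[of n _ _ n] unitary_left)
  finally show ?thesis
    using assms by (simp add: unitary_def)
qed

lemma unitary_diag: "(\<And>i. i < n \<Longrightarrow> cmod (f i) = 1) \<Longrightarrow> unitary n (mat_diag n f)"
  unfolding unitary_def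
  by (simp add: mult.commute[of "cnj _"] complex_norm_square[symmetric])
     (auto simp: mat_diag_def intro!: eq_matI)

lemma unitary_smult: "unitary n U \<Longrightarrow> cmod c = 1 \<Longrightarrow> unitary n (c \<cdot>\<^sub>m U)"
  unfolding unitary_def
  by (auto simp: mat_adjoint_smult mult_smult_distrib[of _ n n _ n] mult_smult_assoc_mat[of _ n n _ n]
      complex_norm_square[symmetric] mult.assoc[symmetric] intro!: eq_matI)

lemma unitary_diag_entries:
  assumes "unitary n (mat_diag n f)" "i < n"
  shows "cmod (f i) = 1"
proof -
  have "(mat_diag n (\<lambda>i. cnj (f i) * f i)) $$ (i, i) = (1\<^sub>m n :: complex mat) $$ (i, i)"
    using unitary_left[OF assms(1)] by simp
  then have "f i * cnj (f i) = 1"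
    using assms(2) by (simp add: mat_diag_def mult.commute)
  then have "(cmod (f i))\<^sup>2 = 1"
    by (metis complex_norm_square of_real_eq_1_iff)
  then show ?thesis
    using norm_ge_zero[of "f i"] by (simp add: power2_eq_1_iff)
qed

section \<open>Block-diagonal matrices\<close>

definition block_diag :: "complex mat \<Rightarrow> complex mat \<Rightarrow> complex mat" where
  "block_diag A B = four_block_mat A (0\<^sub>m (dim_row A) (dim_col B)) (0\<^sub>m (dim_row B) (dim_col A)) B"

lemma block_diag_carrier [simp]:
  "A \<in> carrier_mat n n' \<Longrightarrow> B \<in> carrier_mat m m' \<Longrightarrow> block_diag A B \<in> carrier_mat (n + m) (n' + m')"
  by (simp add: block_diag_def)

lemma block_diag_mult:
  assumes "A \<in> carrier_mat n n" "B \<in> carrier_mat m m" "A' \<in> carrier_mat n n" "B' \<in> carrier_mat m m"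
  shows "block_diag A B * block_diag A' B' = block_diag (A * A') (B * B')"
proof -
  have "dim_row A = n" "dim_col A = n" "dim_row A' = n" "dim_col A' = n"
    "dim_row B = m" "dim_col B = m" "dim_row B' = m" "dim_col B' = m" using assms by auto
  then show ?thesis
    unfolding block_diag_def using assms
    by (subst mult_four_block_mat[of _ n n _ m _ m _ _ n _ m]) auto
qed

lemma block_diag_adjoint: "mat_adjoint (block_diag A B) = block_diag (mat_adjoint A) (mat_adjoint B)"
  by (intro eq_matI) (auto simp: block_diag_def)

lemma block_diag_one: "block_diag (1\<^sub>m n) (1\<^sub>m m) = 1\<^sub>m (n + m)"
  by (simp add: block_diag_def)

lemma block_diag_unitary: "unitary n A \<Longrightarrow> unitary m B \<Longrightarrow> unitary (n + m) (block_diag A B)"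
  unfolding unitary_def
  by (simp add: block_diag_adjoint block_diag_mult[of _ n _ m] block_diag_one)

section \<open>Orthonormal completion and diagonalization\<close>

text \<open>The family is indexed by an arbitrary set because completion has to keep the given
  vectors at their column positions, and these need not form an initial segment.\<close>

definition orthonormal :: "nat \<Rightarrow> (nat \<Rightarrow> complex vec) \<Rightarrow> nat set \<Rightarrow> bool" where
  "orthonormal n f S \<longleftrightarrow> (\<forall>i\<in>S. f i \<in> carrier_vec n) \<and>
     (\<forall>i\<in>S. \<forall>j\<in>S. f i \<bullet>c f j = (if i = j then 1 else 0))"

text \<open>The factors 1 and i give twice the real part and minus twice the imaginary part of
  \<open>v\<close>, which cannot both vanish. This is how real vectors are extracted from complex
  solution spaces.\<close>

lemma multiple_with_nonzero_real_part:
  fixes v :: "complex vec"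
  assumes v: "v \<in> carrier_vec n" "v \<noteq> 0\<^sub>v n"
  obtains a where "a \<cdot>\<^sub>v v + conjugate (a \<cdot>\<^sub>v v) \<noteq> 0\<^sub>v n"
proof (rule ccontr)
  assume "\<not> thesis"
  with that have *: "a \<cdot>\<^sub>v v + conjugate (a \<cdot>\<^sub>v v) = 0\<^sub>v n" for a by blast
  have "v $ i = 0" if i: "i < n" for i
  proof -
    have "(a \<cdot>\<^sub>v v + conjugate (a \<cdot>\<^sub>v v)) $ i = 0" for a using * i by simp
    from this[of 1] this[of \<i>] show ?thesis
      using i v by (simp add: conjugate_complex_def complex_eq_iff)
  qed
  then have "v = 0\<^sub>v n" using v(1) by (intro eq_vecI) auto
  with v show False by simp
qed

text \<open>The scaling factor is real, so that a vector fixed by conjugation stays fixed.\<close>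

lemma normalize_vec:
  fixes v :: "complex vec"
  assumes v: "v \<in> carrier_vec n" "v \<noteq> 0\<^sub>v n"
  obtains r :: real where "(of_real r \<cdot>\<^sub>v v) \<bullet>c (of_real r \<cdot>\<^sub>v v) = 1"
proof -
  have pos: "v \<bullet>c v > 0" using v conjugate_square_greater_0_vec by blast
  then have "v \<bullet>c v = of_real (Re (v \<bullet>c v))" "Re (v \<bullet>c v) > 0"
    by (auto simp: less_complex_def complex_eq_iff)
  then obtain x :: real where x: "v \<bullet>c v = of_real x" "x > 0" by blast
  have cj: "conjugate (complex_of_real r) = of_real r" for r by (simp add: conjugate_complex_def)
  have "(of_real (1 / sqrt x) \<cdot>\<^sub>v v) \<bullet>c (of_real (1 / sqrt x) \<cdot>\<^sub>v v) = of_real (1 / sqrt x) * of_real (1 / sqrt x) * of_real x"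
    using v x by (simp add: conjugate_smult_vec cj)
  also have "\<dots> = 1" using x by (simp flip: of_real_mult)
  finally show ?thesis by (rule that)
qed

text \<open>Orthogonality to the family is a square linear system whose rows are the conjugated
  vectors. Row \<open>k\<close> is zero, so the determinant vanishes and there is a nonzero
  solution. If the family is real, conjugation preserves the solutions, and a real one is
  found.\<close>

lemma orthogonal_vector:
  fixes f :: "nat \<Rightarrow> complex vec"
  assumes f: "\<And>i. i \<in> S \<Longrightarrow> f i \<in> carrier_vec n" and S: "k < n" "k \<notin> S"
    and K: "K \<Longrightarrow> \<forall>i\<in>S. conjugate (f i) = f i"
  obtains v where "v \<in> carrier_vec n" "v \<bullet>c v = 1" "\<forall>i\<in>S \<inter> {..<n}. v \<bullet>c f i = 0" "K \<longrightarrow> conjugate v = v"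
proof -
  define M where "M = mat\<^sub>r n n (\<lambda>i. if i = k then 0\<^sub>v n else if i \<in> S then conjugate (f i) else 0\<^sub>v n)"
  have M: "M \<in> carrier_mat n n" by (simp add: M_def)
  have "det M = 0" unfolding M_def
    by (rule det_row_0) (use S f in auto)
  then obtain v where v: "v \<in> carrier_vec n" "v \<noteq> 0\<^sub>v n" "M *\<^sub>v v = 0\<^sub>v n"
    using det_0_iff_vec_prod_zero[OF M] by blast
  have orth: "v \<bullet>c f i = 0" if "i \<in> S \<inter> {..<n}" for i
  proof -
    have "(M *\<^sub>v v) $ i = 0" using v that by simp
    moreover have "(M *\<^sub>v v) $ i = conjugate (f i) \<bullet> v"
      using that M S f unfolding M_def by auto
    ultimately show ?thesis using comm_scalar_prod[of "conjugate (f i)" n v] f that v(1) by auto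
  qed
  have "\<exists>w \<in> carrier_vec n. w \<noteq> 0\<^sub>v n \<and> (\<forall>i\<in>S \<inter> {..<n}. w \<bullet>c f i = 0) \<and> (K \<longrightarrow> conjugate w = w)"
  proof (cases K)
    case False
    then show ?thesis using v orth by blast
  next
    case True
    obtain a where a: "a \<cdot>\<^sub>v v + conjugate (a \<cdot>\<^sub>v v) \<noteq> 0\<^sub>v n"
      using multiple_with_nonzero_real_part v by blast
    have "(a \<cdot>\<^sub>v v + conjugate (a \<cdot>\<^sub>v v)) \<bullet>c f i = 0" if i: "i \<in> S \<inter> {..<n}" for i
    proof -
      have "conjugate (a \<cdot>\<^sub>v v) \<bullet>c f i = conjugate ((a \<cdot>\<^sub>v v) \<bullet>c f i)"
        using K[OF True] i f[of i] v conjugate_sprod_vec[of "a \<cdot>\<^sub>v v" n "f i"] by auto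
      then show ?thesis using i f[of i] v orth[OF i]
        by (subst add_scalar_prod_distrib[of _ n]) auto
    qed
    moreover have "conjugate (a \<cdot>\<^sub>v v + conjugate (a \<cdot>\<^sub>v v)) = a \<cdot>\<^sub>v v + conjugate (a \<cdot>\<^sub>v v)"
      using v by (intro eq_vecI) (auto simp: conjugate_complex_def add.commute)
    ultimately show ?thesis using a v by (intro bexI[of _ "a \<cdot>\<^sub>v v + conjugate (a \<cdot>\<^sub>v v)"]) auto
  qed
  then obtain w where w: "w \<in> carrier_vec n" "w \<noteq> 0\<^sub>v n" "\<forall>i\<in>S \<inter> {..<n}. w \<bullet>c f i = 0"
    "K \<longrightarrow> conjugate w = w" by blast
  obtain r where r: "(of_real r \<cdot>\<^sub>v w) \<bullet>c (of_real r \<cdot>\<^sub>v w) = 1"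
    using normalize_vec w by blast
  show ?thesis
    by (rule that[OF _ r]) (use w f in \<open>auto simp: conjugate_smult_vec conjugate_complex_def\<close>)
qed

lemma orthonormal_insert:
  assumes "orthonormal n f S" "k \<notin> S" "v \<in> carrier_vec n" "v \<bullet>c v = 1" "\<forall>i\<in>S. v \<bullet>c f i = 0"
  shows "orthonormal n (f(k := v)) (insert k S)"
proof -
  have "f i \<bullet>c v = 0" if "i \<in> S" for i
  proof -
    have "f i \<in> carrier_vec n" using that assms by (auto simp: orthonormal_def)
    then have "f i \<bullet>c v = conjugate (v \<bullet>c f i)"
      using conjugate_conjugate_sprod[of "f i" n v] conjugate_vec_sprod_comm[of v n "f i"] assms(3)
      by simp
    then show ?thesis using assms that by simp
  qed
  then show ?thesis using assms by (auto simp: orthonormal_def)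
qed

lemma orthonormal_extend:
  assumes "orthonormal n f S" "S \<subseteq> {..<n}" "K \<Longrightarrow> \<forall>i\<in>S. conjugate (f i) = f i"
  shows "\<exists>g. orthonormal n g {..<n} \<and> (\<forall>i\<in>S. g i = f i) \<and> (K \<longrightarrow> (\<forall>i<n. conjugate (g i) = g i))"
  using assms
proof (induction "n - card S" arbitrary: S f rule: less_induct)
  case less
  show ?case
  proof (cases "S = {..<n}")
    case True
    then show ?thesis using less.prems by (intro exI[of _ f]) auto
  next
    case False
    then obtain k where k: "k < n" "k \<notin> S" using less.prems(2) by auto
    obtain v where v: "v \<in> carrier_vec n" "v \<bullet>c v = 1" "\<forall>i\<in>S \<inter> {..<n}. v \<bullet>c f i = 0" "K \<longrightarrow> conjugate v = v"
      by (rule orthogonal_vector[of S f n k K]) (use k less.prems in \<open>auto simp: orthonormal_def\<close>)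
    have fin: "finite S" using less.prems(2) finite_subset by blast
    have "insert k S \<subseteq> {..<n}" using k less.prems(2) by auto
    then have "card (insert k S) \<le> n" using card_mono[of "{..<n}" "insert k S"] by simp
    then have lt: "n - card (insert k S) < n - card S" using k fin by simp
    have on: "orthonormal n (f(k := v)) (insert k S)"
      by (rule orthonormal_insert) (use less.prems k v in auto)
    from less.hyps[OF lt on] \<open>insert k S \<subseteq> {..<n}\<close> less.prems(3) v k
    obtain g where g: "orthonormal n g {..<n}" "\<forall>i\<in>insert k S. g i = (f(k := v)) i"
      "K \<longrightarrow> (\<forall>i<n. conjugate (g i) = g i)" by fastforce
    moreover have "\<forall>i\<in>S. g i = f i" using g(2) k(2) by auto
    ultimately show ?thesis by blast
  qed
qed

lemma unitary_of_orthonormal: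
  assumes "orthonormal n g {..<n}"
  shows "unitary n (mat n n (\<lambda>(i, j). g j $ i))"
proof -
  have "(mat_adjoint (mat n n (\<lambda>(i, j). g j $ i)) * mat n n (\<lambda>(i, j). g j $ i)) $$ (i, j) = 1\<^sub>m n $$ (i, j)"
    if ij: "i < n" "j < n" for i j
  proof -
    have "g j \<bullet>c g i = (if j = i then 1 else 0)" "dim_vec (g i) = n" "dim_vec (g j) = n"
      using ij assms by (auto simp: orthonormal_def)
    then have "(\<Sum>k<n. g j $ k * cnj (g i $ k)) = (if j = i then 1 else 0)"
      by (simp add: scalar_prod_def atLeast0LessThan conjugate_complex_def)
    then show ?thesis using ij
      by (auto simp: index_mult_mat_sum mult.commute simp del: index_mult_mat(1))
  qed
  then show ?thesis unfolding unitary_def by (auto intro!: eq_matI)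
qed

definition real_mat :: "complex mat \<Rightarrow> bool" where
  "real_mat A \<longleftrightarrow> (\<forall>i<dim_row A. \<forall>j<dim_col A. A $$ (i, j) \<in> \<real>)"

text \<open>Used to deflate a normal matrix along an eigenvector, to fill in the directions lost at
  zero columns in the cosine-sine decomposition, and to extend an isometry to a unitary. The flag
  \<open>K\<close> asks for a real completion of real vectors.\<close>

lemma unitary_completion:
  assumes "orthonormal n f S" "S \<subseteq> {..<n}" "K \<Longrightarrow> \<forall>i\<in>S. conjugate (f i) = f i"
  obtains Q where "unitary n Q" "\<forall>i\<in>S. \<forall>j<n. Q $$ (j, i) = f i $ j" "K \<longrightarrow> real_mat Q"
proof -
  obtain g where g: "orthonormal n g {..<n}" "\<forall>i\<in>S. g i = f i" "K \<longrightarrow> (\<forall>i<n. conjugate (g i) = g i)"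
    using orthonormal_extend[OF assms] by blast
  have c: "g i \<in> carrier_vec n" if "i < n" for i using g that by (auto simp: orthonormal_def)
  have "g j $ i \<in> \<real>" if "K" "i < n" "j < n" for i j
  proof -
    have "conjugate (g j) $ i = g j $ i" using g that by simp
    then show ?thesis using c[of j] that by (simp add: conjugate_complex_def Reals_cnj_iff)
  qed
  then have "K \<longrightarrow> real_mat (mat n n (\<lambda>(i, j). g j $ i))" by (simp add: real_mat_def)
  with unitary_of_orthonormal[OF g(1)] that show ?thesis using g(2) assms(2) by force
qed

section \<open>Eigenvectors and diagonalization of normal matrices\<close>

lemma adjoint_cscalar_prod:
  fixes A :: "complex mat"
  assumes A: "A \<in> carrier_mat n n" and x: "x \<in> carrier_vec n" and y: "y \<in> carrier_vec n"
  shows "(A *\<^sub>v x) \<bullet>c y = x \<bullet>c (mat_adjoint A *\<^sub>v y)"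
proof -
  have "(A *\<^sub>v x) \<bullet>c y = (\<Sum>i<n. \<Sum>j<n. A $$ (i, j) * x $ j * cnj (y $ i))"
    using assms by (simp add: scalar_prod_def atLeast0LessThan sum_distrib_right conjugate_complex_def)
  also have "\<dots> = (\<Sum>j<n. \<Sum>i<n. A $$ (i, j) * x $ j * cnj (y $ i))"
    by (rule sum.swap)
  also have "\<dots> = x \<bullet>c (mat_adjoint A *\<^sub>v y)"
    using assms by (simp add: scalar_prod_def atLeast0LessThan sum_distrib_left conjugate_complex_def mult_ac)
  finally show ?thesis .
qed

text \<open>Normality gives the images of \<open>v\<close> under \<open>A\<close> and its adjoint
  the same norm. Expanding the squared norm of the difference of the two sides then yields
  0.\<close>

lemma normal_eigenvector_adjoint:
  fixes A :: "complex mat"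
  assumes A: "A \<in> carrier_mat n n" and normal: "A * mat_adjoint A = mat_adjoint A * A"
    and v: "v \<in> carrier_vec n" and unit: "v \<bullet>c v = 1" and ev: "A *\<^sub>v v = l \<cdot>\<^sub>v v"
  shows "mat_adjoint A *\<^sub>v v = cnj l \<cdot>\<^sub>v v"
proof -
  define x where "x = mat_adjoint A *\<^sub>v v"
  have x: "x \<in> carrier_vec n" using A v by (simp add: x_def mult_mat_vec_carrier[of _ n n])
  have A': "mat_adjoint A \<in> carrier_mat n n" using A by simp
  have Av: "A *\<^sub>v v \<in> carrier_vec n" using v by (simp add: ev)
  have "x \<bullet>c x = v \<bullet>c (A *\<^sub>v x)"
    using adjoint_cscalar_prod[OF A' v x] by (simp add: x_def)
  also have "A *\<^sub>v x = mat_adjoint A *\<^sub>v (A *\<^sub>v v)"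
    using A A' v normal by (simp add: x_def assoc_mult_mat_vec[symmetric, of _ n n _ n])
  also have "v \<bullet>c \<dots> = (A *\<^sub>v v) \<bullet>c (A *\<^sub>v v)"
    using adjoint_cscalar_prod[OF A v Av] by simp
  also have "\<dots> = l * cnj l"
    using v unit by (simp add: ev conjugate_smult_vec conjugate_complex_def)
  finally have xx: "x \<bullet>c x = l * cnj l" .
  have xv: "x \<bullet>c v = cnj l"
    using adjoint_cscalar_prod[OF A' v v] v unit
    by (simp add: x_def ev conjugate_smult_vec conjugate_complex_def)
  have vx: "v \<bullet>c x = l"
    using adjoint_cscalar_prod[OF A v v] v unit by (simp add: x_def ev)
  define y where "y = x - cnj l \<cdot>\<^sub>v v"
  have y: "y \<in> carrier_vec n" using x v by (simp add: y_def)
  have cy: "conjugate y = conjugate x - l \<cdot>\<^sub>v conjugate v"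
    using x v by (intro eq_vecI) (auto simp: y_def conjugate_complex_def)
  have "y \<bullet>c y = x \<bullet>c x - l * (x \<bullet>c v) - cnj l * (v \<bullet>c x - l * (v \<bullet>c v))"
    unfolding cy unfolding y_def using x v
    by (simp add: minus_scalar_prod_distrib[of _ n] scalar_prod_minus_distrib[of _ n] right_diff_distrib)
  also have "\<dots> = 0" by (simp add: xx xv vx unit algebra_simps)
  finally have "y = 0\<^sub>v n" using y by simp
  then have "y $ i = 0" if "i < n" for i using that by simp
  then show ?thesis using x v by (intro eq_vecI) (auto simp: y_def x_def[symmetric])
qed

lemma normal_eigenvector:
  fixes A :: "complex mat"
  assumes A: "A \<in> carrier_mat n n" and n: "n > 0"
    and normal: "A * mat_adjoint A = mat_adjoint A * A"
    and K: "K \<Longrightarrow> A\<^sup>T = A"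
  obtains v l where "v \<in> carrier_vec n" "v \<bullet>c v = 1" "A *\<^sub>v v = l \<cdot>\<^sub>v v"
    "mat_adjoint A *\<^sub>v v = cnj l \<cdot>\<^sub>v v" "K \<longrightarrow> conjugate v = v"
proof -
  have unit: "\<exists>u\<in>carrier_vec n. u \<bullet>c u = 1 \<and> A *\<^sub>v u = l \<cdot>\<^sub>v u \<and> mat_adjoint A *\<^sub>v u = cnj l \<cdot>\<^sub>v u
      \<and> (conjugate w = w \<longrightarrow> conjugate u = u)"
    if w: "w \<in> carrier_vec n" "w \<noteq> 0\<^sub>v n" "A *\<^sub>v w = l \<cdot>\<^sub>v w" for w l
  proof -
    obtain r :: real where r: "(of_real r \<cdot>\<^sub>v w) \<bullet>c (of_real r \<cdot>\<^sub>v w) = 1"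
      using normalize_vec w by blast
    have "A *\<^sub>v (of_real r \<cdot>\<^sub>v w) = l \<cdot>\<^sub>v (of_real r \<cdot>\<^sub>v w)"
      using w A by (simp add: mult_mat_vec[of _ n n] smult_smult_assoc mult.commute)
    then show ?thesis using w r normal_eigenvector_adjoint[OF A normal _ r]
      by (intro bexI[of _ "of_real r \<cdot>\<^sub>v w"]) (auto simp: conjugate_smult_vec conjugate_complex_def)
  qed
  have "spectrum A \<noteq> {}" using spectrum_non_empty[OF A n] .
  then obtain l v0 where v0: "v0 \<in> carrier_vec n" "v0 \<noteq> 0\<^sub>v n" "A *\<^sub>v v0 = l \<cdot>\<^sub>v v0"
    using A by (auto simp: spectrum_def eigenvalue_def eigenvector_def)
  show ?thesis
  proof (cases K)
    case False
    then show ?thesis using unit[OF v0] that by blast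
  next
    case True
    obtain u where u: "u \<in> carrier_vec n" "u \<bullet>c u = 1" "A *\<^sub>v u = l \<cdot>\<^sub>v u"
      "mat_adjoint A *\<^sub>v u = cnj l \<cdot>\<^sub>v u"
      using unit[OF v0] by blast
    have "u \<noteq> 0\<^sub>v n" using u by auto
    then obtain a where a: "a \<cdot>\<^sub>v u + conjugate (a \<cdot>\<^sub>v u) \<noteq> 0\<^sub>v n"
      using multiple_with_nonzero_real_part u by blast
    define w where "w = a \<cdot>\<^sub>v u + conjugate (a \<cdot>\<^sub>v u)"
    have AT: "A $$ (j, i) = A $$ (i, j)" if "i < n" "j < n" for i j
      using arg_cong[OF K[OF True], of "\<lambda>M. M $$ (i, j)"] that A by simp
    \<comment> \<open>Symmetry makes \<open>A\<close> the entrywise conjugate of its adjoint, and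
      the adjoint multiplies \<open>u\<close> by \<open>cnj l\<close>. Hence the conjugate of
      \<open>u\<close> belongs to the same eigenvalue \<open>l\<close>, and so does the real vector
      \<open>w\<close>.\<close>
    have "A *\<^sub>v conjugate u = conjugate (mat_adjoint A *\<^sub>v u)"
      using A u(1) AT by (intro eq_vecI) (auto simp: scalar_prod_def conjugate_complex_def intro!: sum.cong)
    then have Acu: "A *\<^sub>v conjugate u = l \<cdot>\<^sub>v conjugate u"
      using u by (simp add: conjugate_smult_vec conjugate_complex_def)
    have "A *\<^sub>v w = a \<cdot>\<^sub>v (l \<cdot>\<^sub>v u) + conjugate a \<cdot>\<^sub>v (l \<cdot>\<^sub>v conjugate u)"
      unfolding w_def using A u Acu
      by (simp add: mult_add_distrib_mat_vec[of _ n n] conjugate_smult_vec mult_mat_vec[of _ n n])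
    also have "\<dots> = l \<cdot>\<^sub>v w"
      unfolding w_def using u by (intro eq_vecI) (auto simp: conjugate_complex_def algebra_simps)
    finally have "A *\<^sub>v w = l \<cdot>\<^sub>v w" .
    moreover have "conjugate w = w"
      unfolding w_def using u by (intro eq_vecI) (auto simp: conjugate_complex_def)
    moreover have "w \<in> carrier_vec n" "w \<noteq> 0\<^sub>v n" using u a by (auto simp: w_def)
    ultimately show ?thesis using unit[of w l] that by blast
  qed
qed

lemma four_block_mat_inject:
  assumes eq: "four_block_mat A B C D = four_block_mat A' B' C' D'"
    and carr: "A \<in> carrier_mat n n" "A' \<in> carrier_mat n n" "B \<in> carrier_mat n m" "B' \<in> carrier_mat n m"
      "C \<in> carrier_mat m n" "C' \<in> carrier_mat m n" "D \<in> carrier_mat m m" "D' \<in> carrier_mat m m"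
  shows "A = A'" "B = B'" "C = C'" "D = D'"
proof -
  have *: "four_block_mat A B C D $$ (i, j) = four_block_mat A' B' C' D' $$ (i, j)" for i j
    by (simp only: eq)
  show "A = A'"
  proof (rule eq_matI)
    fix i j assume "i < dim_row A'" "j < dim_col A'"
    then show "A $$ (i, j) = A' $$ (i, j)" using *[of i j] carr by auto
  qed (use carr in auto)
  show "B = B'"
  proof (rule eq_matI)
    fix i j assume "i < dim_row B'" "j < dim_col B'"
    then show "B $$ (i, j) = B' $$ (i, j)" using *[of i "n + j"] carr by auto
  qed (use carr in auto)
  show "C = C'"
  proof (rule eq_matI)
    fix i j assume "i < dim_row C'" "j < dim_col C'"
    then show "C $$ (i, j) = C' $$ (i, j)" using *[of "n + i" j] carr by auto
  qed (use carr in auto)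
  show "D = D'"
  proof (rule eq_matI)
    fix i j assume "i < dim_row D'" "j < dim_col D'"
    then show "D $$ (i, j) = D' $$ (i, j)" using *[of "n + i" "n + j"] carr by auto
  qed (use carr in auto)
qed

lemma block_diag_inject:
  assumes "block_diag A B = block_diag A' B'"
    "A \<in> carrier_mat n n" "A' \<in> carrier_mat n n" "B \<in> carrier_mat m m" "B' \<in> carrier_mat m m"
  shows "A = A'" "B = B'"
proof -
  have "dim_row A = n" "dim_col A = n" "dim_row A' = n" "dim_col A' = n"
    "dim_row B = m" "dim_col B = m" "dim_row B' = m" "dim_col B' = m" using assms by auto
  then show "A = A'" "B = B'"
    using four_block_mat_inject[OF assms(1)[unfolded block_diag_def], of n m] assms by auto
qed

lemma real_mat_mult:
  assumes "A \<in> carrier_mat n m" "B \<in> carrier_mat m k" "real_mat A" "real_mat B"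
  shows "real_mat (A * B)"
  using assms unfolding real_mat_def
  by (auto simp: index_mult_mat_sum simp del: index_mult_mat(1))

lemma real_mat_block_diag: "real_mat A \<Longrightarrow> real_mat B \<Longrightarrow> real_mat (block_diag A B)"
  unfolding real_mat_def block_diag_def by auto

lemma real_mat_adjoint:
  assumes "real_mat A"
  shows "mat_adjoint A = A\<^sup>T"
  using assms unfolding real_mat_def by (intro eq_matI) (auto simp: Reals_cnj_iff)

text \<open>The flag K selects the real case: a symmetric normal complex matrix has a real
  eigenvector, because conjugation preserves its eigenspaces.\<close>

lemma normal_diagonalization:
  fixes A :: "complex mat"
  assumes "A \<in> carrier_mat n n" "A * mat_adjoint A = mat_adjoint A * A" "K \<Longrightarrow> A\<^sup>T = A"
  shows "\<exists>Q d. unitary n Q \<and> A = Q * mat_diag n d * mat_adjoint Q \<and> (K \<longrightarrow> real_mat Q)"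
  using assms
proof (induction n arbitrary: A)
  case 0
  then show ?case
    by (intro exI[of _ "1\<^sub>m 0"] exI[of _ "\<lambda>_. 0"]) (auto simp: real_mat_def)
next
  case (Suc m)
  define n where "n = Suc m"
  note A = Suc.prems(1)[folded n_def]
  obtain u l where u: "u \<in> carrier_vec n" "u \<bullet>c u = 1" "A *\<^sub>v u = l \<cdot>\<^sub>v u"
    "mat_adjoint A *\<^sub>v u = cnj l \<cdot>\<^sub>v u" "K \<longrightarrow> conjugate u = u"
    using normal_eigenvector[OF A _ Suc.prems(2,3)] by (auto simp: n_def)
  have "orthonormal n (\<lambda>_. u) {0}" using u by (simp add: orthonormal_def)
  then obtain Q where Q: "unitary n Q" "\<forall>j<n. Q $$ (j, 0) = u $ j" "K \<longrightarrow> real_mat Q"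
    by (rule unitary_completion[of n _ _ K]) (use u in \<open>auto simp: n_def\<close>)
  note Qc = unitary_carrier[OF Q(1)]
  define e :: "complex vec" where "e = unit_vec n 0"
  have e: "e \<in> carrier_vec n" by (simp add: e_def)
  have Qe: "Q *\<^sub>v e = u"
    using Q u Qc by (intro eq_vecI) (auto simp: e_def n_def)
  define B where "B = mat_adjoint Q * A * Q"
  have B: "B \<in> carrier_mat n n" using A Qc by (simp add: B_def)
  have adjB: "mat_adjoint B = mat_adjoint Q * mat_adjoint A * Q"
    using A Qc by (simp add: B_def mat_adjoint_mult[of _ n n _ n] assoc_mult_mat[of _ n n _ n _ n])
  have AB: "A = Q * B * mat_adjoint Q"
    using A Q Qc by (simp add: B_def assoc_mult_mat[of _ n n _ n _ n] unitary_cancel_right[of n _ _ n] unitary_right)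
  have Be: "B *\<^sub>v e = l \<cdot>\<^sub>v e"
  proof -
    have "B *\<^sub>v e = mat_adjoint Q *\<^sub>v (A *\<^sub>v (Q *\<^sub>v e))"
      using A Qc e by (simp add: B_def assoc_mult_mat_vec[of _ n n _ n])
    also have "\<dots> = l \<cdot>\<^sub>v (mat_adjoint Q *\<^sub>v (Q *\<^sub>v e))"
      using Qc u Qe by (simp add: mult_mat_vec[of _ n n])
    also have "\<dots> = l \<cdot>\<^sub>v e"
      using Q Qc e by (simp add: assoc_mult_mat_vec[of _ n n _ n, symmetric] unitary_left)
    finally show ?thesis .
  qed
  have Be': "mat_adjoint B *\<^sub>v e = cnj l \<cdot>\<^sub>v e"
  proof -
    have "mat_adjoint B *\<^sub>v e = mat_adjoint Q *\<^sub>v (mat_adjoint A *\<^sub>v (Q *\<^sub>v e))"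
      using A Qc e by (simp add: adjB assoc_mult_mat_vec[of _ n n _ n])
    also have "\<dots> = cnj l \<cdot>\<^sub>v (mat_adjoint Q *\<^sub>v (Q *\<^sub>v e))"
      using Qc u Qe by (simp add: mult_mat_vec[of _ n n])
    also have "\<dots> = cnj l \<cdot>\<^sub>v e"
      using Q Qc e by (simp add: assoc_mult_mat_vec[of _ n n _ n, symmetric] unitary_left)
    finally show ?thesis .
  qed
  have B0: "B $$ (i, 0) = (if i = 0 then l else 0)" if "i < n" for i
    using arg_cong[OF Be, of "\<lambda>v. v $ i"] B that by (auto simp: e_def n_def)
  \<comment> \<open>The eigenvector equation of \<open>A\<close> cleared the first column of
    \<open>B\<close>; the one of the adjoint clears the first row, so that \<open>B\<close> splits
    into blocks.\<close>
  have B0': "B $$ (0, i) = (if i = 0 then l else 0)" if "i < n" for i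
  proof -
    have "cnj (B $$ (0, i)) = (if i = 0 then cnj l else 0)"
      using arg_cong[OF Be', of "\<lambda>v. v $ i"] B that by (auto simp: e_def n_def)
    then show ?thesis by (auto split: if_splits)
  qed
  define C where "C = mat m m (\<lambda>(i, j). B $$ (Suc i, Suc j))"
  define L where "L = mat 1 1 (\<lambda>_. l)"
  have C: "C \<in> carrier_mat m m" and L: "L \<in> carrier_mat 1 1" by (auto simp: C_def L_def)
  have BC: "B = block_diag L C"
    using B B0 B0' by (intro eq_matI) (auto simp: block_diag_def L_def C_def n_def)
  have "B * mat_adjoint B = mat_adjoint Q * (A * mat_adjoint A) * Q"
    unfolding adjB using A Q Qc
    by (simp add: B_def assoc_mult_mat[of _ n n _ n _ n] unitary_cancel_right[of n _ _ n])
  also have "\<dots> = mat_adjoint B * B"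
    unfolding adjB using A Q Qc
    by (simp add: B_def assoc_mult_mat[of _ n n _ n _ n] unitary_cancel_right[of n _ _ n] Suc.prems(2))
  finally have "block_diag (L * mat_adjoint L) (C * mat_adjoint C)
      = block_diag (mat_adjoint L * L) (mat_adjoint C * C)"
    using C L by (simp add: BC block_diag_adjoint block_diag_mult[of _ 1 _ m])
  from block_diag_inject(2)[OF this, of 1 m] have normC: "C * mat_adjoint C = mat_adjoint C * C"
    using C L by simp
  have CT: "C\<^sup>T = C" if K
  proof -
    have "A\<^sup>T = A" using Suc.prems(3) that by simp
    moreover have "mat_adjoint Q = Q\<^sup>T" using Q that by (simp add: real_mat_adjoint)
    ultimately have BT: "B\<^sup>T = B"
      using A Qc by (simp add: B_def transpose_mult[of _ n n _ n] assoc_mult_mat[of _ n n _ n _ n])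
    have "B $$ (j, i) = B $$ (i, j)" if "i < n" "j < n" for i j
      using arg_cong[OF BT, of "\<lambda>M. M $$ (i, j)"] that B by auto
    then show ?thesis by (intro eq_matI) (auto simp: C_def n_def)
  qed
  obtain R d where R: "unitary m R" "C = R * mat_diag m d * mat_adjoint R" "K \<longrightarrow> real_mat R"
    using Suc.IH[OF C normC CT] by blast
  note Rc = unitary_carrier[OF R(1)]
  define T where "T = block_diag (1\<^sub>m 1) R"
  have T: "unitary n T" "T \<in> carrier_mat n n"
    using block_diag_unitary[OF unitary_one R(1), of 1] by (auto simp: T_def n_def)
  have D: "block_diag L (mat_diag m d) = mat_diag n (\<lambda>i. if i = 0 then l else d (i - 1))"
    by (intro eq_matI) (auto simp: block_diag_def L_def mat_diag_def n_def)
  have "T * block_diag L (mat_diag m d) * mat_adjoint T = B"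
    unfolding T_def BC using L Rc R(2)
    by (simp add: block_diag_adjoint block_diag_mult[of _ 1 _ m])
  then have "A = Q * (T * mat_diag n (\<lambda>i. if i = 0 then l else d (i - 1)) * mat_adjoint T) * mat_adjoint Q"
    using AB by (simp add: D)
  also have "\<dots> = (Q * T) * mat_diag n (\<lambda>i. if i = 0 then l else d (i - 1)) * mat_adjoint (Q * T)"
    using T Qc by (simp add: mat_adjoint_mult[of _ n n _ n] assoc_mult_mat[of _ n n _ n _ n])
  finally have "A = (Q * T) * mat_diag n (\<lambda>i. if i = 0 then l else d (i - 1)) * mat_adjoint (Q * T)" .
  moreover have "unitary n (Q * T)" using Q T by (simp add: unitary_mult)
  moreover have "real_mat (Q * T)" if K
    using that Q R T(2) Qc unfolding T_def
    by (intro real_mat_mult[of _ n n _ n] real_mat_block_diag) (auto simp: real_mat_def n_def)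
  ultimately show ?case unfolding n_def by blast
qed

section \<open>Multiplexers, cosine-sine decomposition and demultiplexing\<close>

definition mat2 :: "complex \<Rightarrow> complex \<Rightarrow> complex \<Rightarrow> complex \<Rightarrow> complex mat" where
  "mat2 a b c d = mat 2 2 (\<lambda>(i, j). if i = 0 then (if j = 0 then a else b) else (if j = 0 then c else d))"

lemma mat2_carrier [simp]: "mat2 a b c d \<in> carrier_mat 2 2"
  by (simp add: mat2_def)

lemma mat2_dim [simp]: "dim_row (mat2 a b c d) = 2" "dim_col (mat2 a b c d) = 2"
  by (simp_all add: mat2_def)

lemma mat2_index [simp]:
  "mat2 a b c d $$ (0, 0) = a" "mat2 a b c d $$ (0, Suc 0) = b"
  "mat2 a b c d $$ (Suc 0, 0) = c" "mat2 a b c d $$ (Suc 0, Suc 0) = d"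
  by (simp_all add: mat2_def)

lemma mat2_eqI:
  assumes "A \<in> carrier_mat 2 2"
  shows "A = mat2 (A $$ (0, 0)) (A $$ (0, 1)) (A $$ (1, 0)) (A $$ (1, 1))"
  using assms by (intro eq_matI) (auto simp: less_2_cases_iff)

lemma mat2_mult [simp]:
  "mat2 a b c d * mat2 a' b' c' d' =
     mat2 (a * a' + b * c') (a * b' + b * d') (c * a' + d * c') (c * b' + d * d')"
  by (intro eq_matI)
     (auto simp: less_2_cases_iff index_mult_mat_sum lessThan_nat_numeral lessThan_Suc simp del: index_mult_mat(1))

lemma mat2_adjoint [simp]: "mat_adjoint (mat2 a b c d) = mat2 (cnj a) (cnj c) (cnj b) (cnj d)"
  by (intro eq_matI) (auto simp: less_2_cases_iff)

lemma mat2_one: "1\<^sub>m 2 = mat2 1 0 0 1"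
  by (intro eq_matI) (auto simp: less_2_cases_iff)

lemma mat2_inject [simp]:
  "mat2 a b c d = mat2 a' b' c' d' \<longleftrightarrow> a = a' \<and> b = b' \<and> c = c' \<and> d = d'"
  by (metis mat2_index)

text \<open>The matrix acting on the top qubit by u j, where j < N is the state of the other qubits.\<close>

definition mux :: "nat \<Rightarrow> (nat \<Rightarrow> complex mat) \<Rightarrow> complex mat" where
  "mux N u = four_block_mat
     (mat_diag N (\<lambda>j. u j $$ (0, 0))) (mat_diag N (\<lambda>j. u j $$ (0, 1)))
     (mat_diag N (\<lambda>j. u j $$ (1, 0))) (mat_diag N (\<lambda>j. u j $$ (1, 1)))"

lemma mux_carrier [simp]: "mux N u \<in> carrier_mat (N + N) (N + N)"
  by (simp add: mux_def)

lemma mat_diag_add: "mat_diag n f + mat_diag n g = mat_diag n (\<lambda>i. f i + g i :: complex)"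
  by (intro eq_matI) (auto simp: mat_diag_def)

text \<open>Reduces identities between multiplexers to identities between 2x2 matrices, one for each
  basis state of the lower qubits.\<close>

lemma mux_mult:
  assumes "\<And>j. u j \<in> carrier_mat 2 2" "\<And>j. v j \<in> carrier_mat 2 2"
  shows "mux N u * mux N v = mux N (\<lambda>j. u j * v j)"
proof -
  have "mux N u * mux N v = mux N (\<lambda>j. mat2 (u j $$ (0, 0)) (u j $$ (0, 1)) (u j $$ (1, 0)) (u j $$ (1, 1))
     * mat2 (v j $$ (0, 0)) (v j $$ (0, 1)) (v j $$ (1, 0)) (v j $$ (1, 1)))"
    unfolding mux_def
    by (subst mult_four_block_mat[of _ N N _ N _ N _ _ N _ N]) (auto simp: mat_diag_add)
  also have "\<dots> = mux N (\<lambda>j. u j * v j)"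
    by (simp only: mat2_eqI[OF assms(1), symmetric] mat2_eqI[OF assms(2), symmetric])
  finally show ?thesis .
qed

lemma mux_cong: "(\<And>j. j < N \<Longrightarrow> u j = v j) \<Longrightarrow> mux N u = mux N v"
  unfolding mux_def by (intro cong_four_block_mat) (auto simp: mat_diag_def)

lemma mux_one: "mux N (\<lambda>_. 1\<^sub>m 2) = 1\<^sub>m (N + N)"
proof -
  have "mat_diag N (\<lambda>_. 0 :: complex) = 0\<^sub>m N N" by (intro eq_matI) (auto simp: mat_diag_def)
  then show ?thesis by (simp add: mux_def mat2_one)
qed

lemma mux_adjoint:
  assumes "\<And>j. u j \<in> carrier_mat 2 2"
  shows "mat_adjoint (mux N u) = mux N (\<lambda>j. mat_adjoint (u j))"
proof -
  have "dim_row (u j) = 2" "dim_col (u j) = 2" for j using assms by auto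
  then show ?thesis by (intro eq_matI) (auto simp: mux_def mat_diag_def)
qed

lemma mux_unitary: "(\<And>j. unitary 2 (u j)) \<Longrightarrow> unitary (N + N) (mux N u)"
  by (simp add: unitary_def mux_adjoint mux_mult mux_one)

text \<open>A diagonal on the lower qubits is itself a multiplexer, whose 2x2 matrices are scalar
  and hence commute with everything. This is what lets diagonals travel through the multiplexed
  rotations.\<close>

lemma mux_commute_diag:
  assumes "\<And>j. u j \<in> carrier_mat 2 2"
  shows "mux N u * block_diag (mat_diag N d) (mat_diag N d)
    = block_diag (mat_diag N d) (mat_diag N d) * mux N u"
proof -
  have "block_diag (mat_diag N d) (mat_diag N d) = mux N (\<lambda>j. mat2 (d j) 0 0 (d j))"
    by (intro eq_matI) (auto simp: block_diag_def mux_def mat_diag_def)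
  then have "mux N u * block_diag (mat_diag N d) (mat_diag N d) = mux N (\<lambda>j. u j * mat2 (d j) 0 0 (d j))"
    "block_diag (mat_diag N d) (mat_diag N d) * mux N u = mux N (\<lambda>j. mat2 (d j) 0 0 (d j) * u j)"
    using assms by (auto simp: mux_mult)
  moreover have "u j * mat2 (d j) 0 0 (d j) = mat2 (d j) 0 0 (d j) * u j" for j
    by (subst (1 2) mat2_eqI[OF assms]) (simp add: mult.commute)
  ultimately show ?thesis by simp
qed

text \<open>Angles carry no factor 1/2: this is exp(i t Z), and \<open>ry t\<close> below is exp(-i
  t Y), the plane rotation by \<open>t\<close>.\<close>

definition rz :: "real \<Rightarrow> complex mat" where
  "rz t = mat2 (cis t) 0 0 (cis (- t))"

definition ry :: "real \<Rightarrow> complex mat" where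
  "ry t = mat2 (of_real (cos t)) (- of_real (sin t)) (of_real (sin t)) (of_real (cos t))"

lemma rz_unitary: "unitary 2 (rz t)"
  by (simp add: unitary_def rz_def mat2_one cis_cnj cis_mult)

lemma ry_unitary: "unitary 2 (ry t)"
  by (simp add: unitary_def ry_def mat2_one flip: of_real_mult of_real_add)
     (simp add: power2_eq_square[symmetric] mult.commute)

text \<open>The nonzero columns of \<open>P\<close>, divided by \<open>c i\<close>, are orthonormal
  and become columns of \<open>A\<close>. Where \<open>c i = 0\<close> the column of
  \<open>P\<close> is zero, so any completion will do there.\<close>

lemma orthogonal_columns:
  assumes P: "P \<in> carrier_mat n n" and c: "mat_adjoint P * P = mat_diag n (\<lambda>i. of_real (c i * c i))"
  obtains A where "unitary n A" "P = A * mat_diag n (\<lambda>i. of_real (c i))"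
proof -
  have PP: "(\<Sum>k<n. cnj (P $$ (k, i)) * P $$ (k, j)) = (if i = j then of_real (c i * c i) else 0)"
    if "i < n" "j < n" for i j
  proof -
    have "(mat_adjoint P * P) $$ (i, j) = (\<Sum>k<n. cnj (P $$ (k, i)) * P $$ (k, j))"
      using P that by (simp add: index_mult_mat_sum del: index_mult_mat(1))
    then show ?thesis using that by (auto simp: c mat_diag_def)
  qed
  define S where "S = {i. i < n \<and> c i \<noteq> 0}"
  define f where "f i = vec n (\<lambda>k. P $$ (k, i) / complex_of_real (c i))" for i
  have "f i \<bullet>c f j = (if i = j then 1 else 0)" if "i \<in> S" "j \<in> S" for i j
  proof -
    have "f i \<bullet>c f j = (\<Sum>k<n. cnj (P $$ (k, j)) * P $$ (k, i)) / (of_real (c i) * of_real (c j))"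
      by (simp add: f_def scalar_prod_def atLeast0LessThan conjugate_complex_def sum_divide_distrib mult.commute)
    then show ?thesis using that by (auto simp: PP S_def)
  qed
  then have "orthonormal n f S" by (auto simp: orthonormal_def f_def)
  then obtain A where A: "unitary n A" "\<forall>i\<in>S. \<forall>j<n. A $$ (j, i) = f i $ j"
    by (rule unitary_completion[of n f S False]) (auto simp: S_def)
  note Ac = unitary_carrier[OF A(1)]
  have "P $$ (k, i) = A $$ (k, i) * of_real (c i)" if "k < n" "i < n" for k i
  proof (cases "c i = 0")
    case False
    then show ?thesis using A(2) that by (auto simp: S_def f_def)
  next
    case True
    have "complex_of_real (\<Sum>k<n. (cmod (P $$ (k, i)))\<^sup>2) = (\<Sum>k<n. cnj (P $$ (k, i)) * P $$ (k, i))"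
      by (simp only: of_real_sum complex_norm_square mult.commute)
    also have "\<dots> = 0" using PP[of i i] that True by simp
    finally have "(\<Sum>k<n. (cmod (P $$ (k, i)))\<^sup>2) = 0" using of_real_eq_0_iff by blast
    then have "cmod (P $$ (k, i)) = 0" using that(1) by (subst (asm) sum_nonneg_eq_0_iff) auto
    then show ?thesis using True by simp
  qed
  then have "P = A * mat_diag n (\<lambda>i. of_real (c i))"
    using P Ac by (subst mat_diag_mult_right[OF Ac]) (auto intro!: eq_matI)
  with A(1) that show ?thesis by blast
qed

lemma column_norms:
  fixes P :: "complex mat"
  assumes P: "P \<in> carrier_mat n n" and d: "mat_adjoint P * P = mat_diag n d"
  obtains c where "\<And>i. i < n \<Longrightarrow> d i = of_real (c i * c i)" "\<And>i. c i \<ge> (0 :: real)"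
proof -
  define c where "c i = sqrt (\<Sum>k<n. (cmod (P $$ (k, i)))\<^sup>2)" for i
  have "d i = of_real (c i * c i)" if "i < n" for i
  proof -
    have "d i = (mat_adjoint P * P) $$ (i, i)" using that by (simp add: d mat_diag_def)
    also have "\<dots> = (\<Sum>k<n. cnj (P $$ (k, i)) * P $$ (k, i))"
      using P that by (simp add: index_mult_mat_sum del: index_mult_mat(1))
    also have "\<dots> = of_real (\<Sum>k<n. (cmod (P $$ (k, i)))\<^sup>2)"
      by (simp only: of_real_sum complex_norm_square mult.commute)
    also have "\<dots> = of_real (c i * c i)" by (simp add: c_def sum_nonneg)
    finally show ?thesis .
  qed
  moreover have "c i \<ge> 0" for i by (simp add: c_def sum_nonneg)
  ultimately show ?thesis by (rule that)
qed

lemma unit_complex_cis: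
  assumes "cmod z = 1"
  obtains t where "z = cis t"
  using assms rcis_Ex[of z] that
  by (metis cis_rcis_eq rcis_cmod_Arg)

lemma four_block_mat_adjoint:
  fixes A :: "complex mat"
  assumes "A \<in> carrier_mat n n" "B \<in> carrier_mat n m" "C \<in> carrier_mat m n" "D \<in> carrier_mat m m"
  shows "mat_adjoint (four_block_mat A B C D)
    = four_block_mat (mat_adjoint A) (mat_adjoint C) (mat_adjoint B) (mat_adjoint D)"
  using assms by (intro eq_matI) auto

lemma four_block_mat_ex:
  assumes "U \<in> carrier_mat (n + m) (n + m)"
  obtains A B C D where "U = four_block_mat A B C D"
    "A \<in> carrier_mat n n" "B \<in> carrier_mat n m" "C \<in> carrier_mat m n" "D \<in> carrier_mat m m"
  by (rule that[of "mat n n (\<lambda>(i, j). U $$ (i, j))" "mat n m (\<lambda>(i, j). U $$ (i, j + n))"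
        "mat m n (\<lambda>(i, j). U $$ (i + n, j))" "mat m m (\<lambda>(i, j). U $$ (i + n, j + n))"])
     (use assms in \<open>auto intro!: eq_matI\<close>)

text \<open>With \<open>C\<close> zero, the upper right block of U*U = 1 reads A*B = 0, and
  \<open>A\<close> is invertible; so \<open>B\<close> vanishes too.\<close>

lemma unitary_block_diagI:
  assumes U: "unitary (n + m) (four_block_mat A B C D)" and C: "C = 0\<^sub>m m n" and A: "unitary n A"
    and carr: "B \<in> carrier_mat n m" "D \<in> carrier_mat m m"
  shows "four_block_mat A B C D = block_diag A D" "unitary m D"
proof -
  note Ac = unitary_carrier[OF A]
  have "four_block_mat (mat_adjoint A * A) (mat_adjoint A * B)
      (mat_adjoint B * A) (mat_adjoint B * B + mat_adjoint D * D) = four_block_mat (1\<^sub>m n) (0\<^sub>m n m) (0\<^sub>m m n) (1\<^sub>m m)"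
    (is "?L = _")
  proof -
    have Z: "mat_adjoint (0\<^sub>m m n) = (0\<^sub>m n m :: complex mat)" by (intro eq_matI) auto
    have "?L = mat_adjoint (four_block_mat A B C D) * four_block_mat A B C D"
      using Ac carr unfolding C
      by (subst four_block_mat_adjoint[of _ n _ m], simp_all add: Z)
         (subst mult_four_block_mat[of _ n n _ m _ m _ _ n _ m],
          simp_all add: Z right_add_zero_mat[of _ n m] right_add_zero_mat[of _ m n]
            mult_carrier_mat[of _ n n _ m] mult_carrier_mat[of _ m n _ n])
    then show ?thesis using U by (simp add: unitary_def)
  qed
  note eqs = four_block_mat_inject[OF this, of n m]
  have "mat_adjoint A * B = 0\<^sub>m n m" by (rule eqs) (use Ac carr in auto)
  then have "A * (mat_adjoint A * B) = 0\<^sub>m n m" using Ac by simp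
  then have B: "B = 0\<^sub>m n m" using unitary_cancel_right[OF A carr(1)] by simp
  show "four_block_mat A B C D = block_diag A D"
    using Ac carr by (simp add: block_diag_def B C)
  have "mat_adjoint B * B + mat_adjoint D * D = 1\<^sub>m m" by (rule eqs) (use Ac carr in auto)
  moreover have "mat_adjoint B * B = 0\<^sub>m m m" unfolding B by (intro eq_matI) (auto simp: scalar_prod_def)
  ultimately show "unitary m D" using carr by (simp add: unitary_def)
qed

text \<open>Only the left half of U has to be decomposed; unitarity forces the shape of the right half.\<close>

lemma cosine_sine_decomposition:
  assumes U: "unitary (n + n) U"
  obtains A0 A1 B0 B1 t where "unitary n A0" "unitary n A1" "unitary n B0" "unitary n B1"
    "U = block_diag A0 A1 * mux n (\<lambda>j. ry (t j)) * block_diag B0 B1"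
proof -
  note Uc = unitary_carrier[OF U]
  obtain U0 X U1 Y where Ublk: "U = four_block_mat U0 X U1 Y"
    and carr: "U0 \<in> carrier_mat n n" "X \<in> carrier_mat n n" "U1 \<in> carrier_mat n n" "Y \<in> carrier_mat n n"
    using four_block_mat_ex[OF Uc] by blast
  have "four_block_mat (mat_adjoint U0 * U0 + mat_adjoint U1 * U1) (mat_adjoint U0 * X + mat_adjoint U1 * Y)
      (mat_adjoint X * U0 + mat_adjoint Y * U1) (mat_adjoint X * X + mat_adjoint Y * Y)
      = four_block_mat (1\<^sub>m n) (0\<^sub>m n n) (0\<^sub>m n n) (1\<^sub>m n)" (is "?L = _")
  proof -
    have "?L = mat_adjoint U * U"
      using carr unfolding Ublk
      by (subst four_block_mat_adjoint[of _ n _ n], simp_all)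
         (subst mult_four_block_mat[of _ n n _ n _ n _ _ n _ n], simp_all)
    then show ?thesis using U by (simp add: unitary_def)
  qed
  from four_block_mat_inject(1)[OF this, of n n]
  have iso: "mat_adjoint U0 * U0 + mat_adjoint U1 * U1 = 1\<^sub>m n" using carr by simp
  \<comment> \<open>One \<open>Q\<close> serves both blocks of the left half: U1*U1 = 1 - U0*U0 is
    diagonal in the same basis, and the two diagonals, being squared column norms that add up to 1,
    are squared cosines and sines.\<close>
  have "(mat_adjoint U0 * U0) * mat_adjoint (mat_adjoint U0 * U0) = mat_adjoint (mat_adjoint U0 * U0) * (mat_adjoint U0 * U0)"
    using carr by (simp add: mat_adjoint_mult[of _ n n _ n])
  from normal_diagonalization[OF _ this, of n False] carr
  obtain Q d where Q: "unitary n Q" "mat_adjoint U0 * U0 = Q * mat_diag n d * mat_adjoint Q" by auto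
  note Qc = unitary_carrier[OF Q(1)]
  have P0: "mat_adjoint (U0 * Q) * (U0 * Q) = mat_diag n d"
  proof -
    have "mat_adjoint (U0 * Q) * (U0 * Q) = mat_adjoint Q * (mat_adjoint U0 * U0) * Q"
      using carr Qc by (simp add: mat_adjoint_mult[of _ n n _ n] assoc_mult_mat[of _ n n _ n _ n])
    then show ?thesis unfolding Q(2) using Q Qc
      by (simp add: assoc_mult_mat[of _ n n _ n _ n] unitary_cancel_left[of n _ _ n] unitary_left
          right_mult_one_mat[of _ n n])
  qed
  have P1: "mat_adjoint (U1 * Q) * (U1 * Q) = mat_diag n (\<lambda>i. 1 - d i)"
  proof -
    have "mat_adjoint (U0 * Q) * (U0 * Q) + mat_adjoint (U1 * Q) * (U1 * Q)
      = mat_adjoint Q * (mat_adjoint U0 * U0 + mat_adjoint U1 * U1) * Q"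
      using carr Qc by (simp add: mat_adjoint_mult[of _ n n _ n] assoc_mult_mat[of _ n n _ n _ n]
          mult_add_distrib_mat[of _ n n _ n] add_mult_distrib_mat[of _ n n _ _ n])
    also have "\<dots> = 1\<^sub>m n"
      unfolding iso using Q(1) Qc by (simp add: unitary_left right_mult_one_mat[of _ n n])
    finally have *: "mat_diag n d + mat_adjoint (U1 * Q) * (U1 * Q) = 1\<^sub>m n" by (simp only: P0)
    have c: "mat_adjoint (U1 * Q) * (U1 * Q) \<in> carrier_mat n n" using carr Qc by simp
    show ?thesis
    proof (rule eq_matI)
      fix i j assume "i < dim_row (mat_diag n (\<lambda>i. 1 - d i))" "j < dim_col (mat_diag n (\<lambda>i. 1 - d i))"
      then have ij: "i < n" "j < n" by (auto simp: mat_diag_def)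
      have "(mat_diag n d + mat_adjoint (U1 * Q) * (U1 * Q)) $$ (i, j) = 1\<^sub>m n $$ (i, j)" by (simp only: *)
      then have "mat_diag n d $$ (i, j) + (mat_adjoint (U1 * Q) * (U1 * Q)) $$ (i, j) = (if i = j then 1 else 0)"
        using ij c carr Qc by (subst (asm) index_add_mat) auto
      then show "(mat_adjoint (U1 * Q) * (U1 * Q)) $$ (i, j) = mat_diag n (\<lambda>i. 1 - d i) $$ (i, j)"
        using ij by (auto simp: mat_diag_def eq_diff_eq add.commute simp del: index_mult_mat(1))
    qed (use c Qc in \<open>auto simp: mat_diag_def\<close>)
  qed
  obtain c where c: "\<And>i. i < n \<Longrightarrow> d i = of_real (c i * c i)" "\<And>i. c i \<ge> (0 :: real)"
    using column_norms[OF _ P0] carr Qc by auto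
  obtain s where s: "\<And>i. i < n \<Longrightarrow> 1 - d i = of_real (s i * s i)" "\<And>i. s i \<ge> (0 :: real)"
    using column_norms[OF _ P1] carr Qc by auto
  have "\<exists>t. i < n \<longrightarrow> c i = cos t \<and> s i = sin t" for i
  proof (cases "i < n")
    case True
    have "complex_of_real (c i * c i + s i * s i) = of_real 1" using c(1)[OF True] s(1)[OF True] by (simp add: diff_eq_eq add.commute)
    then have "c i * c i + s i * s i = 1" by (simp only: of_real_eq_iff)
    then have "(c i)\<^sup>2 + (s i)\<^sup>2 = 1" by (simp add: power2_eq_square)
    then show ?thesis using sincos_total_2pi_le by blast
  qed simp
  then obtain t where t: "\<And>i. i < n \<Longrightarrow> c i = cos (t i)" "\<And>i. i < n \<Longrightarrow> s i = sin (t i)" by metis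
  have "mat_diag n d = mat_diag n (\<lambda>i. of_real (c i * c i))"
    by (rule eq_matI) (use c(1) in \<open>simp_all add: mat_diag_def\<close>)
  note P0' = P0[unfolded this]
  have "mat_diag n (\<lambda>i. 1 - d i) = mat_diag n (\<lambda>i. of_real (s i * s i))"
    by (rule eq_matI) (use s(1) in \<open>simp_all add: mat_diag_def\<close>)
  note P1' = P1[unfolded this]
  obtain A0 where A0: "unitary n A0" "U0 * Q = A0 * mat_diag n (\<lambda>i. of_real (c i))"
    using orthogonal_columns[OF mult_carrier_square[OF carr(1) Qc] P0'] by blast
  obtain A1 where A1: "unitary n A1" "U1 * Q = A1 * mat_diag n (\<lambda>i. of_real (s i))"
    using orthogonal_columns[OF mult_carrier_square[OF carr(3) Qc] P1'] by blast
  note Ac = unitary_carrier[OF A0(1)] unitary_carrier[OF A1(1)]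
  define C where "C = mat_diag n (\<lambda>i. complex_of_real (c i))"
  define S where "S = mat_diag n (\<lambda>i. complex_of_real (s i))"
  define nS where "nS = mat_diag n (\<lambda>i. - complex_of_real (s i))"
  have CS: "C \<in> carrier_mat n n" "S \<in> carrier_mat n n" "nS \<in> carrier_mat n n"
    by (auto simp: C_def S_def nS_def)
  define R where "R = mux n (\<lambda>j. ry (t j))"
  have R: "unitary (n + n) R" by (simp add: R_def mux_unitary ry_unitary)
  note Rc = unitary_carrier[OF R]
  have "mat_adjoint R = mux n (\<lambda>j. mat_adjoint (ry (t j)))"
    unfolding R_def by (rule mux_adjoint) (simp add: ry_def)
  then have adjR: "mat_adjoint R = four_block_mat C S nS C"
    using t by (auto simp: mux_def ry_def C_def S_def nS_def mat_diag_def intro!: cong_four_block_mat)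
  define AA where "AA = block_diag A0 A1"
  have AA: "unitary (n + n) AA" using A0 A1 by (simp add: AA_def block_diag_unitary)
  note AAc = unitary_carrier[OF AA]
  define Z where "Z = mat_adjoint A0 * X"
  define W where "W = mat_adjoint A1 * Y"
  have ZW: "Z \<in> carrier_mat n n" "W \<in> carrier_mat n n" using Ac carr by (auto simp: Z_def W_def)
  have U0: "U0 = A0 * (C * mat_adjoint Q)" and U1: "U1 = A1 * (S * mat_adjoint Q)"
  proof -
    have "U0 * (Q * mat_adjoint Q) = A0 * C * mat_adjoint Q" "U1 * (Q * mat_adjoint Q) = A1 * S * mat_adjoint Q"
      using A0 A1 carr Qc by (simp_all add: C_def S_def flip: assoc_mult_mat[of _ n n _ n _ n])
    then show "U0 = A0 * (C * mat_adjoint Q)" "U1 = A1 * (S * mat_adjoint Q)"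
      using Q Qc carr Ac CS by (simp_all add: unitary_right assoc_mult_mat[of _ n n _ n _ n])
  qed
  have "mat_adjoint AA * U = four_block_mat (C * mat_adjoint Q) Z (S * mat_adjoint Q) W"
  proof -
    have "mat_adjoint AA * U = four_block_mat (mat_adjoint A0 * U0) (mat_adjoint A0 * X)
        (mat_adjoint A1 * U1) (mat_adjoint A1 * Y)"
      unfolding AA_def block_diag_adjoint Ublk using Ac carr
      by (simp add: block_diag_def) (subst mult_four_block_mat[of _ n n _ n _ n _ _ n _ n], simp_all)
    then show ?thesis unfolding Z_def W_def U0 U1 using A0 A1 Qc CS by (simp add: unitary_cancel_left[of n _ _ n])
  qed
  \<comment> \<open>Removing \<open>AA\<close> and the rotation from the left leaves a unitary whose
    left half is the adjoint of \<open>Q\<close> above a zero block, so it must be block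
    diagonal.\<close>
  then have RAU: "mat_adjoint R * (mat_adjoint AA * U) = four_block_mat
      (C * (C * mat_adjoint Q) + S * (S * mat_adjoint Q)) (C * Z + S * W)
      (nS * (C * mat_adjoint Q) + C * (S * mat_adjoint Q)) (nS * Z + C * W)"
    unfolding adjR using CS ZW Qc by (simp add: mult_four_block_mat[of _ n n _ n _ n _ _ n _ n])
  have "C * (C * mat_adjoint Q) + S * (S * mat_adjoint Q) = (C * C + S * S) * mat_adjoint Q"
    using CS Qc by (simp add: add_mult_distrib_mat[of _ n n _ _ n] assoc_mult_mat[of _ n n _ n _ n])
  also have "C * C + S * S = mat_diag n (\<lambda>_. 1)"
    unfolding C_def S_def mat_diag_diag mat_diag_add of_real_mult[symmetric]
    by (rule eq_matI) (use c(1)[symmetric] s(1)[symmetric] in \<open>simp_all add: mat_diag_def del: of_real_mult\<close>)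
  finally have TL: "C * (C * mat_adjoint Q) + S * (S * mat_adjoint Q) = mat_adjoint Q" using Qc by simp
  have "nS * (C * mat_adjoint Q) + C * (S * mat_adjoint Q) = (nS * C + C * S) * mat_adjoint Q"
    using CS Qc by (simp add: add_mult_distrib_mat[of _ n n _ _ n] assoc_mult_mat[of _ n n _ n _ n])
  also have "nS * C + C * S = 0\<^sub>m n n"
    unfolding C_def S_def nS_def mat_diag_diag mat_diag_add by (intro eq_matI) (auto simp: mat_diag_def)
  finally have BL: "nS * (C * mat_adjoint Q) + C * (S * mat_adjoint Q) = 0\<^sub>m n n" using Qc by simp
  define B1 where "B1 = nS * Z + C * W"
  have B1c: "B1 \<in> carrier_mat n n" using CS ZW by (simp add: B1_def)
  have RAU': "mat_adjoint R * (mat_adjoint AA * U) = four_block_mat (mat_adjoint Q) (C * Z + S * W) (0\<^sub>m n n) B1"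
    by (simp only: RAU TL BL B1_def)
  have "unitary (n + n) (mat_adjoint R * (mat_adjoint AA * U))"
    using R AA U by (intro unitary_mult unitary_adjoint)
  then have un: "unitary (n + n) (four_block_mat (mat_adjoint Q) (C * Z + S * W) (0\<^sub>m n n) B1)"
    by (simp only: RAU')
  note bd = unitary_block_diagI[OF un refl unitary_adjoint[OF Q(1)] _ B1c]
  have "U = AA * (R * (mat_adjoint R * (mat_adjoint AA * U)))"
    using R AA Uc AAc by (simp add: unitary_cancel_right[of "n + n" _ _ "n + n"])
  also have "\<dots> = AA * R * block_diag (mat_adjoint Q) B1"
    using bd(1) CS ZW AAc Rc Qc B1c unfolding RAU'
    by (simp add: assoc_mult_mat[of _ "n + n" "n + n" _ "n + n" _ "n + n"])
  finally have "U = AA * R * block_diag (mat_adjoint Q) B1" .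
  moreover have "unitary n B1" using bd(2) CS ZW by simp
  ultimately show ?thesis
    using that A0(1) A1(1) unitary_adjoint[OF Q(1)] unfolding AA_def R_def by blast
qed

text \<open>The ansatz A0 = V D W and A1 = V D* W forces A0 A1* = V D^2 V*. So \<open>V\<close>
  diagonalizes A0 A1*, \<open>D\<close> takes half the angles of its unit eigenvalues,
  \<open>W\<close> is solved from the first equation, and the second then holds
  automatically.\<close>

lemma demultiplexing:
  assumes A: "unitary n A0" "unitary n A1"
  obtains V W t where "unitary n V" "unitary n W"
    "block_diag A0 A1 = block_diag V V * mux n (\<lambda>j. rz (t j)) * block_diag W W"
proof -
  note Ac = unitary_carrier[OF A(1)] unitary_carrier[OF A(2)]
  define M where "M = A0 * mat_adjoint A1"
  have M: "unitary n M" using A by (simp add: M_def unitary_mult unitary_adjoint)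
  note Mc = unitary_carrier[OF M]
  obtain V d where V: "unitary n V" "M = V * mat_diag n d * mat_adjoint V"
    using normal_diagonalization[OF Mc, of False] M by (auto simp: unitary_left unitary_right)
  note Vc = unitary_carrier[OF V(1)]
  have "mat_adjoint V * M * V = mat_diag n d"
    using V Vc by (simp add: assoc_mult_mat[of _ n n _ n _ n] unitary_cancel_left[of n _ _ n] unitary_left
        right_mult_one_mat[of _ n n])
  then have dun: "unitary n (mat_diag n d)"
    using V M by (metis unitary_mult unitary_adjoint)
  have "\<exists>t. i < n \<longrightarrow> d i = cis t * cis t" for i
  proof (cases "i < n")
    case True
    obtain t where "d i = cis t" using unit_complex_cis unitary_diag_entries[OF dun True] by blast
    then have "d i = cis (t / 2) * cis (t / 2)" by (simp add: cis_mult)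
    then show ?thesis by blast
  qed simp
  then obtain t where t: "\<And>i. i < n \<Longrightarrow> d i = cis (t i) * cis (t i)" by metis
  define D where "D = mat_diag n (\<lambda>i. cis (t i))"
  define D' where "D' = mat_diag n (\<lambda>i. cis (- t i))"
  have D: "unitary n D" "unitary n D'" by (auto simp: D_def D'_def intro!: unitary_diag)
  have D': "D' = mat_adjoint D" by (simp add: D_def D'_def cis_cnj)
  have DD: "mat_diag n d = D * D" using t by (auto simp: D_def mat_diag_diag) (auto simp: mat_diag_def)
  note Dc = unitary_carrier[OF D(1)] unitary_carrier[OF D(2)]
  define W where "W = D' * (mat_adjoint V * A0)"
  have W: "unitary n W" using D V A by (simp add: W_def unitary_mult unitary_adjoint)
  note Wc = unitary_carrier[OF W]
  have "V * D * W = A0"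
    using D V Dc Vc Ac by (simp add: W_def D' assoc_mult_mat[of _ n n _ n _ n] unitary_cancel_right[of n _ _ n])
  moreover have "V * D' * W = A1"
  proof -
    have "V * D' * W = mat_adjoint M * A0"
      using Dc Vc Ac unfolding V(2) DD
      by (simp add: W_def D' assoc_mult_mat[of _ n n _ n _ n] mat_adjoint_mult[of _ n n _ n])
    also have "\<dots> = A1"
      using A Ac by (simp add: M_def assoc_mult_mat[of _ n n _ n _ n] mat_adjoint_mult[of _ n n _ n] unitary_left
          right_mult_one_mat[of _ n n])
    finally show ?thesis .
  qed
  moreover have "mux n (\<lambda>j. rz (t j)) = block_diag D D'"
    by (intro eq_matI) (auto simp: mux_def rz_def D_def D'_def block_diag_def mat_diag_def)
  ultimately have "block_diag A0 A1 = block_diag V V * mux n (\<lambda>j. rz (t j)) * block_diag W W"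
    using Vc Dc Wc by (simp add: block_diag_mult[of _ n _ n])
  then show ?thesis using that V(1) W by blast
qed

section \<open>Gates on the top qubit and uniformly controlled rotations\<close>

lemma qbit_less_2 [simp]: "qbit i k < 2"
  by (simp add: qbit_def)

lemma qbit_top_0: "i < 2 ^ n \<Longrightarrow> n \<le> l \<Longrightarrow> qbit i l = 0"
  using power_increasing[of n l "2 :: nat"] by (simp add: qbit_def order.strict_trans2)

lemma qbit_add_power:
  assumes "i < 2 ^ n"
  shows "qbit (i + 2 ^ n) l = (if l = n then 1 else qbit i l)"
proof -
  consider "l < n" | "l = n" | "l > n" by linarith
  then show ?thesis
  proof cases
    case 1
    have "(2 :: nat) ^ n = 2 ^ l * 2 ^ (n - l)" using 1 by (simp flip: power_add)
    then have "(i + 2 ^ n) div 2 ^ l = i div 2 ^ l + 2 ^ (n - l)" by simp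
    moreover have "even ((2 :: nat) ^ (n - l))" using 1 by simp
    ultimately show ?thesis using 1 by (auto simp: qbit_def mod2_eq_if)
  next
    case 2
    then show ?thesis using assms by (simp add: qbit_def)
  next
    case 3
    have "(2 :: nat) ^ Suc n \<le> 2 ^ l" using 3 by (intro power_increasing) auto
    then have "i + 2 ^ n < 2 ^ l" "i < 2 ^ l" using assms by auto
    then show ?thesis using 3 by (simp add: qbit_def)
  qed
qed

lemma qbit_mod: "l < k \<Longrightarrow> qbit (j mod 2 ^ k) l = qbit j l"
  by (simp add: qbit_def take_bit_eq_mod[symmetric] drop_bit_eq_div[symmetric] drop_bit_take_bit)
     (simp add: take_bit_eq_mod mod_mod_cancel le_imp_power_dvd[of 1, simplified])

lemma mod_power_Suc_qbit: "j mod 2 ^ Suc k = j mod 2 ^ k + 2 ^ k * qbit j k"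
  using mod_mult2_eq[of j "2 ^ k" 2] by (simp add: qbit_def mult.commute)

lemma qbit_ext:
  assumes "i < 2 ^ n" "j < 2 ^ n" "\<And>l. l < n \<Longrightarrow> qbit i l = qbit j l"
  shows "i = j"
proof -
  have "i mod 2 ^ k = j mod 2 ^ k" if "k \<le> n" for k
    using that
  proof (induction k)
    case (Suc k)
    then show ?case using assms(3)[of k] unfolding mod_power_Suc_qbit by simp
  qed simp
  from this[of n] show ?thesis using assms by simp
qed

lemma flip_bit_less:
  assumes "j < 2 ^ n" "t < n"
  shows "flip_bit j t < 2 ^ n"
proof (cases "qbit j t = 0")
  case True
  define q where "q = j div 2 ^ t"
  have n: "(2 :: nat) ^ n = 2 ^ t * 2 ^ (n - t)" using assms(2) by (simp flip: power_add)
  have "j < 2 ^ (n - t) * 2 ^ t" using assms(1) by (simp only: n mult.commute)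
  then have "q < 2 ^ (n - t)" by (simp add: q_def less_mult_imp_div_less)
  moreover have "even q" using True by (simp add: q_def qbit_def even_iff_mod_2_eq_zero)
  moreover have "even ((2 :: nat) ^ (n - t))" using assms(2) by simp
  \<comment> \<open>An even number below an even bound leaves room for its successor, which is the
    value of the upper bits once bit \<open>t\<close> is set.\<close>
  ultimately have "Suc q < 2 ^ (n - t)" by (metis Suc_lessI even_Suc)
  then have "2 ^ t * Suc (Suc q) \<le> 2 ^ n" unfolding n by (intro mult_le_mono2) simp
  moreover have "j < 2 ^ t * Suc q" using dividend_less_times_div[of "2 ^ t" j] by (simp add: q_def)
  ultimately show ?thesis using True by (simp add: flip_bit_def)
next
  case False
  then show ?thesis using assms(1) by (auto simp: flip_bit_def)
qed

lemma flip_bit_add_power: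
  assumes "j < 2 ^ n" "t < n"
  shows "flip_bit (j + 2 ^ n) t = flip_bit j t + 2 ^ n"
proof -
  have "2 ^ t \<le> j" if "qbit j t \<noteq> 0"
    using that by (rule contrapos_np) (simp add: qbit_def)
  then show ?thesis using assms by (auto simp: flip_bit_def qbit_add_power)
qed

section \<open>Gates below and on an added top qubit\<close>

lemma gate_mat_carrier [simp]: "gate_mat n g \<in> carrier_mat (2 ^ n) (2 ^ n)"
  by (cases g) (auto simp: single_qubit_mat_def cnot_mat_def)

lemma index_split:
  fixes i :: nat
  assumes "i < N + N"
  obtains i' where "i' < N" "i = i' \<or> i = i' + N"
  using assms that[of i] that[of "i - N"] by (cases "i < N") auto

lemma block_diag_index:
  assumes "i < N" "j < N" "A \<in> carrier_mat N N" "B \<in> carrier_mat N N"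
  shows "block_diag A B $$ (i, j) = A $$ (i, j)" "block_diag A B $$ (i, j + N) = 0"
    "block_diag A B $$ (i + N, j) = 0" "block_diag A B $$ (i + N, j + N) = B $$ (i, j)"
  using assms by (auto simp: block_diag_def)

lemma single_qubit_mat_index:
  assumes "i < 2 ^ n" "j < 2 ^ n"
  shows "single_qubit_mat n k u $$ (i, j)
    = (if \<forall>l. l \<noteq> k \<longrightarrow> qbit i l = qbit j l then u $$ (qbit i k, qbit j k) else 0)"
  using assms by (simp add: single_qubit_mat_def)

lemma single_qubit_mat_lift:
  assumes "k < n"
  shows "single_qubit_mat (Suc n) k u = block_diag (single_qubit_mat n k u) (single_qubit_mat n k u)"
proof (rule eq_matI)
  fix i j
  assume "i < dim_row (block_diag (single_qubit_mat n k u) (single_qubit_mat n k u))"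
    "j < dim_col (block_diag (single_qubit_mat n k u) (single_qubit_mat n k u))"
  then have ij: "i < 2 ^ n + 2 ^ n" "j < 2 ^ n + 2 ^ n"
    by (auto simp: block_diag_def single_qubit_mat_def)
  obtain i' where i': "i' < 2 ^ n" "i = i' \<or> i = i' + 2 ^ n" using index_split[OF ij(1)] by blast
  obtain j' where j': "j' < 2 ^ n" "j = j' \<or> j = j' + 2 ^ n" using index_split[OF ij(2)] by blast
  have top: "qbit i' n = 0" "qbit j' n = 0" using i' j' by (auto simp: qbit_top_0)
  have both: "(\<forall>l. l \<noteq> k \<longrightarrow> qbit (i' + 2 ^ n) l = qbit (j' + 2 ^ n) l)
      \<longleftrightarrow> (\<forall>l. l \<noteq> k \<longrightarrow> qbit i' l = qbit j' l)"
    using top by (simp add: qbit_add_power[OF i'(1)] qbit_add_power[OF j'(1)]) metis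
  have one: "\<not> (\<forall>l. l \<noteq> k \<longrightarrow> qbit (i' + 2 ^ n) l = qbit j' l)"
    "\<not> (\<forall>l. l \<noteq> k \<longrightarrow> qbit i' l = qbit (j' + 2 ^ n) l)"
    using i'(1) j'(1) top assms by (auto simp: qbit_add_power intro!: exI[of _ n])
  have c: "single_qubit_mat n k u \<in> carrier_mat (2 ^ n) (2 ^ n)" by (simp add: single_qubit_mat_def)
  show "single_qubit_mat (Suc n) k u $$ (i, j)
    = block_diag (single_qubit_mat n k u) (single_qubit_mat n k u) $$ (i, j)"
    using i'(2) j'(2) ij i'(1) j'(1) assms
    by (elim disjE) (simp_all add: block_diag_index[OF i'(1) j'(1) c c] single_qubit_mat_index both one
        qbit_add_power[OF i'(1), of k] qbit_add_power[OF j'(1), of k], blast)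
qed (auto simp: single_qubit_mat_def block_diag_def)

lemma cnot_mat_lift:
  assumes "c < n" "t < n"
  shows "cnot_mat (Suc n) c t = block_diag (cnot_mat n c t) (cnot_mat n c t)"
proof (rule eq_matI)
  fix i j
  assume "i < dim_row (block_diag (cnot_mat n c t) (cnot_mat n c t))"
    "j < dim_col (block_diag (cnot_mat n c t) (cnot_mat n c t))"
  then have ij: "i < 2 ^ n + 2 ^ n" "j < 2 ^ n + 2 ^ n"
    by (auto simp: block_diag_def cnot_mat_def)
  obtain i' where i': "i' < 2 ^ n" "i = i' \<or> i = i' + 2 ^ n" using index_split[OF ij(1)] by blast
  obtain j' where j': "j' < 2 ^ n" "j = j' \<or> j = j' + 2 ^ n" using index_split[OF ij(2)] by blast
  have fl: "flip_bit j' t < 2 ^ n" using j' assms by (simp add: flip_bit_less)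
  show "cnot_mat (Suc n) c t $$ (i, j) = block_diag (cnot_mat n c t) (cnot_mat n c t) $$ (i, j)"
    using i' j' fl assms
    by (auto simp: cnot_mat_def block_diag_def qbit_add_power flip_bit_add_power)
qed (auto simp: cnot_mat_def block_diag_def)

lemma gate_mat_lift:
  assumes "valid_gate n g"
  shows "gate_mat (Suc n) g = block_diag (gate_mat n g) (gate_mat n g)"
  using assms by (cases g) (auto simp: single_qubit_mat_lift cnot_mat_lift)

lemma mux_index:
  assumes "i < N" "j < N"
  shows "mux N u $$ (i, j) = (if i = j then u j $$ (0, 0) else 0)"
    "mux N u $$ (i, j + N) = (if i = j then u j $$ (0, 1) else 0)"
    "mux N u $$ (i + N, j) = (if i = j then u j $$ (1, 0) else 0)"
    "mux N u $$ (i + N, j + N) = (if i = j then u j $$ (1, 1) else 0)"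
  using assms by (auto simp: mux_def mat_diag_def)

lemma single_qubit_mat_top: "single_qubit_mat (Suc n) n u = mux (2 ^ n) (\<lambda>_. u)"
proof (rule eq_matI)
  fix i j
  assume "i < dim_row (mux (2 ^ n) (\<lambda>_. u))" "j < dim_col (mux (2 ^ n) (\<lambda>_. u))"
  then have ij: "i < 2 ^ n + 2 ^ n" "j < 2 ^ n + 2 ^ n"
    by (auto simp: mux_def mat_diag_def)
  obtain i' where i': "i' < 2 ^ n" "i = i' \<or> i = i' + 2 ^ n" using index_split[OF ij(1)] by blast
  obtain j' where j': "j' < 2 ^ n" "j = j' \<or> j = j' + 2 ^ n" using index_split[OF ij(2)] by blast
  have top: "qbit i' n = 0" "qbit j' n = 0" using i' j' by (auto simp: qbit_top_0)
  have eq: "(\<forall>l. l \<noteq> n \<longrightarrow> qbit i l = qbit j l) \<longleftrightarrow> i' = j'"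
  proof
    assume "\<forall>l. l \<noteq> n \<longrightarrow> qbit i l = qbit j l"
    then have "qbit i' l = qbit j' l" if "l < n" for l
      using that i' j' by (auto simp: qbit_add_power split: if_splits)
    then show "i' = j'" using qbit_ext i' j' by blast
  qed (use i' j' in \<open>auto simp: qbit_add_power\<close>)
  have "single_qubit_mat (Suc n) n u $$ (i, j) = (if i' = j' then u $$ (qbit i n, qbit j n) else 0)"
    using ij by (simp add: single_qubit_mat_def eq)
  also have "\<dots> = mux (2 ^ n) (\<lambda>_. u) $$ (i, j)"
    using i'(2) j'(2)
    by (elim disjE; simp add: mux_index[OF i'(1) j'(1)] top qbit_add_power[OF i'(1)] qbit_add_power[OF j'(1)])
  finally show "single_qubit_mat (Suc n) n u $$ (i, j) = mux (2 ^ n) (\<lambda>_. u) $$ (i, j)" .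
qed (auto simp: single_qubit_mat_def mux_def mat_diag_def)

definition pauli_x :: "complex mat" where
  "pauli_x = mat2 0 1 1 0"

definition ctrl_x :: "nat \<Rightarrow> nat \<Rightarrow> complex mat" where
  "ctrl_x c j = (if qbit j c = 1 then pauli_x else 1\<^sub>m 2)"

lemma ctrl_x_carrier [simp]: "ctrl_x c j \<in> carrier_mat 2 2"
  by (simp add: ctrl_x_def pauli_x_def)

lemma cnot_mat_top:
  assumes "c < n"
  shows "cnot_mat (Suc n) c n = mux (2 ^ n) (ctrl_x c)"
proof (rule eq_matI)
  fix i j
  assume "i < dim_row (mux (2 ^ n) (ctrl_x c))" "j < dim_col (mux (2 ^ n) (ctrl_x c))"
  then have ij: "i < 2 ^ n + 2 ^ n" "j < 2 ^ n + 2 ^ n"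
    by (auto simp: mux_def mat_diag_def)
  obtain i' where i': "i' < 2 ^ n" "i = i' \<or> i = i' + 2 ^ n" using index_split[OF ij(1)] by blast
  obtain j' where j': "j' < 2 ^ n" "j = j' \<or> j = j' + 2 ^ n" using index_split[OF ij(2)] by blast
  have top: "qbit i' n = 0" "qbit j' n = 0" using i' j' by (auto simp: qbit_top_0)
  have c: "qbit j c = qbit j' c" using j' assms by (auto simp: qbit_add_power)
  have fl: "flip_bit j n = (if j = j' then j' + 2 ^ n else j')"
    using j' top by (auto simp: flip_bit_def qbit_add_power)
  have "cnot_mat (Suc n) c n $$ (i, j) = (if i = (if qbit j' c = 1 then flip_bit j n else j) then 1 else 0)"
    using ij by (simp add: cnot_mat_def c)
  also have "\<dots> = mux (2 ^ n) (ctrl_x c) $$ (i, j)"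
    unfolding fl using i' j'
    by (elim disjE; simp add: mux_index[OF i'(1) j'(1)] ctrl_x_def pauli_x_def mat2_one)
  finally show "cnot_mat (Suc n) c n $$ (i, j) = mux (2 ^ n) (ctrl_x c) $$ (i, j)" .
qed (auto simp: cnot_mat_def mux_def mat_diag_def)

section \<open>Circuits and their CNOT counts\<close>

lemma foldl_gates:
  assumes "U \<in> carrier_mat (2 ^ n) (2 ^ n)"
  shows "foldl (\<lambda>U g. gate_mat n g * U) U gs = circuit_unitary n gs * U
    \<and> circuit_unitary n gs \<in> carrier_mat (2 ^ n) (2 ^ n)"
  using assms
proof (induction gs arbitrary: U)
  case Nil
  then show ?case by (simp add: circuit_unitary_def)
next
  case (Cons g gs)
  have "circuit_unitary n (g # gs) = circuit_unitary n gs * gate_mat n g"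
    using Cons.IH[of "gate_mat n g"] by (simp add: circuit_unitary_def right_mult_one_mat[OF gate_mat_carrier])
  then show ?case
    using Cons.IH[of "gate_mat n g * U"] Cons.prems
    by (simp add: assoc_mult_mat[of _ "2 ^ n" "2 ^ n" _ "2 ^ n" _ "2 ^ n"])
qed

lemma circuit_unitary_carrier [simp]: "circuit_unitary n gs \<in> carrier_mat (2 ^ n) (2 ^ n)"
  using foldl_gates[of "1\<^sub>m (2 ^ n)" n gs] by simp

lemma circuit_unitary_append:
  "circuit_unitary n (gs @ hs) = circuit_unitary n hs * circuit_unitary n gs"
  using foldl_gates[OF circuit_unitary_carrier, of n gs hs]
  by (simp add: circuit_unitary_def[of n "gs @ hs"] flip: circuit_unitary_def)

lemma circuit_unitary_single: "circuit_unitary n [g] = gate_mat n g"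
  by (simp add: circuit_unitary_def right_mult_one_mat[OF gate_mat_carrier])

text \<open>Equality is exact and not up to phase: a scalar is a single-qubit gate and costs
  nothing. Exactness is what allows circuits for the factors of a product to be composed
  freely.\<close>

definition implementable :: "nat \<Rightarrow> nat \<Rightarrow> complex mat \<Rightarrow> bool" where
  "implementable n k U \<longleftrightarrow>
     (\<exists>gs. (\<forall>g\<in>set gs. valid_gate n g) \<and> circuit_unitary n gs = U \<and> cnot_count gs \<le> k)"

lemma implementable_carrier: "implementable n k U \<Longrightarrow> U \<in> carrier_mat (2 ^ n) (2 ^ n)"
  by (auto simp: implementable_def)

lemma implementable_mono: "implementable n k U \<Longrightarrow> k \<le> l \<Longrightarrow> implementable n l U"
  unfolding implementable_def by (metis order_trans)

lemma implementable_mult: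
  assumes "implementable n k U" "implementable n l V"
  shows "implementable n (k + l) (U * V)"
proof -
  obtain gs hs where "\<forall>g\<in>set gs. valid_gate n g" "circuit_unitary n gs = U" "cnot_count gs \<le> k"
    "\<forall>g\<in>set hs. valid_gate n g" "circuit_unitary n hs = V" "cnot_count hs \<le> l"
    using assms by (auto simp: implementable_def)
  then show ?thesis unfolding implementable_def
    by (intro exI[of _ "hs @ gs"]) (auto simp: circuit_unitary_append cnot_count_def)
qed

lemma implementable_single_qubit:
  assumes "unitary 2 u" "k < n"
  shows "implementable n 0 (single_qubit_mat n k u)"
  using assms unfolding implementable_def unitary_def
  by (intro exI[of _ "[SQ k u]"]) (auto simp: circuit_unitary_single cnot_count_def)

lemma implementable_cnot:
  assumes "c < n" "t < n" "c \<noteq> t"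
  shows "implementable n 1 (cnot_mat n c t)"
  using assms unfolding implementable_def
  by (intro exI[of _ "[CNOT c t]"]) (auto simp: circuit_unitary_single cnot_count_def)

lemma circuit_unitary_lift:
  assumes "\<forall>g\<in>set gs. valid_gate n g"
  shows "circuit_unitary (Suc n) gs = block_diag (circuit_unitary n gs) (circuit_unitary n gs)"
  using assms
proof (induction gs rule: rev_induct)
  case Nil
  then show ?case by (simp add: circuit_unitary_def block_diag_one flip: mult_2)
next
  case (snoc g gs)
  then show ?case
    by (simp add: circuit_unitary_append circuit_unitary_single gate_mat_lift
        block_diag_mult[of _ "2 ^ n" _ "2 ^ n"])
qed

lemma valid_gate_Suc: "valid_gate n g \<Longrightarrow> valid_gate (Suc n) g"
  by (cases g) auto

lemma implementable_lift: "implementable n k U \<Longrightarrow> implementable (Suc n) k (block_diag U U)"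
  unfolding implementable_def by (metis circuit_unitary_lift valid_gate_Suc)

text \<open>Two multiplexed rotations with one control fewer, conjugated by CNOTs, give one with all
  controls. Peeling off the trailing CNOT lets the inner ones cancel in the recursion.\<close>

lemma implementable_mux_rz_cnot:
  assumes "k \<le> n" "\<And>i j. i mod 2 ^ k = j mod 2 ^ k \<Longrightarrow> t i = t j"
  shows "implementable (Suc n) (2 ^ k - 1)
    (mux (2 ^ n) (\<lambda>j. rz (t j) * (if k = 0 then 1\<^sub>m 2 else ctrl_x (k - 1) j)))"
  using assms
proof (induction k arbitrary: t)
  case 0
  have t0: "t j = t 0" for j by (rule 0(2)) simp
  have "mux (2 ^ n) (\<lambda>j. rz (t j) * 1\<^sub>m 2) = single_qubit_mat (Suc n) n (rz (t 0))"
    unfolding single_qubit_mat_top by (intro mux_cong, subst t0) (simp add: rz_def mat2_one)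
  then show ?case using implementable_single_qubit[OF rz_unitary, of n "Suc n"] by simp
next
  case (Suc k)
  define a where "a j = (t (j mod 2 ^ k) + t (j mod 2 ^ k + 2 ^ k)) / 2" for j
  define p where "p j = (k > 0 \<and> qbit j (k - 1) = 1)" for j
  define b where "b j = (t (j mod 2 ^ k) - t (j mod 2 ^ k + 2 ^ k)) / 2" for j
  \<comment> \<open>In the product below, \<open>rz (b' j)\<close> is enclosed by two flips
    controlled by qubit \<open>k - 1\<close>, which negate its angle when that qubit is 1; the sign
    compensates for this. The flip controlled by qubit \<open>k\<close> then decides between
    \<open>a j + b j\<close> and \<open>a j - b j\<close>.\<close>
  define b' where "b' j = (if p j then - b j else b j)" for j
  have p: "p i = p j" if "i mod 2 ^ k = j mod 2 ^ k" for i j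
    using that qbit_mod[of "k - 1" k i] qbit_mod[of "k - 1" k j] by (auto simp: p_def)
  have b': "b' i = b' j" if "i mod 2 ^ k = j mod 2 ^ k" for i j
    using p[OF that] that by (simp add: b'_def b_def)
  define G where "G t = mux (2 ^ n) (\<lambda>j. rz (t j) * (if k = 0 then 1\<^sub>m 2 else ctrl_x (k - 1) j))" for t
  have Ga: "implementable (Suc n) (2 ^ k - 1) (G a)"
    unfolding G_def by (rule Suc.IH[OF Suc_leD[OF Suc.prems(1)]]) (simp add: a_def)
  have Gb: "implementable (Suc n) (2 ^ k - 1) (G b')"
    unfolding G_def by (rule Suc.IH[OF Suc_leD[OF Suc.prems(1)] b'])
  have C: "implementable (Suc n) 1 (mux (2 ^ n) (ctrl_x k))"
    using implementable_cnot[of k "Suc n" n] Suc.prems(1) by (simp add: cnot_mat_top)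
  have "(2 :: nat) ^ k \<ge> 1" by simp
  then have cnt: "2 ^ k - 1 + 1 + (2 ^ k - 1) \<le> (2 :: nat) ^ Suc k - 1"
    by (simp only: power_Suc)
  have "G a * mux (2 ^ n) (ctrl_x k) * G b' = mux (2 ^ n) (\<lambda>j.
      rz (a j) * (if k = 0 then 1\<^sub>m 2 else ctrl_x (k - 1) j) * ctrl_x k j
      * (rz (b' j) * (if k = 0 then 1\<^sub>m 2 else ctrl_x (k - 1) j)))"
    unfolding G_def by (simp add: mux_mult rz_def)
  also have "\<dots> = mux (2 ^ n) (\<lambda>j. rz (t j) * ctrl_x k j)"
  proof (rule mux_cong)
    fix j
    have "t j = t (j mod 2 ^ k + 2 ^ k * qbit j k)"
      by (rule Suc.prems(2)) (simp only: mod_power_Suc_qbit[symmetric] mod_mod_trivial)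
    moreover have "qbit j k = 0 \<or> qbit j k = 1" using qbit_less_2[of j k] by linarith
    ultimately have "(qbit j k = 0 \<and> t j = a j + b j) \<or> (qbit j k = 1 \<and> t j = a j - b j)"
      by (auto simp: a_def b_def field_simps)
    then show "rz (a j) * (if k = 0 then 1\<^sub>m 2 else ctrl_x (k - 1) j) * ctrl_x k j
      * (rz (b' j) * (if k = 0 then 1\<^sub>m 2 else ctrl_x (k - 1) j)) = rz (t j) * ctrl_x k j"
      by (auto simp: b'_def p_def ctrl_x_def rz_def pauli_x_def mat2_one cis_mult)
  qed
  finally have "mux (2 ^ n) (\<lambda>j. rz (t j) * (if Suc k = 0 then 1\<^sub>m 2 else ctrl_x (Suc k - 1) j))
    = G a * mux (2 ^ n) (ctrl_x k) * G b'" by simp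
  then show ?case
    using implementable_mono[OF implementable_mult[OF implementable_mult[OF Ga C] Gb] cnt] by simp
qed

lemma implementable_mux_rz:
  assumes "n > 0"
  shows "implementable (Suc n) (2 ^ n) (mux (2 ^ n) (\<lambda>j. rz (t j)))"
proof -
  \<comment> \<open>A multiplexer reads only indices below \<open>2 ^ n\<close>, so reducing
    \<open>j\<close> mod \<open>2 ^ n\<close> leaves the matrix unchanged and supplies the required
    periodicity.\<close>
  have "implementable (Suc n) (2 ^ n - 1)
      (mux (2 ^ n) (\<lambda>j. rz (t (j mod 2 ^ n)) * (if n = 0 then 1\<^sub>m 2 else ctrl_x (n - 1) j)))"
    by (rule implementable_mux_rz_cnot) auto
  moreover have "implementable (Suc n) 1 (mux (2 ^ n) (ctrl_x (n - 1)))"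
    using implementable_cnot[of "n - 1" "Suc n" n] assms by (simp add: cnot_mat_top)
  ultimately have "implementable (Suc n) (2 ^ n - 1 + 1)
      (mux (2 ^ n) (\<lambda>j. rz (t (j mod 2 ^ n)) * ctrl_x (n - 1) j) * mux (2 ^ n) (ctrl_x (n - 1)))"
    using assms by (intro implementable_mult) auto
  moreover have "mux (2 ^ n) (\<lambda>j. rz (t (j mod 2 ^ n)) * ctrl_x (n - 1) j) * mux (2 ^ n) (ctrl_x (n - 1))
    = mux (2 ^ n) (\<lambda>j. rz (t (j mod 2 ^ n)) * ctrl_x (n - 1) j * ctrl_x (n - 1) j)"
    by (subst mux_mult) (auto simp: rz_def)
  moreover have "\<dots> = mux (2 ^ n) (\<lambda>j. rz (t j))"
    by (rule mux_cong) (auto simp: rz_def ctrl_x_def pauli_x_def mat2_one)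
  ultimately show ?thesis by simp
qed

text \<open>The columns of the basis change are the eigenvectors of the y-rotations; it turns X into Z.
  The leftover multiplexed Z is diagonal.\<close>

lemma implementable_mux_ry:
  assumes "n > 0"
  obtains G d where "implementable (Suc n) (2 ^ n - 1) G" "unitary (2 ^ n) (mat_diag (2 ^ n) d)"
    "mux (2 ^ n) (\<lambda>j. ry (t j)) = G * block_diag (1\<^sub>m (2 ^ n)) (mat_diag (2 ^ n) d)"
    "\<forall>e. G * block_diag (mat_diag (2 ^ n) e) (mat_diag (2 ^ n) e)
       = block_diag (mat_diag (2 ^ n) e) (mat_diag (2 ^ n) e) * G"
proof -
  define s :: complex where "s = of_real (1 / sqrt 2)"
  have ss: "s * s = 1 / 2" unfolding s_def of_real_mult[symmetric] by simp
  have cs: "cnj s = s" by (simp add: s_def)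
  define k where "k = mat2 s s (- \<i> * s) (\<i> * s)"
  have k: "unitary 2 k"
    unfolding unitary_def k_def by (simp add: mat2_one cs ss algebra_simps flip: mult.assoc)
  define d where "d j = (if qbit j (n - 1) = 1 then - 1 else 1 :: complex)" for j
  define G where "G = mux (2 ^ n) (\<lambda>_. k)
    * mux (2 ^ n) (\<lambda>j. rz (t (j mod 2 ^ n)) * (if n = 0 then 1\<^sub>m 2 else ctrl_x (n - 1) j))
    * mux (2 ^ n) (\<lambda>_. mat_adjoint k)"
  have "implementable (Suc n) (2 ^ n - 1)
      (mux (2 ^ n) (\<lambda>j. rz (t (j mod 2 ^ n)) * (if n = 0 then 1\<^sub>m 2 else ctrl_x (n - 1) j)))"
    by (rule implementable_mux_rz_cnot) auto
  from implementable_mult[OF implementable_mult[OF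
      implementable_single_qubit[OF k, of n "Suc n"] this]
      implementable_single_qubit[OF unitary_adjoint[OF k], of n "Suc n"]]
  have G: "implementable (Suc n) (2 ^ n - 1) G" by (simp add: G_def single_qubit_mat_top)
  have kc: "k \<in> carrier_mat 2 2" by (simp add: k_def)
  have "G = mux (2 ^ n) (\<lambda>j. k * (rz (t (j mod 2 ^ n)) * ctrl_x (n - 1) j) * mat_adjoint k)"
    unfolding G_def using assms kc by (simp add: mux_mult rz_def)
  also have "\<dots> = mux (2 ^ n) (\<lambda>j. ry (t j) * mat2 1 0 0 (d j))"
  proof (rule mux_cong)
    fix j :: nat assume "j < 2 ^ n"
    have half: "s * (s * x) = x / 2" for x using ss by (simp flip: mult.assoc)
    have half': "s * (x * s) = x / 2" for x using half[of x] by (simp add: mult_ac)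
    show "k * (rz (t (j mod 2 ^ n)) * ctrl_x (n - 1) j) * mat_adjoint k = ry (t j) * mat2 1 0 0 (d j)"
      using \<open>j < 2 ^ n\<close>
      by (auto simp: k_def rz_def ry_def ctrl_x_def pauli_x_def mat2_one d_def cs half half' mult_ac
          complex_eq_iff algebra_simps)
  qed
  finally have Gm: "G = mux (2 ^ n) (\<lambda>j. ry (t j) * mat2 1 0 0 (d j))" .
  have dd: "d j * d j = 1" "cmod (d j) = 1" for j by (auto simp: d_def)
  have bd: "block_diag (1\<^sub>m (2 ^ n)) (mat_diag (2 ^ n) d) = mux (2 ^ n) (\<lambda>j. mat2 1 0 0 (d j))"
    by (intro eq_matI) (auto simp: block_diag_def mux_def mat_diag_def)
  have "G * block_diag (1\<^sub>m (2 ^ n)) (mat_diag (2 ^ n) d)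
      = mux (2 ^ n) (\<lambda>j. ry (t j) * mat2 1 0 0 (d j) * mat2 1 0 0 (d j))"
    unfolding bd Gm by (subst mux_mult) (auto simp: ry_def)
  also have "\<dots> = mux (2 ^ n) (\<lambda>j. ry (t j))"
    by (rule mux_cong) (simp add: ry_def dd mult.assoc)
  finally have "mux (2 ^ n) (\<lambda>j. ry (t j)) = G * block_diag (1\<^sub>m (2 ^ n)) (mat_diag (2 ^ n) d)" ..
  moreover have "unitary (2 ^ n) (mat_diag (2 ^ n) d)" by (rule unitary_diag) (simp add: dd)
  moreover have "G * block_diag (mat_diag (2 ^ n) e) (mat_diag (2 ^ n) e)
       = block_diag (mat_diag (2 ^ n) e) (mat_diag (2 ^ n) e) * G" for e
    unfolding Gm by (rule mux_commute_diag) (simp add: ry_def)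
  ultimately show ?thesis using G that by blast
qed

section \<open>Two-qubit operators\<close>

lemma four_block_mult2:
  fixes A :: "complex mat"
  assumes "A \<in> carrier_mat 2 2" "B \<in> carrier_mat 2 2" "C \<in> carrier_mat 2 2" "D \<in> carrier_mat 2 2"
    "A' \<in> carrier_mat 2 2" "B' \<in> carrier_mat 2 2" "C' \<in> carrier_mat 2 2" "D' \<in> carrier_mat 2 2"
  shows "four_block_mat A B C D * four_block_mat A' B' C' D'
    = four_block_mat (A * A' + B * C') (A * B' + B * D') (C * A' + D * C') (C * B' + D * D')"
  using assms by (intro mult_four_block_mat) auto

lemma mat2_add [simp]:
  "mat2 a b c d + mat2 a' b' c' d' = mat2 (a + a') (b + b') (c + c') (d + d')"
  by (intro eq_matI) (auto simp: less_2_cases_iff)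

lemma mat2_smult [simp]: "k \<cdot>\<^sub>m mat2 a b c d = mat2 (k * a) (k * b) (k * c) (k * d)"
  by (intro eq_matI) (auto simp: less_2_cases_iff)

lemma mat2_transpose [simp]: "(mat2 a b c d)\<^sup>T = mat2 a c b d"
  by (intro eq_matI) (auto simp: less_2_cases_iff)

lemma mat2_zero: "0\<^sub>m 2 2 = mat2 0 0 0 0"
  by (intro eq_matI) (auto simp: less_2_cases_iff)

lemma mat_diag2: "mat_diag 2 f = mat2 (f 0) 0 0 (f 1)"
  by (intro eq_matI) (auto simp: mat_diag_def mat2_def less_2_cases_iff)

lemma four_block_smult2:
  fixes A :: "complex mat"
  assumes "A \<in> carrier_mat 2 2" "B \<in> carrier_mat 2 2" "C \<in> carrier_mat 2 2" "D \<in> carrier_mat 2 2"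
  shows "k \<cdot>\<^sub>m four_block_mat A B C D = four_block_mat (k \<cdot>\<^sub>m A) (k \<cdot>\<^sub>m B) (k \<cdot>\<^sub>m C) (k \<cdot>\<^sub>m D)"
  using assms by (rule smult_four_block_mat)

lemma four_block_add2:
  fixes A :: "complex mat"
  assumes "A \<in> carrier_mat 2 2" "B \<in> carrier_mat 2 2" "C \<in> carrier_mat 2 2" "D \<in> carrier_mat 2 2"
    "A' \<in> carrier_mat 2 2" "B' \<in> carrier_mat 2 2" "C' \<in> carrier_mat 2 2" "D' \<in> carrier_mat 2 2"
  shows "four_block_mat A B C D + four_block_mat A' B' C' D'
    = four_block_mat (A + A') (B + B') (C + C') (D + D')"
  using assms by (rule add_four_block_mat)

lemma four_block_carrier4:
  "A \<in> carrier_mat 2 2 \<Longrightarrow> D \<in> carrier_mat 2 2 \<Longrightarrow> four_block_mat A B C D \<in> carrier_mat 4 4"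
  using four_block_carrier_mat[of A 2 2 D 2 2] by simp

lemma four_block_adjoint2:
  fixes A :: "complex mat"
  assumes "A \<in> carrier_mat 2 2" "B \<in> carrier_mat 2 2" "C \<in> carrier_mat 2 2" "D \<in> carrier_mat 2 2"
  shows "mat_adjoint (four_block_mat A B C D)
    = four_block_mat (mat_adjoint A) (mat_adjoint C) (mat_adjoint B) (mat_adjoint D)"
  using assms by (rule four_block_mat_adjoint)

lemma four_block_transpose2:
  fixes A :: "complex mat"
  assumes "A \<in> carrier_mat 2 2" "B \<in> carrier_mat 2 2" "C \<in> carrier_mat 2 2" "D \<in> carrier_mat 2 2"
  shows "(four_block_mat A B C D)\<^sup>T = four_block_mat (A\<^sup>T) (C\<^sup>T) (B\<^sup>T) (D\<^sup>T)"
  using assms by (rule transpose_four_block_mat)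

lemma one_mat4: "1\<^sub>m 4 = four_block_mat (mat2 1 0 0 1) (mat2 0 0 0 0) (mat2 0 0 0 0) (mat2 1 0 0 1)"
  using four_block_one_mat[of 2 2, where 'a = complex] by (simp add: mat2_one mat2_zero)

lemma mat_diag4: "mat_diag 4 f = four_block_mat (mat2 (f 0) 0 0 (f 1)) (mat2 0 0 0 0)
    (mat2 0 0 0 0) (mat2 (f 2) 0 0 (f 3))"
  by (intro eq_matI)
     (auto simp: mat_diag_def mat2_def less_Suc_eq numeral_2_eq_2 numeral_3_eq_3 numeral_eq_Suc)

text \<open>The first factor acts on the top qubit (bit 1 of the index), the second on bit 0.\<close>

definition tensor :: "complex mat \<Rightarrow> complex mat \<Rightarrow> complex mat" where
  "tensor A B = four_block_mat (A $$ (0, 0) \<cdot>\<^sub>m B) (A $$ (0, 1) \<cdot>\<^sub>m B) (A $$ (1, 0) \<cdot>\<^sub>m B) (A $$ (1, 1) \<cdot>\<^sub>m B)"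

lemma tensor_mat2: "tensor (mat2 a b c d) B = four_block_mat (a \<cdot>\<^sub>m B) (b \<cdot>\<^sub>m B) (c \<cdot>\<^sub>m B) (d \<cdot>\<^sub>m B)"
  by (simp add: tensor_def)

lemma tensor_carrier [simp]: "B \<in> carrier_mat 2 2 \<Longrightarrow> tensor A B \<in> carrier_mat 4 4"
  by (simp add: tensor_def four_block_carrier4)

lemma mat2_cases:
  assumes "A \<in> carrier_mat 2 2"
  obtains a b c d where "A = mat2 a b c d"
  using mat2_eqI[OF assms] by blast

lemma tensor_mult:
  assumes "A \<in> carrier_mat 2 2" "B \<in> carrier_mat 2 2" "A' \<in> carrier_mat 2 2" "B' \<in> carrier_mat 2 2"
  shows "tensor A B * tensor A' B' = tensor (A * A') (B * B')"
  by (rule mat2_cases[OF assms(1)], rule mat2_cases[OF assms(2)],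
      rule mat2_cases[OF assms(3)], rule mat2_cases[OF assms(4)])
     (simp add: tensor_mat2 four_block_mult2 algebra_simps)

lemma implementable_tensor:
  assumes "unitary 2 A" "unitary 2 B"
  shows "implementable 2 0 (tensor A B)"
proof -
  note AB = unitary_carrier[OF assms(1)] unitary_carrier[OF assms(2)]
  have "implementable (Suc 1) 0 (single_qubit_mat (Suc 1) 1 A)"
    using assms by (intro implementable_single_qubit) auto
  moreover have "implementable (Suc 1) 0 (block_diag (single_qubit_mat (Suc 0) 0 B) (single_qubit_mat (Suc 0) 0 B))"
    using implementable_lift[OF implementable_single_qubit[of B 0 1]] assms by simp
  ultimately have *: "implementable (Suc 1) (0 + 0) (mux 2 (\<lambda>_. A)
      * block_diag (single_qubit_mat (Suc 0) 0 B) (single_qubit_mat (Suc 0) 0 B))"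
    unfolding single_qubit_mat_top by (intro implementable_mult) auto
  have B: "single_qubit_mat (Suc 0) 0 B = B"
    unfolding single_qubit_mat_top using AB(2)
    by (intro eq_matI) (auto simp: mux_def mat_diag_def less_2_cases_iff)
  have "mux 2 (\<lambda>_. A) * block_diag B B = tensor A B"
    by (rule mat2_cases[OF AB(1)], rule mat2_cases[OF AB(2)])
       (simp add: mux_def mat_diag2 block_diag_def mat2_zero tensor_mat2 four_block_mult2 mult.commute)
  then show ?thesis using * unfolding B by (simp add: numeral_2_eq_2)
qed

text \<open>The CNOT with control bit 0 and target bit 1, the top qubit.\<close>

definition cx :: "complex mat" where
  "cx = four_block_mat (mat2 1 0 0 0) (mat2 0 0 0 1) (mat2 0 0 0 1) (mat2 1 0 0 0)"

lemma implementable_cx: "implementable 2 1 cx"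
proof -
  have "cnot_mat (Suc 1) 0 1 = cx"
    by (simp add: cnot_mat_top mux_def mat_diag2 cx_def ctrl_x_def qbit_def pauli_x_def mat2_one)
  then show ?thesis using implementable_cnot[of 0 2 1] by (simp add: numeral_2_eq_2)
qed

definition rt2 :: complex where
  "rt2 = of_real (1 / sqrt 2)"

lemma rt2_square: "rt2 * rt2 = 1 / 2" "rt2 * (rt2 * x) = x / 2" "cnj rt2 = rt2"
proof -
  show *: "rt2 * rt2 = 1 / 2" unfolding rt2_def of_real_mult[symmetric] by simp
  show "rt2 * (rt2 * x) = x / 2" using * by (simp flip: mult.assoc)
qed (simp add: rt2_def)

definition hadamard :: "complex mat" where
  "hadamard = mat2 rt2 rt2 rt2 (- rt2)"

lemma hadamard_unitary: "unitary 2 hadamard"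
  by (simp add: unitary_def hadamard_def mat2_one rt2_square)

text \<open>The columns are Bell states with phases chosen so that single-qubit operations become real.\<close>

definition magic :: "complex mat" where
  "magic = four_block_mat (mat2 rt2 (\<i> * rt2) 0 0) (mat2 0 0 (\<i> * rt2) (- rt2))
     (mat2 0 0 rt2 (- \<i> * rt2)) (mat2 (\<i> * rt2) rt2 0 0)"

text \<open>Minus the tensor square of the Pauli matrix Y. It equals \<open>magic\<close> times its
  transpose, so that the trace of X X^T can be computed without changing to the magic basis.\<close>

definition spin_flip :: "complex mat" where
  "spin_flip = four_block_mat (mat2 0 0 0 0) (mat2 0 1 (- 1) 0) (mat2 0 (- 1) 1 0) (mat2 0 0 0 0)"

lemma magic_carrier [simp]: "magic \<in> carrier_mat 4 4"
  by (simp add: magic_def four_block_carrier4)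

lemma spin_flip_carrier [simp]: "spin_flip \<in> carrier_mat 4 4"
  by (simp add: spin_flip_def four_block_carrier4)

lemma magic_unitary: "unitary 4 magic"
proof -
  have "mat_adjoint magic * magic = 1\<^sub>m 4"
    by (simp add: magic_def four_block_adjoint2 four_block_mult2 one_mat4 rt2_square mult_ac)
  then show ?thesis by (simp add: unitary_def)
qed

lemma magic_transpose: "magic * magic\<^sup>T = spin_flip"
  by (simp add: magic_def four_block_transpose2 four_block_mult2 spin_flip_def rt2_square mult_ac)

lemma magic_adjoint_transpose: "(mat_adjoint magic)\<^sup>T * mat_adjoint magic = spin_flip"
  by (simp add: magic_def four_block_transpose2 four_block_adjoint2 four_block_mult2 spin_flip_def
      rt2_square mult_ac)

text \<open>The Bell columns are joint eigenvectors of ZZ and XX with signs (+,+), (+,-), (-,+),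
  (-,-). A diagonal with these phases is therefore exp(i \<alpha> ZZ) exp(i \<beta> XX), where
  \<alpha> and \<beta> are half the sum and half the difference of \<open>a\<close> and
  \<open>b\<close>. Conjugation by \<open>cx\<close> turns ZZ into Z on the top qubit and XX into X
  on the lower one.\<close>

lemma magic_diagonal:
  assumes d: "d 0 = cis a" "d 1 = cis b" "d 2 = cis (- b)" "d 3 = cis (- a)"
  shows "magic * mat_diag 4 d = cx * tensor (rz ((a + b) / 2))
    (hadamard * rz ((a - b) / 2) * hadamard) * cx * magic"
proof -
  define x where "x = cis ((a + b) / 2)"
  define y where "y = cis ((a - b) / 2)"
  define x' where "x' = cis (- ((a + b) / 2))"
  define y' where "y' = cis (- ((a - b) / 2))"
  have e: "d 0 = x * y" "d 1 = x * y'" "d 2 = x' * y" "d 3 = x' * y'"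
    unfolding d x_def y_def x'_def y'_def cis_mult by (simp_all add: field_simps)
  have r: "rz ((a + b) / 2) = mat2 x 0 0 x'" "rz ((a - b) / 2) = mat2 y 0 0 y'"
    by (simp_all add: rz_def x_def y_def x'_def y'_def)
  show ?thesis
    unfolding mat_diag4 e r hadamard_def magic_def cx_def
    by (simp add: tensor_mat2 four_block_mult2 rt2_square algebra_simps)
qed

section \<open>Real rotations in the magic basis\<close>

text \<open>Rotations of neighbouring coordinates suffice to generate SO(4), and exactly these three
  families have simple local forms in the magic basis.\<close>

definition givens :: "nat \<Rightarrow> real \<Rightarrow> complex mat" where
  "givens m a = mat 4 4 (\<lambda>(i, j).
     if i = m then (if j = m then of_real (cos a) else if j = Suc m then - of_real (sin a) else 0)
     else if i = Suc m then (if j = m then of_real (sin a) else if j = Suc m then of_real (cos a) else 0)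
     else if i = j then 1 else 0)"

lemma givens_carrier [simp]: "givens m a \<in> carrier_mat 4 4"
  by (simp add: givens_def)

lemma givens_dim [simp]: "dim_row (givens m a) = 4" "dim_col (givens m a) = 4"
  by (simp_all add: givens_def)

lemma givens_index:
  assumes "i < 4" "j < 4"
  shows "givens m a $$ (i, j) =
    (if i = m then (if j = m then of_real (cos a) else if j = Suc m then - of_real (sin a) else 0)
     else if i = Suc m then (if j = m then of_real (sin a) else if j = Suc m then of_real (cos a) else 0)
     else if i = j then 1 else 0)"
  using assms by (simp add: givens_def)

lemma less_4_cases: "i < 4 \<longleftrightarrow> i = 0 \<or> i = Suc 0 \<or> i = 2 \<or> i = (3 :: nat)"
  by auto

lemma sum_less_4: "(\<Sum>k<4. f k) = f 0 + f (Suc 0) + f 2 + (f 3 :: 'a :: comm_monoid_add)"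
proof -
  have "{..<4 :: nat} = {0, Suc 0, 2, 3}" by auto
  then show ?thesis by (simp add: add.assoc)
qed

lemma givens_mult_index:
  assumes X: "X \<in> carrier_mat 4 n" and m: "m < 3" and i: "i < 4" and j: "j < n"
  shows "(givens m a * X) $$ (i, j) =
    (if i = m then of_real (cos a) * X $$ (m, j) - of_real (sin a) * X $$ (Suc m, j)
     else if i = Suc m then of_real (sin a) * X $$ (m, j) + of_real (cos a) * X $$ (Suc m, j)
     else X $$ (i, j))"
proof -
  have "(givens m a * X) $$ (i, j) = (\<Sum>k<4. givens m a $$ (i, k) * X $$ (k, j))"
    using X i j by (subst index_mult_mat_sum) auto
  moreover have "m = 0 \<or> m = Suc 0 \<or> m = 2" using m by auto
  ultimately show ?thesis using i unfolding less_4_cases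
    by (elim disjE) (simp_all add: sum_less_4 givens_def numeral_2_eq_2 numeral_3_eq_3)
qed

lemma givens_add: "m < 3 \<Longrightarrow> givens m a * givens m b = givens m (a + b)"
  by (intro eq_matI)
     (auto simp: givens_mult_index[OF givens_carrier] givens_index cos_add sin_add
       simp del: index_mult_mat(1))

lemma givens_transpose: "(givens m a)\<^sup>T = givens m (- a)"
  by (intro eq_matI) (auto simp: givens_def)

lemma givens_zero: "givens m 0 = 1\<^sub>m 4"
  by (intro eq_matI) (auto simp: givens_def)

lemma givens_real: "real_mat (givens m a)"
  by (auto simp: real_mat_def givens_def)

lemma givens_unitary: "m < 3 \<Longrightarrow> unitary 4 (givens m a)"
  by (simp add: unitary_def real_mat_adjoint[OF givens_real] givens_transpose givens_add givens_zero)

lemma det_rotation: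
  fixes R :: "real \<Rightarrow> complex mat"
  assumes "\<And>a. R a \<in> carrier_mat n n" "\<And>a b. R a * R b = R (a + b)" "\<And>a. (R a)\<^sup>T = R (- a)" "R 0 = 1\<^sub>m n"
  shows "det (R a) = 1"
proof -
  have "det (R a) = det (R (a / 2) * R (a / 2))" using assms(2)[of "a / 2" "a / 2"] by simp
  also have "\<dots> = det (R (a / 2)) * det (R (a / 2))" using assms(1) by (intro det_mult)
  also have "\<dots> = det (R (a / 2)) * det ((R (a / 2))\<^sup>T)" by (simp add: det_transpose[OF assms(1)])
  also have "\<dots> = det (R (a / 2) * R (- (a / 2)))"
    using assms(1) unfolding assms(3) by (intro det_mult[symmetric])
  also have "\<dots> = 1" unfolding assms(2) using assms(4) by simp
  finally show ?thesis .
qed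

lemma det_givens: "m < 3 \<Longrightarrow> det (givens m a) = 1"
  by (rule det_rotation) (auto simp: givens_add givens_transpose givens_zero)

text \<open>The elements of SO(4) that act as a tensor product in the magic basis. They form a group
  containing the plane rotations, and hence turn out to be all of SO(4).\<close>

definition magic_local :: "complex mat \<Rightarrow> bool" where
  "magic_local T \<longleftrightarrow> unitary 4 T \<and> real_mat T \<and> det T = 1
     \<and> (\<exists>A B. unitary 2 A \<and> unitary 2 B \<and> magic * T = tensor A B * magic)"

lemma magic_local_one: "magic_local (1\<^sub>m 4)"
proof -
  have "tensor (1\<^sub>m 2) (1\<^sub>m 2) = 1\<^sub>m 4" by (simp add: mat2_one tensor_mat2 one_mat4)
  then have "magic * 1\<^sub>m 4 = tensor (1\<^sub>m 2) (1\<^sub>m 2) * magic"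
    by (simp add: right_mult_one_mat[of _ 4 4] left_mult_one_mat[of _ 4 4])
  then show ?thesis unfolding magic_local_def
    by (auto simp: real_mat_def intro!: exI[of _ "1\<^sub>m 2"])
qed

lemma magic_local_mult:
  assumes "magic_local S" "magic_local T"
  shows "magic_local (S * T)"
proof -
  obtain A B where AB: "unitary 2 A" "unitary 2 B" "magic * S = tensor A B * magic"
    using assms(1) by (auto simp: magic_local_def)
  obtain A' B' where AB': "unitary 2 A'" "unitary 2 B'" "magic * T = tensor A' B' * magic"
    using assms(2) by (auto simp: magic_local_def)
  have c: "S \<in> carrier_mat 4 4" "T \<in> carrier_mat 4 4" using assms by (auto simp: magic_local_def)
  have t: "tensor A B \<in> carrier_mat 4 4" "tensor A' B' \<in> carrier_mat 4 4" using AB AB' by auto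
  have "magic * (S * T) = tensor A B * (magic * T)"
    using c t AB(3) by (simp flip: assoc_mult_mat[of _ 4 4 _ 4 _ 4])
  also have "\<dots> = tensor (A * A') (B * B') * magic"
    using t AB AB' by (simp add: tensor_mult flip: assoc_mult_mat[of _ 4 4 _ 4 _ 4])
  finally have "magic * (S * T) = tensor (A * A') (B * B') * magic" .
  moreover have "unitary 2 (A * A')" "unitary 2 (B * B')" using AB AB' by (simp_all add: unitary_mult)
  moreover have "unitary 4 (S * T)" "real_mat (S * T)" "det (S * T) = 1"
    using assms c by (auto simp: magic_local_def unitary_mult real_mat_mult[of _ 4 4 _ 4] det_mult[of _ 4])
  ultimately show ?thesis unfolding magic_local_def by blast
qed

lemma magic_local_adjoint:
  assumes "magic_local T"
  shows "magic_local (mat_adjoint T)"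
proof -
  obtain A B where AB: "unitary 2 A" "unitary 2 B" "magic * T = tensor A B * magic"
    using assms by (auto simp: magic_local_def)
  have T: "unitary 4 T" "real_mat T" "det T = 1" using assms by (auto simp: magic_local_def)
  note c = unitary_carrier[OF T(1)]
  have t: "tensor A B \<in> carrier_mat 4 4" using AB by auto
  have "tensor A B * magic * mat_adjoint T = magic"
    using c T(1) unfolding AB(3)[symmetric]
    by (simp add: assoc_mult_mat[of _ 4 4 _ 4 _ 4] unitary_right right_mult_one_mat[of _ 4 4])
  then have "tensor (mat_adjoint A) (mat_adjoint B) * magic
      = tensor (mat_adjoint A) (mat_adjoint B) * (tensor A B * (magic * mat_adjoint T))"
    using c t by (simp add: assoc_mult_mat[of _ 4 4 _ 4 _ 4])
  also have "\<dots> = tensor (mat_adjoint A) (mat_adjoint B) * tensor A B * (magic * mat_adjoint T)"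
    using c t AB by (simp add: assoc_mult_mat[of _ 4 4 _ 4 _ 4])
  also have "tensor (mat_adjoint A) (mat_adjoint B) * tensor A B = 1\<^sub>m 4"
    using AB by (simp add: tensor_mult unitary_left) (simp add: mat2_one tensor_mat2 one_mat4)
  finally have "magic * mat_adjoint T = tensor (mat_adjoint A) (mat_adjoint B) * magic"
    using c by (simp add: left_mult_one_mat[of _ 4 4])
  moreover have "real_mat (mat_adjoint T)" using T(2) c by (auto simp: real_mat_def Reals_cnj_iff)
  moreover have "det (mat_adjoint T) = 1"
    using T by (simp add: real_mat_adjoint det_transpose[OF c])
  ultimately show ?thesis using T AB unitary_adjoint unfolding magic_local_def by blast
qed

text \<open>Equal z-rotations affect only the span of |00> and |11>, which carries columns 0 and 1;
  opposite ones affect only the span of |01> and |10>, which carries columns 2 and 3. Equal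
  y-rotations fix columns 0 and 3. In each case the two local angles add up, hence the factor
  2.\<close>

lemma magic_givens:
  "magic * givens 0 (2 * a) = tensor (rz a) (rz a) * magic"
  "magic * givens 1 (2 * a) = tensor (ry a) (ry a) * magic"
  "magic * givens 2 (2 * a) = tensor (rz a) (rz (- a)) * magic"
proof -
  define c where "c = complex_of_real (cos a)"
  define s where "s = complex_of_real (sin a)"
  have "c * c + s * s = of_real ((sin a)\<^sup>2 + (cos a)\<^sup>2)"
    by (simp add: c_def s_def power2_eq_square)
  then have cs: "c * c = 1 - s * s"
    by (simp add: eq_diff_eq del: of_real_add)
  have csx: "c * (c * x) = x - s * (s * x)" for x
    using arg_cong[OF cs, of "\<lambda>z. z * x"] by (simp add: algebra_simps)
  have d: "complex_of_real (cos (2 * a)) = 1 - 2 * (s * s)" "complex_of_real (sin (2 * a)) = 2 * (s * c)"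
    using cs by (simp_all add: cos_double sin_double c_def s_def power2_eq_square)
  have cis: "cis a = c + \<i> * s" "cis (- a) = c - \<i> * s"
    by (simp_all add: c_def s_def complex_eq_iff)
  define u where "u = 1 - 2 * (s * s)"
  define v where "v = 2 * (s * c)"
  have g: "givens 0 (2 * a) = four_block_mat (mat2 u (- v) v u) (mat2 0 0 0 0) (mat2 0 0 0 0) (mat2 1 0 0 1)"
    "givens 1 (2 * a) = four_block_mat (mat2 1 0 0 u) (mat2 0 0 (- v) 0) (mat2 0 v 0 0) (mat2 u 0 0 1)"
    "givens 2 (2 * a) = four_block_mat (mat2 1 0 0 1) (mat2 0 0 0 0) (mat2 0 0 0 0) (mat2 u (- v) v u)"
    by (intro eq_matI; force simp: givens_def d u_def v_def less_4_cases mat2_def numeral_2_eq_2 numeral_3_eq_3)+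
  show "magic * givens 0 (2 * a) = tensor (rz a) (rz a) * magic"
    unfolding g rz_def magic_def cis minus_minus
    by (simp add: tensor_mat2 four_block_mult2 u_def v_def algebra_simps cs csx)
  show "magic * givens 1 (2 * a) = tensor (ry a) (ry a) * magic"
    unfolding g ry_def magic_def c_def[symmetric] s_def[symmetric]
    by (simp add: tensor_mat2 four_block_mult2 u_def v_def algebra_simps cs csx)
  show "magic * givens 2 (2 * a) = tensor (rz a) (rz (- a)) * magic"
    unfolding g rz_def magic_def cis minus_minus
    by (simp add: tensor_mat2 four_block_mult2 u_def v_def algebra_simps cs csx)
qed

lemma magic_local_givens:
  assumes "m < 3"
  shows "magic_local (givens m a)"
proof -
  have "m = 0 \<or> m = 1 \<or> m = 2" using assms by auto
  then have "\<exists>A B. unitary 2 A \<and> unitary 2 B \<and> magic * givens m a = tensor A B * magic"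
    using magic_givens[of "a / 2"] rz_unitary ry_unitary by (elim disjE) auto
  then show ?thesis using assms by (simp add: magic_local_def givens_unitary givens_real det_givens)
qed

text \<open>Rotating by minus the argument of x + i y puts the vector on the nonnegative axis. The
  sign \<open>r \<ge> 0\<close> later makes diagonal entries 1 and not -1; the second equation also
  serves to find a zero of a sinusoid.\<close>

lemma givens_angle: "\<exists>a r. 0 \<le> r \<and> cos a * x - sin a * y = r \<and> sin a * x + cos a * (y :: real) = 0"
proof -
  define z where "z = Complex x y"
  define a where "a = Arg z"
  have "rcis (cmod z) a = Complex x y" by (simp add: a_def z_def rcis_cmod_Arg)
  then have xy: "x = cmod z * cos a" "y = cmod z * sin a" by (auto simp: complex_eq_iff)
  have "cos (- a) * x - sin (- a) * y = cmod z * (cos a * cos a) + cmod z * (sin a * sin a)"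
    unfolding xy by (simp add: mult_ac)
  also have "\<dots> = cmod z" by (simp flip: distrib_left)
  finally have "cos (- a) * x - sin (- a) * y = cmod z" .
  moreover have "sin (- a) * x + cos (- a) * y = 0" unfolding xy by simp
  ultimately show ?thesis by (intro exI[of _ "- a"] exI[of _ "cmod z"]) auto
qed

text \<open>Column \<open>k\<close> is cleared from the bottom upwards, each rotation moving the
  entry of row \<open>m + 1\<close> into row \<open>m\<close>. Only rows from \<open>m\<close> on
  are ever mixed, which protects the rows finished before.\<close>

lemma givens_eliminate:
  assumes X: "X \<in> carrier_mat 4 4" "real_mat X" and k: "k < 4" and m: "m \<le> 3"
  shows "\<exists>T. magic_local T \<and> (\<forall>i<m. \<forall>j<4. (T * X) $$ (i, j) = X $$ (i, j))
    \<and> (\<forall>i<4. m < i \<longrightarrow> (T * X) $$ (i, k) = 0)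
    \<and> (m < 3 \<longrightarrow> (\<exists>r\<ge>0. (T * X) $$ (m, k) = of_real r))"
  using m
proof (induction rule: inc_induct)
  case base
  show ?case using magic_local_one X by (intro exI[of _ "1\<^sub>m 4"]) auto
next
  case (step m)
  then obtain T where T: "magic_local T" "\<forall>i<Suc m. \<forall>j<4. (T * X) $$ (i, j) = X $$ (i, j)"
    "\<forall>i<4. Suc m < i \<longrightarrow> (T * X) $$ (i, k) = 0" by blast
  have Tc: "T \<in> carrier_mat 4 4" "real_mat T" using T(1) by (auto simp: magic_local_def)
  have Y: "T * X \<in> carrier_mat 4 4" "real_mat (T * X)" using Tc X by (auto simp: real_mat_mult[of _ 4 4 _ 4])
  have "(T * X) $$ (i, k) \<in> \<real>" if "i < 4" for i
    using Y(2) Tc(1) X(1) k that unfolding real_mat_def by (auto simp del: index_mult_mat(1))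
  from this[of m] this[of "Suc m"] step obtain x y
    where xy: "(T * X) $$ (m, k) = of_real x" "(T * X) $$ (Suc m, k) = of_real y"
    by (auto elim!: Reals_cases simp del: index_mult_mat(1))
  obtain a r where ar: "0 \<le> r" "cos a * x - sin a * y = r" "sin a * x + cos a * y = 0"
    using givens_angle by blast
  have m3: "m < 3" using step by simp
  have assoc: "givens m a * T * X = givens m a * (T * X)"
    using Tc X by (simp add: assoc_mult_mat[of _ 4 4 _ 4 _ 4])
  note ix = givens_mult_index[OF Y(1) m3]
  have "(givens m a * (T * X)) $$ (m, k) = of_real (cos a * x - sin a * y)"
    using ix[of m k a] k step by (simp add: xy del: index_mult_mat(1))
  moreover have "(givens m a * (T * X)) $$ (Suc m, k) = of_real (sin a * x + cos a * y)"
    using ix[of "Suc m" k a] k step by (simp add: xy del: index_mult_mat(1))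
  ultimately show ?case
    using T ar m3 k ix[of _ _ a]
    by (intro exI[of _ "givens m a * T"])
       (auto simp: assoc magic_local_mult magic_local_givens simp del: index_mult_mat(1))
qed

lemma unitary_col_norm:
  assumes "unitary n U" "j < n"
  shows "(\<Sum>i<n. (cmod (U $$ (i, j)))\<^sup>2) = 1"
proof -
  note c = unitary_carrier[OF assms(1)]
  have "complex_of_real (\<Sum>i<n. (cmod (U $$ (i, j)))\<^sup>2) = (\<Sum>i<n. cnj (U $$ (i, j)) * U $$ (i, j))"
    by (simp only: of_real_sum complex_norm_square mult.commute)
  also have "\<dots> = (mat_adjoint U * U) $$ (j, j)"
    using c assms(2) by (subst index_mult_mat_sum) auto
  also have "\<dots> = of_real 1" using assms by (simp add: unitary_left)
  finally show ?thesis by (simp only: of_real_eq_iff)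
qed

text \<open>The entry 1 already exhausts the unit norm of its column; the same argument for the
  adjoint treats the row.\<close>

lemma unitary_diagonal_one:
  assumes U: "unitary n U" and i: "i < n" "U $$ (i, i) = 1" and j: "j < n" "j \<noteq> i"
  shows "U $$ (j, i) = 0" "U $$ (i, j) = 0"
proof -
  have col: "V $$ (j, i) = 0" if "unitary n V" "V $$ (i, i) = 1" for V
  proof -
    have "(\<Sum>k\<in>{..<n} - {i}. (cmod (V $$ (k, i)))\<^sup>2) = 0"
      using unitary_col_norm[OF that(1) i(1)] i(1) that(2) by (subst (asm) sum.remove[of _ i]) auto
    then have "(cmod (V $$ (j, i)))\<^sup>2 = 0"
      using j by (subst (asm) sum_nonneg_eq_0_iff) auto
    then show ?thesis by simp
  qed
  show "U $$ (j, i) = 0" using col[OF U i(2)] .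
  have "mat_adjoint U $$ (j, i) = 0"
    using unitary_carrier[OF U] i by (intro col[OF unitary_adjoint[OF U]]) auto
  then show "U $$ (i, j) = 0" using unitary_carrier[OF U] i j by simp
qed

lemma det_mat_diag: "det (mat_diag n f) = (\<Prod>i<n. f i :: complex)"
proof -
  have "det (mat_diag n f) = prod_list (diag_mat (mat_diag n f))"
    by (rule det_upper_triangular[of _ n]) (auto simp: mat_diag_def)
  also have "\<dots> = (\<Prod>i<n. f i)"
    unfolding prod_list_diag_prod by (rule prod.cong) (auto simp: mat_diag_def)
  finally show ?thesis .
qed

text \<open>QR factorization by plane rotations: they reduce \<open>X\<close> to a matrix with three
  ones on the diagonal, which unitarity makes diagonal and the determinant makes the identity. Thus
  \<open>X\<close> is the inverse of a product of local rotations.\<close>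

lemma special_orthogonal_magic_local:
  assumes X: "unitary 4 X" "real_mat X" "det X = 1"
  shows "magic_local X"
proof -
  have "\<exists>T. magic_local T \<and> (\<forall>j<k. (T * X) $$ (j, j) = 1)" if "k \<le> 3" for k
    using that
  proof (induction k)
    case 0
    show ?case using magic_local_one by auto
  next
    case (Suc k)
    then obtain T where T: "magic_local T" "\<forall>j<k. (T * X) $$ (j, j) = 1" by auto
    define Y where "Y = T * X"
    have Y: "unitary 4 Y" "real_mat Y"
      using T X by (auto simp: Y_def magic_local_def unitary_mult real_mat_mult[of _ 4 4 _ 4])
    note Yc = unitary_carrier[OF Y(1)]
    have k3: "k < 3" using Suc.prems by simp
    obtain S r where S: "magic_local S" "\<forall>i<k. \<forall>j<4. (S * Y) $$ (i, j) = Y $$ (i, j)"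
      "\<forall>i<4. k < i \<longrightarrow> (S * Y) $$ (i, k) = 0" "r \<ge> 0" "(S * Y) $$ (k, k) = of_real r"
      using givens_eliminate[OF Yc Y(2), of k k] k3 by auto
    have SY: "unitary 4 (S * Y)" using S Y by (auto simp: magic_local_def unitary_mult)
    have one: "(S * Y) $$ (j, j) = 1" if "j < k" for j
      using that S(2) T(2) k3 by (auto simp: Y_def simp del: index_mult_mat(1))
    have zero: "(S * Y) $$ (i, k) = 0" if "i < 4" "i \<noteq> k" for i
    proof (cases "i < k")
      case True
      then show ?thesis using unitary_diagonal_one(2)[OF SY _ one[OF True], of k] k3 by simp
    next
      case False
      then show ?thesis using S(3) that by simp
    qed
    \<comment> \<open>The diagonal entry is the only one left in column \<open>k\<close>, so it has
      modulus 1; being nonnegative, it equals 1.\<close>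
    have "(\<Sum>i<4. (cmod ((S * Y) $$ (i, k)))\<^sup>2) = 1" using k3 by (intro unitary_col_norm[OF SY]) simp
    also have "(\<Sum>i<4. (cmod ((S * Y) $$ (i, k)))\<^sup>2) = (cmod ((S * Y) $$ (k, k)))\<^sup>2"
      using k3 zero by (subst sum.remove[of _ k]) (auto intro!: sum.neutral simp del: index_mult_mat(1))
    finally have "r\<^sup>2 = 1" using S(5) by (simp del: index_mult_mat(1))
    then have "r = 1" using S(4) by (simp add: power2_eq_1_iff)
    then have "\<forall>j<Suc k. (S * Y) $$ (j, j) = 1" using one S(5) by (auto simp: less_Suc_eq simp del: index_mult_mat(1))
    moreover have "S * Y = S * T * X"
      using S(1) T(1) X(1) unfolding Y_def magic_local_def by (simp add: assoc_mult_mat[of _ 4 4 _ 4 _ 4])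
    ultimately show ?case using magic_local_mult[OF S(1) T(1)] by metis
  qed
  from this[of 3] obtain T where T: "magic_local T" "\<forall>j<3. (T * X) $$ (j, j) = 1" by auto
  define Y where "Y = T * X"
  note Xc = unitary_carrier[OF X(1)]
  have Tc: "unitary 4 T" "T \<in> carrier_mat 4 4" "det T = 1" using T(1) by (auto simp: magic_local_def)
  have Y: "unitary 4 Y" "det Y = 1"
    using Tc X Xc by (auto simp: Y_def unitary_mult det_mult[of _ 4])
  note Yc = unitary_carrier[OF Y(1)]
  have Yd: "Y = mat_diag 4 (\<lambda>i. Y $$ (i, i))"
  proof (rule eq_matI)
    fix i j assume "i < dim_row (mat_diag 4 (\<lambda>i. Y $$ (i, i)))" "j < dim_col (mat_diag 4 (\<lambda>i. Y $$ (i, i)))"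
    then have ij: "i < 4" "j < 4" by (auto simp: mat_diag_def)
    have "Y $$ (i, j) = 0" if "i \<noteq> j"
    proof (cases "i < 3")
      case True
      then show ?thesis using unitary_diagonal_one(2)[OF Y(1), of i j] T(2) ij that by (simp add: Y_def)
    next
      case False
      then have "j < 3" using ij that by simp
      then show ?thesis using unitary_diagonal_one(1)[OF Y(1), of j i] T(2) ij that by (simp add: Y_def)
    qed
    then show "Y $$ (i, j) = mat_diag 4 (\<lambda>i. Y $$ (i, i)) $$ (i, j)" using ij by (auto simp: mat_diag_def)
  qed (use Yc in \<open>auto simp: mat_diag_def\<close>)
  have "det Y = (\<Prod>i<4. Y $$ (i, i))" by (subst Yd) (rule det_mat_diag)
  also have "\<dots> = Y $$ (3, 3)"
  proof -
    have "{..<4 :: nat} = insert 3 {..<3}" by auto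
    then show ?thesis using T(2) by (simp add: Y_def del: index_mult_mat(1))
  qed
  finally have "Y $$ (3, 3) = 1" using Y by simp
  then have "Y $$ (i, i) = 1" if "i < 4" for i
    using that T(2) by (cases "i = 3") (auto simp: Y_def simp del: index_mult_mat(1))
  then have "Y = 1\<^sub>m 4" by (subst Yd) (auto simp: mat_diag_def)
  then have "mat_adjoint T * (T * X) = mat_adjoint T * 1\<^sub>m 4" by (simp add: Y_def)
  then have "X = mat_adjoint T"
    using Tc Xc by (simp add: unitary_cancel_left[of 4 _ _ 4] right_mult_one_mat[of _ 4 4])
  then show ?thesis using magic_local_adjoint[OF T(1)] by simp
qed

section \<open>Two-qubit circuits\<close>

definition mtrace :: "complex mat \<Rightarrow> complex" where
  "mtrace A = (\<Sum>i<dim_row A. A $$ (i, i))"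

lemma mtrace_comm:
  assumes "A \<in> carrier_mat n n" "B \<in> carrier_mat n n"
  shows "mtrace (A * B) = mtrace (B * A)"
proof -
  have "mtrace (A * B) = (\<Sum>i<n. \<Sum>k<n. A $$ (i, k) * B $$ (k, i))"
    using assms by (simp add: mtrace_def index_mult_mat_sum del: index_mult_mat(1))
  also have "\<dots> = (\<Sum>k<n. \<Sum>i<n. A $$ (i, k) * B $$ (k, i))" by (rule sum.swap)
  also have "\<dots> = mtrace (B * A)"
    using assms by (simp add: mtrace_def index_mult_mat_sum mult.commute del: index_mult_mat(1))
  finally show ?thesis .
qed

lemma mtrace_linear:
  assumes "A \<in> carrier_mat n n" "B \<in> carrier_mat n n"
  shows "mtrace (a \<cdot>\<^sub>m A + b \<cdot>\<^sub>m B) = a * mtrace A + b * mtrace B"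
  using assms by (simp add: mtrace_def sum.distrib sum_distrib_left)

lemma mtrace_smult: "A \<in> carrier_mat n n \<Longrightarrow> mtrace (a \<cdot>\<^sub>m A) = a * mtrace A"
  by (simp add: mtrace_def sum_distrib_left)

lemma det_adjoint:
  assumes "A \<in> carrier_mat n n"
  shows "det (mat_adjoint A) = cnj (det A)"
proof -
  interpret cnj: comm_ring_hom cnj by unfold_locales auto
  have "mat_adjoint A = map_mat cnj (A\<^sup>T)" by (intro eq_matI) auto
  then show ?thesis using det_transpose[OF assms] by simp
qed

lemma det_unitary:
  assumes "unitary n U"
  shows "det (mat_adjoint U) * det U = 1" "cmod (det U) = 1"
proof -
  note c = unitary_carrier[OF assms]
  show 1: "det (mat_adjoint U) * det U = 1"
    using det_mult[of "mat_adjoint U" n U] c unitary_left[OF assms] by simp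
  then have "complex_of_real ((cmod (det U))\<^sup>2) = of_real 1"
    unfolding complex_norm_square using det_adjoint[OF c] by (simp add: mult.commute)
  then have "(cmod (det U))\<^sup>2 = 1" by (simp only: of_real_eq_iff)
  then show "cmod (det U) = 1" using norm_ge_zero[of "det U"] by (simp add: power2_eq_1_iff)
qed

lemma unitaryI_right:
  assumes "A \<in> carrier_mat n n" "A * mat_adjoint A = 1\<^sub>m n"
  shows "unitary n A"
  using unitary_adjoint[of n "mat_adjoint A"] assms by (simp add: unitary_def)

lemma conj_diag_index:
  assumes A: "A \<in> carrier_mat n n" and ij: "i < n" "j < n"
  shows "(A * mat_diag n d * mat_adjoint A) $$ (i, j) = (\<Sum>k<n. A $$ (i, k) * d k * cnj (A $$ (j, k)))"
proof -
  have "(A * mat_diag n d) $$ (i, k) = A $$ (i, k) * d k" if "k < n" for k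
    using A ij that by (subst mat_diag_mult_right[OF A]) simp
  moreover have "(A * mat_diag n d * mat_adjoint A) $$ (i, j)
      = (\<Sum>k<n. (A * mat_diag n d) $$ (i, k) * mat_adjoint A $$ (k, j))"
    using A ij by (subst index_mult_mat_sum) (auto simp: mat_diag_def)
  ultimately show ?thesis using A ij by (simp del: index_mult_mat(1))
qed

text \<open>As the product is 1, the conjugate of each number is the product of the other three. So
  a real sum means that the first and third elementary symmetric functions agree, and modulo these
  two relations the product of the three differences \<open>z0 * zi - 1\<close> vanishes.\<close>

lemma unit_complexes_pairing:
  fixes z0 z1 z2 z3 :: complex
  assumes c: "cmod z0 = 1" "cmod z1 = 1" "cmod z2 = 1" "cmod z3 = 1"
    and p: "z0 * z1 * z2 * z3 = 1" and im: "Im (z0 + z1 + z2 + z3) = 0"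
  shows "z0 * z1 = 1 \<or> z0 * z2 = 1 \<or> z0 * z3 = 1"
proof -
  have inv: "cnj z = y" if "cmod z = 1" "z * y = 1" for z y
  proof -
    have "cnj z * z = 1" using that(1) complex_norm_square[of z] by (simp add: mult.commute)
    then have "cnj z * (z * y) = y" by (simp flip: mult.assoc)
    then show ?thesis using that(2) by simp
  qed
  have cj: "cnj z0 = z1 * z2 * z3" "cnj z1 = z0 * z2 * z3" "cnj z2 = z0 * z1 * z3" "cnj z3 = z0 * z1 * z2"
    using p by (auto intro!: inv c simp: mult_ac)
  have "z0 + z1 + z2 + z3 = cnj (z0 + z1 + z2 + z3)" using im by (simp add: complex_eq_iff)
  then have e: "z0 + z1 + z2 + z3 = z1 * z2 * z3 + z0 * z2 * z3 + z0 * z1 * z3 + z0 * z1 * z2"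
    by (simp add: cj)
  have "(z0 * z1 - 1) * (z0 * z2 - 1) * (z0 * z3 - 1)
    = z0 * ((z0 + z1 + z2 + z3) - (z1 * z2 * z3 + z0 * z2 * z3 + z0 * z1 * z3 + z0 * z1 * z2))
      + (z0 * z0 + 1) * (z0 * z1 * z2 * z3 - 1)" by (simp add: algebra_simps)
  then have "(z0 * z1 - 1) * (z0 * z2 - 1) * (z0 * z3 - 1) = 0" unfolding e p by simp
  then show ?thesis by auto
qed

text \<open>Adjusts a real diagonalization so that conjugate eigenvalues stand where
  \<open>magic_diagonal\<close> expects them and so that the rotation has determinant 1, as
  membership in SO(4) demands.\<close>

lemma symmetric_unitary_diagonalization:
  assumes P: "unitary 4 P" "P\<^sup>T = P" "det P = 1" "Im (mtrace P) = 0"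
  obtains R z where "unitary 4 R" "real_mat R" "det R = 1" "P = R * mat_diag 4 z * mat_adjoint R"
    "\<And>i. i < 4 \<Longrightarrow> cmod (z i) = 1" "z 0 * z 3 = 1" "z 1 * z 2 = 1"
proof -
  note Pc = unitary_carrier[OF P(1)]
  obtain Q z where Q: "unitary 4 Q" "P = Q * mat_diag 4 z * mat_adjoint Q" "real_mat Q"
    using normal_diagonalization[OF Pc, of True] P by (auto simp: unitary_left unitary_right)
  note Qc = unitary_carrier[OF Q(1)]
  have "mat_adjoint Q * P * Q = mat_diag 4 z"
    using Q Qc by (simp add: assoc_mult_mat[of _ 4 4 _ 4 _ 4] unitary_cancel_left[of 4 _ _ 4] unitary_left
        right_mult_one_mat[of _ 4 4])
  then have "unitary 4 (mat_diag 4 z)" using Q P by (metis unitary_mult unitary_adjoint)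
  then have z1: "cmod (z i) = 1" if "i < 4" for i using unitary_diag_entries that by blast
  have "det P = det Q * det (mat_diag 4 z) * det (mat_adjoint Q)"
    using Qc unfolding Q(2) by (simp add: det_mult[of _ 4])
  then have "(det (mat_adjoint Q) * det Q) * det (mat_diag 4 z) = 1" using P(3) by (simp add: mult_ac)
  then have "det (mat_diag 4 z) = 1" unfolding det_unitary(1)[OF Q(1)] by simp
  moreover have "{..<4 :: nat} = {0, 1, 2, 3}" by auto
  ultimately have pz: "z 0 * z 1 * z 2 * z 3 = 1" by (simp add: det_mat_diag mult.assoc)
  have "mtrace P = mtrace (mat_adjoint Q * (Q * mat_diag 4 z))"
    unfolding Q(2) using Qc by (intro mtrace_comm[of _ 4]) auto
  also have "\<dots> = (\<Sum>i<4. z i)"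
    using unitary_cancel_left[OF Q(1), of "mat_diag 4 z" 4] by (simp add: mtrace_def) (simp add: mat_diag_def)
  finally have "Im (z 0 + z 1 + z 2 + z 3) = 0" using P(4) by (simp add: sum_less_4)
  then obtain k where k: "z 0 * z k = 1" "k = 1 \<or> k = 2 \<or> k = 3"
    using unit_complexes_pairing[of "z 0" "z 1" "z 2" "z 3"] z1 pz by auto
  \<comment> \<open>Exchanges \<open>k\<close> and 3, which moves the partner of the first
    eigenvalue to the last position; the other two are then partners because the product of all four
    is 1.\<close>
  define p where "p = (\<lambda>i. if i = 3 then k else if i = k then 3 else i)"
  define R0 where "R0 = mat 4 4 (\<lambda>(i, j). Q $$ (i, p j))"
  have R0c: "R0 \<in> carrier_mat 4 4" by (simp add: R0_def)
  have p4: "p i < 4" if "i < 4" for i using that k(2) by (auto simp: p_def)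
  have reindex: "(\<Sum>i<4. f (p i)) = (\<Sum>i<4. f i :: complex)" for f
    using k(2) by (elim disjE) (simp_all add: p_def sum_less_4)
  have conj: "R0 * mat_diag 4 (\<lambda>i. d (p i)) * mat_adjoint R0 = Q * mat_diag 4 d * mat_adjoint Q" for d
  proof (rule eq_matI)
    fix i j assume "i < dim_row (Q * mat_diag 4 d * mat_adjoint Q)" "j < dim_col (Q * mat_diag 4 d * mat_adjoint Q)"
    then have ij: "i < 4" "j < 4" using Qc by auto
    show "(R0 * mat_diag 4 (\<lambda>i. d (p i)) * mat_adjoint R0) $$ (i, j) = (Q * mat_diag 4 d * mat_adjoint Q) $$ (i, j)"
      unfolding conj_diag_index[OF R0c ij] conj_diag_index[OF Qc ij]
      using reindex[of "\<lambda>k. Q $$ (i, k) * d k * cnj (Q $$ (j, k))"] ij by (simp add: R0_def)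
  qed (use R0c Qc in auto)
  have R0: "unitary 4 R0"
    by (rule unitaryI_right[OF R0c])
       (use conj[of "\<lambda>_. 1"] R0c Qc Q(1) in \<open>simp add: right_mult_one_mat[of _ 4 4] unitary_right\<close>)
  have R0r: "real_mat R0" using Q(3) Qc p4 by (auto simp: real_mat_def R0_def)
  define e where "e = det R0"
  have ee: "e * e = 1" using det_unitary(1)[OF R0] R0r R0c by (simp add: real_mat_adjoint det_transpose e_def)
  then have e: "e = 1 \<or> e = - 1" by (simp add: square_eq_1_iff)
  \<comment> \<open>Flips the sign of the first column if the determinant is -1. A diagonal of signs
    cancels when it conjugates a diagonal matrix.\<close>
  define J where "J = mat_diag 4 (\<lambda>i. if i = 0 then e else 1)"
  have J: "unitary 4 J" unfolding J_def by (rule unitary_diag) (use e in auto)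
  note Jc = unitary_carrier[OF J]
  have "real_mat J" using e by (auto simp: real_mat_def J_def mat_diag_def)
  then have "real_mat (R0 * J)" using R0r R0c Jc by (auto intro!: real_mat_mult[of _ 4 4 _ 4])
  moreover have "det J = e" unfolding J_def det_mat_diag by (simp add: prod.delta)
  then have "det (R0 * J) = 1" using det_mult[OF R0c Jc] ee by (simp add: e_def)
  moreover have "P = (R0 * J) * mat_diag 4 (\<lambda>i. z (p i)) * mat_adjoint (R0 * J)"
  proof -
    have "J * mat_diag 4 (\<lambda>i. z (p i)) * mat_adjoint J = mat_diag 4 (\<lambda>i. z (p i))"
      unfolding J_def mat_adjoint_diag mat_diag_diag using e by (intro eq_matI) (auto simp: mat_diag_def)
    then have "R0 * (J * mat_diag 4 (\<lambda>i. z (p i)) * mat_adjoint J) * mat_adjoint R0 = P"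
      using conj[of z] Q(2) by simp
    then show ?thesis using R0c Jc
      by (simp add: mat_adjoint_mult[of _ 4 4 _ 4] assoc_mult_mat[of _ 4 4 _ 4 _ 4])
  qed
  moreover have p03: "z (p 0) * z (p 3) = 1" using k by (auto simp: p_def)
  moreover have "(z (p 0) * z (p 3)) * (z (p 1) * z (p 2)) = 1"
    using k(2) pz by (elim disjE) (simp_all add: p_def mult_ac)
  then have "z (p 1) * z (p 2) = 1" unfolding p03 by simp
  moreover have "unitary 4 (R0 * J)" using R0 J by (rule unitary_mult)
  ultimately show ?thesis using that z1 p4 by blast
qed

text \<open>A real trace forces the eigenvalues of the symmetric unitary X X^T into conjugate pairs. Its
  real diagonalization then writes X as a real rotation, a diagonal that is a tensor product up to
  two CNOTs, and another real rotation.\<close>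

lemma implementable_two_cnots:
  assumes U: "unitary 4 U" "det U = 1" "Im (mtrace (U * spin_flip * U\<^sup>T * spin_flip)) = 0"
  shows "implementable 2 2 U"
proof -
  note Uc = unitary_carrier[OF U(1)]
  have Ec: "mat_adjoint magic \<in> carrier_mat 4 4" by simp
  define X where "X = mat_adjoint magic * U * magic"
  have X: "unitary 4 X"
    unfolding X_def using U magic_unitary by (intro unitary_mult unitary_adjoint)
  note Xc = unitary_carrier[OF X]
  have detX: "det X = 1"
    using Uc Ec det_unitary(1)[OF magic_unitary] U(2) by (simp add: X_def det_mult[of _ 4])
  have UX: "U * magic = magic * X"
    using Uc magic_unitary by (simp add: X_def assoc_mult_mat[of _ 4 4 _ 4 _ 4] unitary_cancel_right[of 4 _ _ 4])
  define P where "P = X * X\<^sup>T"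
  have XTc: "X\<^sup>T \<in> carrier_mat 4 4" using Xc by simp
  have XT: "unitary 4 (X\<^sup>T)"
  proof (rule unitaryI_right[OF XTc])
    have "X\<^sup>T * mat_adjoint (X\<^sup>T) = (mat_adjoint X * X)\<^sup>T"
    proof -
      have "(mat_adjoint X * X)\<^sup>T = X\<^sup>T * (mat_adjoint X)\<^sup>T" using Xc by (intro transpose_mult) auto
      moreover have "mat_adjoint (X\<^sup>T) = (mat_adjoint X)\<^sup>T" by (intro eq_matI) auto
      ultimately show ?thesis by simp
    qed
    then show "X\<^sup>T * mat_adjoint (X\<^sup>T) = 1\<^sub>m 4" using X by (simp add: unitary_left)
  qed
  have P: "unitary 4 P" unfolding P_def using X XT by (rule unitary_mult)
  have PT: "P\<^sup>T = P" unfolding P_def using Xc XTc by (subst transpose_mult[of _ 4 4 _ 4]) auto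
  have detP: "det P = 1" using Xc XTc detX det_transpose[OF Xc] by (simp add: P_def det_mult[of _ 4])
  \<comment> \<open>Cyclicity of the trace brings the magic basis factors together in pairs, each of
    which is \<open>spin_flip\<close>.\<close>
  have "mtrace P = mtrace (U * spin_flip * U\<^sup>T * spin_flip)"
  proof -
    have ET: "magic\<^sup>T \<in> carrier_mat 4 4" "(mat_adjoint magic)\<^sup>T \<in> carrier_mat 4 4" "U\<^sup>T \<in> carrier_mat 4 4"
      using Uc Ec by (auto simp only: transpose_carrier_mat magic_carrier)
    have "P = mat_adjoint magic * (U * (magic * (magic\<^sup>T * (U\<^sup>T * (mat_adjoint magic)\<^sup>T))))"
      unfolding P_def X_def using Uc Ec ET
      by (simp add: transpose_mult[of _ 4 4 _ 4] assoc_mult_mat[of _ 4 4 _ 4 _ 4])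
    then have "mtrace P = mtrace (U * (magic * (magic\<^sup>T * (U\<^sup>T * (mat_adjoint magic)\<^sup>T))) * mat_adjoint magic)"
      using Uc Ec ET by (simp add: mtrace_comm[of _ 4])
    also have "U * (magic * (magic\<^sup>T * (U\<^sup>T * (mat_adjoint magic)\<^sup>T))) * mat_adjoint magic
        = U * (magic * magic\<^sup>T) * U\<^sup>T * ((mat_adjoint magic)\<^sup>T * mat_adjoint magic)"
      using Uc Ec ET by (simp add: assoc_mult_mat[of _ 4 4 _ 4 _ 4])
    finally show ?thesis unfolding magic_transpose magic_adjoint_transpose .
  qed
  then have "Im (mtrace P) = 0" using U(3) by simp
  then obtain R z where R: "unitary 4 R" "real_mat R" "det R = 1" "P = R * mat_diag 4 z * mat_adjoint R"
    and z: "\<And>i. i < 4 \<Longrightarrow> cmod (z i) = 1" "z 0 * z 3 = 1" "z 1 * z 2 = 1"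
    using symmetric_unitary_diagonalization[OF P PT detP] by blast
  note Rc = unitary_carrier[OF R(1)]
  obtain a' where a': "z 0 = cis a'" using unit_complex_cis z(1)[of 0] by auto
  obtain b' where b': "z 1 = cis b'" using unit_complex_cis z(1)[of 1] by auto
  have inv: "y = cis (- t)" if "cis t * y = 1" for t y
  proof -
    have "y = cis (- t) * (cis t * y)" by (simp add: cis_mult flip: mult.assoc)
    then show ?thesis using that by simp
  qed
  define a where "a = a' / 2"
  define b where "b = b' / 2"
  have z23: "z 3 = cis (- a')" "z 2 = cis (- b')" using z(2,3) a' b' by (auto intro!: inv)
  have zz: "z 0 = cis a * cis a" "z 1 = cis b * cis b" "z 2 = cis (- b) * cis (- b)" "z 3 = cis (- a) * cis (- a)"
    unfolding a' b' z23 cis_mult by (simp_all add: a_def b_def)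
  \<comment> \<open>A square root of the eigenvalues that gives each pair opposite half phases. This
    keeps the form needed by \<open>magic_diagonal\<close> and makes the determinant 1.\<close>
  define d where "d i = (if i = 0 then cis a else if i = 1 then cis b else if i = 2 then cis (- b) else cis (- a))"
    for i :: nat
  define D where "D = mat_diag 4 d"
  have D: "unitary 4 D" unfolding D_def by (rule unitary_diag) (simp add: d_def)
  note Dc = unitary_carrier[OF D]
  have DD: "mat_diag 4 z = D * D"
    unfolding D_def mat_diag_diag by (intro eq_matI) (auto simp: mat_diag_def d_def zz zz(2)[unfolded One_nat_def] less_4_cases)
  have DT: "D\<^sup>T = D" by (intro eq_matI) (auto simp: D_def mat_diag_def)
  have AT: "(mat_adjoint D)\<^sup>T = mat_adjoint D" by (intro eq_matI) (auto simp: D_def mat_diag_def)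
  have detD: "det D = 1" by (simp add: D_def det_mat_diag d_def eval_nat_numeral lessThan_Suc cis_mult)
  have RT: "(mat_adjoint R)\<^sup>T = R" using R(2) by (simp add: real_mat_adjoint)
  \<comment> \<open>What remains of X = R D Y. Since P = R D^2 R^T, the product Y Y^T is 1; together
    with unitarity this equates the adjoint with the transpose, so \<open>Y\<close> is real.\<close>
  define Y where "Y = mat_adjoint D * (mat_adjoint R * X)"
  have Y: "unitary 4 Y" unfolding Y_def using D R X by (intro unitary_mult unitary_adjoint)
  note Yc = unitary_carrier[OF Y]
  have "det (mat_adjoint D) = 1" "det (mat_adjoint R) = 1"
    using det_unitary(1)[OF D] det_unitary(1)[OF R(1)] detD R(3) by auto
  then have detY: "det Y = 1" using detX Dc Rc Xc by (simp add: Y_def det_mult[of _ 4])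
  have "Y * Y\<^sup>T = mat_adjoint D * (mat_adjoint R * (P * (R * mat_adjoint D)))"
  proof -
    have "Y\<^sup>T = X\<^sup>T * (R * mat_adjoint D)"
      unfolding Y_def using Dc Rc Xc
      by (simp add: transpose_mult[of _ 4 4 _ 4] AT RT assoc_mult_mat[of _ 4 4 _ 4 _ 4])
    then show ?thesis using Dc Rc Xc XTc by (simp add: Y_def P_def assoc_mult_mat[of _ 4 4 _ 4 _ 4])
  qed
  also have "\<dots> = 1\<^sub>m 4"
    unfolding R(4) DD using D R(1) Dc Rc
    by (simp add: assoc_mult_mat[of _ 4 4 _ 4 _ 4] unitary_cancel_left[of 4 _ _ 4] unitary_right)
  finally have YY: "Y * Y\<^sup>T = 1\<^sub>m 4" .
  have "mat_adjoint Y = mat_adjoint Y * (Y * Y\<^sup>T)"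
    unfolding YY using Yc by (simp add: right_mult_one_mat[of _ 4 4])
  also have "\<dots> = Y\<^sup>T" using Y Yc by (intro unitary_cancel_left[of 4 _ _ 4]) auto
  finally have YT: "mat_adjoint Y = Y\<^sup>T" .
  have "real_mat Y"
    unfolding real_mat_def
  proof (intro allI impI)
    fix i j assume ij: "i < dim_row Y" "j < dim_col Y"
    have "mat_adjoint Y $$ (j, i) = Y\<^sup>T $$ (j, i)" by (simp only: YT)
    then show "Y $$ (i, j) \<in> \<real>" using ij by (simp add: Reals_cnj_iff)
  qed
  then have Yl: "magic_local Y" using Y detY by (intro special_orthogonal_magic_local)
  have Rl: "magic_local R" using R by (intro special_orthogonal_magic_local)
  obtain A B where AB: "unitary 2 A" "unitary 2 B" "magic * R = tensor A B * magic"
    using Rl by (auto simp: magic_local_def)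
  obtain A' B' where AB': "unitary 2 A'" "unitary 2 B'" "magic * Y = tensor A' B' * magic"
    using Yl by (auto simp: magic_local_def)
  define H where "H = hadamard * rz ((a - b) / 2) * hadamard"
  have H: "unitary 2 H" unfolding H_def by (intro unitary_mult hadamard_unitary rz_unitary)
  define C where "C = cx * tensor (rz ((a + b) / 2)) H * cx"
  have "implementable 2 (1 + 0 + 1) C"
    unfolding C_def using H rz_unitary
    by (intro implementable_mult implementable_cx implementable_tensor)
  then have impC: "implementable 2 2 C" by (simp add: numeral_2_eq_2)
  have Cc: "C \<in> carrier_mat 4 4" using implementable_carrier[OF impC] by simp
  have MD: "magic * D = C * magic"
    unfolding D_def C_def H_def by (rule magic_diagonal) (simp_all add: d_def)
  have tc: "tensor A B \<in> carrier_mat 4 4" "tensor A' B' \<in> carrier_mat 4 4" using AB AB' by auto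
  have "X = R * (D * Y)"
    unfolding Y_def using R(1) D Rc Dc Xc by (simp add: unitary_cancel_right[of 4 _ _ 4])
  then have "U * magic = magic * R * (D * Y)"
    using UX Rc Dc Yc by (simp add: assoc_mult_mat[of _ 4 4 _ 4 _ 4])
  also have "\<dots> = tensor A B * (magic * D * Y)"
    unfolding AB(3) using tc Dc Yc by (simp add: assoc_mult_mat[of _ 4 4 _ 4 _ 4])
  also have "\<dots> = tensor A B * (C * (magic * Y))"
    unfolding MD using Cc Yc by (simp add: assoc_mult_mat[of _ 4 4 _ 4 _ 4])
  also have "\<dots> = tensor A B * C * tensor A' B' * magic"
    unfolding AB'(3) using tc Cc by (simp add: assoc_mult_mat[of _ 4 4 _ 4 _ 4])
  finally have "U * magic * mat_adjoint magic = tensor A B * C * tensor A' B' * magic * mat_adjoint magic"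
    by simp
  then have "U = tensor A B * C * tensor A' B'"
    using Uc tc Cc magic_unitary
    by (simp add: assoc_mult_mat[of _ 4 4 _ 4 _ 4] unitary_right right_mult_one_mat[of _ 4 4])
  moreover have "implementable 2 (0 + 2 + 0) (tensor A B * C * tensor A' B')"
    using AB AB' impC by (intro implementable_mult implementable_tensor)
  ultimately show ?thesis by (simp add: eval_nat_numeral)
qed

text \<open>The trace in the two-CNOT criterion is a sinusoid in t, so its imaginary part vanishes for some t.\<close>

lemma implementable_two_cnots_family:
  assumes W: "unitary 4 W"
    and F: "\<And>t. unitary 4 (F t)" "\<And>t. det (F t) = 1"
    and M: "M1 \<in> carrier_mat 4 4" "M2 \<in> carrier_mat 4 4"
    and FS: "\<And>t. F t * spin_flip * (F t)\<^sup>T = of_real (cos t) \<cdot>\<^sub>m M1 + of_real (sin t) \<cdot>\<^sub>m M2"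
  obtains t where "implementable 2 2 (W * F t)"
proof -
  note Wc = unitary_carrier[OF W]
  obtain r where r: "det W = cis r" using unit_complex_cis det_unitary(2)[OF W] by blast
  \<comment> \<open>A fourth root of the inverse determinant, since scaling a 4x4 matrix by
    \<open>c\<close> multiplies its determinant by \<open>c ^ 4\<close>.\<close>
  define c where "c = cis (- r / 4)"
  have "c ^ 4 = cis (- r)" by (simp add: c_def DeMoivre)
  then have c4: "c ^ 4 * det W = 1" by (simp add: r cis_mult)
  have c1: "cmod c = 1" by (simp add: c_def)
  define G where "G M = mtrace (W * M * W\<^sup>T * spin_flip)" for M
  define A where "A = c * c * G M1"
  define B where "B = c * c * G M2"
  \<comment> \<open>\<open>givens_angle\<close> applied to the vector (Im B, Im A) supplies the zero
    of the sinusoid.\<close>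
  obtain t where t: "cos t * Im A + sin t * Im B = 0"
    using givens_angle[of "Im B" "Im A"] by (metis add.commute)
  have Fc: "F t \<in> carrier_mat 4 4" "(F t)\<^sup>T \<in> carrier_mat 4 4" using F(1) by auto
  have WT: "W\<^sup>T \<in> carrier_mat 4 4" using Wc by simp
  define V where "V = c \<cdot>\<^sub>m (W * F t)"
  have V: "unitary 4 V" unfolding V_def using W F c1 by (intro unitary_smult unitary_mult)
  have detV: "det V = 1"
    unfolding V_def det_smult using Wc Fc F(2) c4 by (simp add: det_mult[of _ 4])
  have "V * spin_flip * V\<^sup>T * spin_flip = (c * c) \<cdot>\<^sub>m (W * (F t * spin_flip * (F t)\<^sup>T) * W\<^sup>T * spin_flip)"
  proof -
    have "V\<^sup>T = c \<cdot>\<^sub>m ((F t)\<^sup>T * W\<^sup>T)"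
      unfolding V_def transpose_mult[OF Wc Fc(1), symmetric] by (intro eq_matI) auto
    then show ?thesis unfolding V_def using Wc WT Fc
      by (simp add: mult_smult_assoc_mat[of _ 4 4 _ 4] mult_smult_distrib[of _ 4 4 _ 4]
          assoc_mult_mat[of _ 4 4 _ 4 _ 4]) (intro eq_matI, auto)
  qed
  then have "mtrace (V * spin_flip * V\<^sup>T * spin_flip)
      = c * c * G (of_real (cos t) \<cdot>\<^sub>m M1 + of_real (sin t) \<cdot>\<^sub>m M2)"
    using Wc WT M by (simp add: mtrace_smult[of _ 4] FS G_def)
  also have "G (of_real (cos t) \<cdot>\<^sub>m M1 + of_real (sin t) \<cdot>\<^sub>m M2) = of_real (cos t) * G M1 + of_real (sin t) * G M2"
  proof -
    have "W * (of_real (cos t) \<cdot>\<^sub>m M1 + of_real (sin t) \<cdot>\<^sub>m M2) * W\<^sup>T * spin_flip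
      = of_real (cos t) \<cdot>\<^sub>m (W * M1 * W\<^sup>T * spin_flip) + of_real (sin t) \<cdot>\<^sub>m (W * M2 * W\<^sup>T * spin_flip)"
      using Wc WT M
      by (simp add: mult_add_distrib_mat[of _ 4 4 _ 4] add_mult_distrib_mat[of _ 4 4 _ _ 4]
          mult_smult_assoc_mat[of _ 4 4 _ 4] mult_smult_distrib[of _ 4 4 _ 4])
    then show ?thesis unfolding G_def using Wc WT M by (simp add: mtrace_linear[of _ 4])
  qed
  also have "c * c * (of_real (cos t) * G M1 + of_real (sin t) * G M2) = of_real (cos t) * A + of_real (sin t) * B"
    by (simp add: A_def B_def algebra_simps)
  finally have "Im (mtrace (V * spin_flip * V\<^sup>T * spin_flip)) = 0" using t by simp
  then have iV: "implementable 2 2 V" using V detV by (intro implementable_two_cnots)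
  \<comment> \<open>The phase \<open>c\<close> is undone by a scalar gate on the top qubit, at no
    cost in CNOTs.\<close>
  have "implementable 2 (0 + 2) (tensor (cnj c \<cdot>\<^sub>m 1\<^sub>m 2) (1\<^sub>m 2) * V)"
    using iV c1 by (intro implementable_mult implementable_tensor unitary_smult) auto
  moreover have "tensor (cnj c \<cdot>\<^sub>m 1\<^sub>m 2) (1\<^sub>m 2) * V = W * F t"
  proof -
    have "tensor (cnj c \<cdot>\<^sub>m 1\<^sub>m 2) (1\<^sub>m 2) = cnj c \<cdot>\<^sub>m 1\<^sub>m 4"
      by (simp add: mat2_one tensor_mat2 one_mat4) (auto simp: mat2_def intro!: eq_matI)
    moreover have "cnj c * c = 1" "c * cnj c = 1" using c1 complex_norm_square[of c] by (simp_all add: mult.commute)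
    ultimately show ?thesis unfolding V_def using Wc Fc
      by (simp add: mult_smult_assoc_mat[of _ 4 4 _ 4] mult_smult_distrib[of _ 4 4 _ 4]
          left_mult_one_mat[of _ 4 4]) (intro eq_matI, auto simp flip: mult.assoc)
  qed
  ultimately show ?thesis using that by (simp add: eval_nat_numeral)
qed

text \<open>The family is exp(i t ZZ / 2), a diagonal. It meets the antidiagonal
  \<open>spin_flip\<close> from both sides, so phases t and -t appear and the result is linear in
  their cosine and sine. The diagonal split off is the inverse of the chosen member.\<close>

lemma two_qubit_up_to_diagonal:
  assumes W: "unitary 4 W"
  obtains C d where "implementable 2 2 C" "unitary 4 (mat_diag 4 d)" "W = C * mat_diag 4 d"
proof -
  define f where "f t i = cis (if i = 0 \<or> i = 3 then t / 2 else - t / 2)" for t :: real and i :: nat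
  define F where "F t = mat_diag 4 (f t)" for t
  define K where "K = four_block_mat (mat2 0 0 0 0) (mat2 0 \<i> \<i> 0) (mat2 0 \<i> \<i> 0) (mat2 0 0 0 0)"
  have F: "unitary 4 (F t)" for t unfolding F_def by (rule unitary_diag) (simp add: f_def)
  have det: "det (F t) = 1" for t
    by (simp add: F_def det_mat_diag f_def eval_nat_numeral lessThan_Suc cis_mult)
  have FS: "F t * spin_flip * (F t)\<^sup>T = of_real (cos t) \<cdot>\<^sub>m spin_flip + of_real (sin t) \<cdot>\<^sub>m K" for t
  proof -
    have "cis t = of_real (cos t) + \<i> * of_real (sin t)" "cis (- t) = of_real (cos t) - \<i> * of_real (sin t)"
      by (simp_all add: complex_eq_iff)
    then show ?thesis
      by (simp add: F_def mat_diag4 f_def spin_flip_def K_def four_block_mult2 four_block_transpose2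
          four_block_smult2 four_block_add2 cis_mult mult.commute)
  qed
  have K: "K \<in> carrier_mat 4 4" by (simp add: K_def four_block_carrier4)
  obtain t where t: "implementable 2 2 (W * F t)"
    using implementable_two_cnots_family[of W F spin_flip K] W F det K FS by auto
  have "W = W * F t * mat_adjoint (F t)"
    using W F[of t] by (simp add: assoc_mult_mat[of _ 4 4 _ 4 _ 4] unitary_right right_mult_one_mat[of _ 4 4])
  moreover have "unitary 4 (mat_adjoint (F t))" using F by (rule unitary_adjoint)
  ultimately show ?thesis using that t by (simp add: F_def)
qed

text \<open>The correcting family must now be cheap to invert. A y-rotation on the lower qubit is
  free but fixes \<open>spin_flip\<close>; after the fixed gate \<open>Q\<close>, which is exp(i
  pi/4 ZZ) and costs one CNOT, it acts on \<open>M1\<close>, i times XX, and does produce a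
  sinusoid. Two CNOTs for the corrected operator and one for the inverse of \<open>Q\<close> give
  three.\<close>

lemma two_qubit_three_cnots:
  assumes W: "unitary 4 W"
  shows "implementable 2 3 W"
proof -
  define w where "w = cis (pi / 4)"
  have w: "w * w = \<i>" "cnj w * cnj w = - \<i>" "w * cnj w = 1" "cmod w = 1"
    by (simp_all add: w_def cis_cnj cis_mult)
  define Q where "Q = mat_diag 4 (\<lambda>i. if i = 0 \<or> i = 3 then w else cnj w)"
  have Q: "unitary 4 Q" unfolding Q_def by (rule unitary_diag) (simp add: w)
  note Qc = unitary_carrier[OF Q]
  define L where "L t = block_diag (ry t) (ry t)" for t
  have ryc: "ry t \<in> carrier_mat 2 2" for t by (simp add: ry_def)
  have L: "unitary 4 (L t)" for t
    using block_diag_unitary[OF ry_unitary ry_unitary, of t t] by (simp add: L_def)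
  note Lc = unitary_carrier[OF L]
  have ry_add: "ry a * ry b = ry (a + b)" for a b
    by (simp add: ry_def cos_add sin_add algebra_simps)
  have Ladd: "L a * L b = L (a + b)" for a b
    using ryc by (simp add: L_def block_diag_mult[of _ 2 _ 2] ry_add)
  have Lb: "L t = four_block_mat (ry t) (mat2 0 0 0 0) (mat2 0 0 0 0) (ry t)" for t
    using ryc[of t] by (simp add: L_def block_diag_def mat2_zero)
  have LT: "(L t)\<^sup>T = L (- t)" for t
    unfolding Lb by (simp add: ry_def four_block_transpose2)
  have L0: "L 0 = 1\<^sub>m 4" unfolding Lb by (simp add: ry_def one_mat4)
  have detL: "det (L t) = 1" for t by (rule det_rotation) (use Lc Ladd LT L0 in auto)
  have detQ: "det Q = 1" using w(3) by (simp add: Q_def det_mat_diag eval_nat_numeral lessThan_Suc mult_ac)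
  define F where "F t = L (t / 2) * Q" for t
  define M1 where "M1 = four_block_mat (mat2 0 0 0 0) (mat2 0 \<i> \<i> 0) (mat2 0 \<i> \<i> 0) (mat2 0 0 0 0)"
  define M2 where "M2 = four_block_mat (mat2 0 0 0 0) (mat2 (- \<i>) 0 0 \<i>) (mat2 (- \<i>) 0 0 \<i>) (mat2 0 0 0 0)"
  have F: "unitary 4 (F t)" for t unfolding F_def using L Q by (rule unitary_mult)
  have det: "det (F t) = 1" for t using Lc[of "t / 2"] Qc by (simp add: F_def det_mult[of _ 4] detL detQ)
  have FS: "F t * spin_flip * (F t)\<^sup>T = of_real (cos t) \<cdot>\<^sub>m M1 + of_real (sin t) \<cdot>\<^sub>m M2" for t
  proof -
    have QSQ: "Q * spin_flip * Q = M1"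
      by (simp add: Q_def mat_diag4 spin_flip_def M1_def four_block_mult2 w)
    have QT: "Q\<^sup>T = Q" by (intro eq_matI) (auto simp: Q_def mat_diag_def)
    have "F t * spin_flip * (F t)\<^sup>T = L (t / 2) * (Q * spin_flip * Q) * (L (t / 2))\<^sup>T"
      unfolding F_def using Lc[of "t / 2"] Qc
      by (simp add: transpose_mult[of _ 4 4 _ 4] QT assoc_mult_mat[of _ 4 4 _ 4 _ 4])
    also have "\<dots> = L (t / 2) * M1 * L (- (t / 2))" by (simp only: QSQ LT)
    also have "\<dots> = of_real (cos t) \<cdot>\<^sub>m M1 + of_real (sin t) \<cdot>\<^sub>m M2"
    proof -
      define c where "c = complex_of_real (cos (t / 2))"
      define s where "s = complex_of_real (sin (t / 2))"
      have ry: "ry (t / 2) = mat2 c (- s) s c" "ry (- (t / 2)) = mat2 c s (- s) c"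
        by (simp_all add: ry_def c_def s_def)
      have d: "complex_of_real (cos t) = c * c - s * s" "complex_of_real (sin t) = 2 * (s * c)"
        using cos_double[of "t / 2"] sin_double[of "t / 2"] by (simp_all add: c_def s_def power2_eq_square)
      show ?thesis unfolding Lb ry M1_def M2_def d
        by (simp add: four_block_mult2 four_block_smult2 four_block_add2 algebra_simps)
    qed
    finally show ?thesis .
  qed
  have M: "M1 \<in> carrier_mat 4 4" "M2 \<in> carrier_mat 4 4"
    by (simp_all add: M1_def M2_def four_block_carrier4)
  obtain t where t: "implementable 2 2 (W * F t)"
    using implementable_two_cnots_family[of W F M1 M2] W F det M FS by auto
  define P where "P = mat2 1 0 0 \<i>"
  have P: "unitary 2 P" by (simp add: P_def unitary_def mat2_one)
  \<comment> \<open>Up to phase gates \<open>P\<close> on both qubits and a scalar, the inverse of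
    \<open>Q\<close> is a controlled-Z, and Hadamard gates on the top qubit turn that into
    \<open>cx\<close>.\<close>
  have "mat_adjoint Q = tensor (cnj w \<cdot>\<^sub>m (P * hadamard)) P * cx * tensor hadamard (1\<^sub>m 2)"
  proof -
    have "\<i> * cnj w = w" using w(1,3) by (metis mult.assoc mult.commute mult_1_right)
    then show ?thesis
      by (simp add: Q_def mat_diag4 P_def hadamard_def tensor_mat2 mat2_one cx_def four_block_mult2
          four_block_adjoint2 rt2_square algebra_simps)
  qed
  moreover have "implementable 2 (0 + 1 + 0) (tensor (cnj w \<cdot>\<^sub>m (P * hadamard)) P * cx * tensor hadamard (1\<^sub>m 2))"
    using P w(4) by (intro implementable_mult implementable_tensor implementable_cx unitary_smult unitary_mult
        hadamard_unitary unitary_one) auto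
  ultimately have iQ: "implementable 2 1 (mat_adjoint Q)" by simp
  have "tensor (1\<^sub>m 2) (ry a) = L a" for a
    unfolding Lb by (simp add: mat2_one tensor_mat2 ry_def)
  then have iL: "implementable 2 0 (L a)" for a
    using implementable_tensor[OF unitary_one ry_unitary, of a] by simp
  have "W = W * F t * (mat_adjoint Q * L (- (t / 2)))"
  proof -
    have "Q * (mat_adjoint Q * L (- (t / 2))) = L (- (t / 2))"
      using Q Lc by (rule unitary_cancel_right)
    then have "W * F t * (mat_adjoint Q * L (- (t / 2))) = W * (L (t / 2) * L (- (t / 2)))"
      unfolding F_def using unitary_carrier[OF W] Qc Lc by (simp add: assoc_mult_mat[of _ 4 4 _ 4 _ 4])
    then show ?thesis using unitary_carrier[OF W] by (simp add: Ladd L0 right_mult_one_mat[of _ 4 4])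
  qed
  moreover have "implementable 2 (2 + (1 + 0)) (W * F t * (mat_adjoint Q * L (- (t / 2))))"
    using t iQ iL by (intro implementable_mult)
  ultimately show ?thesis by simp
qed

section \<open>Quantum Shannon decomposition and isometries\<close>

text \<open>One hop of a diagonal towards the start of the circuit: it leaves the block
  \<open>C * D\<close>, passes through \<open>M\<close> and is absorbed by \<open>W\<close>.
  Everything applied still earlier is collected in \<open>R\<close>.\<close>

lemma push_diagonal:
  assumes "C \<in> carrier_mat n n" "D \<in> carrier_mat n n" "W \<in> carrier_mat n n"
    "M \<in> carrier_mat (n + n) (n + n)" "R \<in> carrier_mat (n + n) (n + n)"
    and comm: "M * block_diag D D = block_diag D D * M"
  shows "block_diag (C * D) (C * D) * (M * (block_diag W W * R))
    = block_diag C C * (M * (block_diag (D * W) (D * W) * R))"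
proof -
  have c: "block_diag C C \<in> carrier_mat (n + n) (n + n)" "block_diag D D \<in> carrier_mat (n + n) (n + n)"
    "block_diag W W \<in> carrier_mat (n + n) (n + n)" using assms by auto
  note assoc = assoc_mult_mat[of _ "n + n" "n + n" _ "n + n" _ "n + n"]
  have "block_diag (C * D) (C * D) * (M * (block_diag W W * R))
    = block_diag C C * (block_diag D D * M * (block_diag W W * R))"
    using assms(1-5) c by (simp add: block_diag_mult[of _ n _ n, symmetric] assoc)
  also have "\<dots> = block_diag C C * (M * (block_diag D D * block_diag W W * R))"
    unfolding comm[symmetric] using assms(4,5) c by (simp add: assoc)
  finally show ?thesis using assms(1-3) by (simp add: block_diag_mult[of _ n _ n])
qed

lemma block_diag_mat_diag:
  "block_diag (mat_diag n d) (mat_diag n d) = mat_diag (n + n) (\<lambda>i. if i < n then d i else d (i - n))"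
  by (intro eq_matI) (auto simp: block_diag_def mat_diag_def)

lemma mux_rz_commute:
  "mux n (\<lambda>j. rz (t j)) * block_diag (mat_diag n d) (mat_diag n d)
    = block_diag (mat_diag n d) (mat_diag n d) * mux n (\<lambda>j. rz (t j))"
  by (rule mux_commute_diag) (simp add: rz_def)

text \<open>Only the left multiplexed unitary is demultiplexed, since an isometry will need only
  \<open>B0\<close> from the right one. The diagonal left over by the y-rotations acts on the lower
  block alone and is merged into \<open>B1\<close>.\<close>

lemma cosine_sine_circuit:
  assumes U: "unitary (2 ^ n + 2 ^ n) U" and n: "n > 0"
  obtains V W B0 B1 G t where "unitary (2 ^ n) V" "unitary (2 ^ n) W" "unitary (2 ^ n) B0" "unitary (2 ^ n) B1"
    "implementable (Suc n) (2 ^ n - 1) G"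
    "\<forall>d. G * block_diag (mat_diag (2 ^ n) d) (mat_diag (2 ^ n) d)
       = block_diag (mat_diag (2 ^ n) d) (mat_diag (2 ^ n) d) * G"
    "U = block_diag V V * (mux (2 ^ n) (\<lambda>j. rz (t j)) * (block_diag W W * (G * block_diag B0 B1)))"
proof -
  let ?N = "2 ^ n :: nat"
  obtain A0 A1 B0 B1 s where AB: "unitary ?N A0" "unitary ?N A1" "unitary ?N B0" "unitary ?N B1"
    "U = block_diag A0 A1 * mux ?N (\<lambda>j. ry (s j)) * block_diag B0 B1"
    using cosine_sine_decomposition[OF U] by blast
  obtain G e where G: "implementable (Suc n) (2 ^ n - 1) G" "unitary ?N (mat_diag ?N e)"
    "mux ?N (\<lambda>j. ry (s j)) = G * block_diag (1\<^sub>m ?N) (mat_diag ?N e)"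
    "\<forall>d. G * block_diag (mat_diag ?N d) (mat_diag ?N d) = block_diag (mat_diag ?N d) (mat_diag ?N d) * G"
    using implementable_mux_ry[OF n] by blast
  obtain V W t where VW: "unitary ?N V" "unitary ?N W"
    "block_diag A0 A1 = block_diag V V * mux ?N (\<lambda>j. rz (t j)) * block_diag W W"
    using demultiplexing[OF AB(1,2)] by blast
  have Gc: "G \<in> carrier_mat (?N + ?N) (?N + ?N)" using implementable_carrier[OF G(1)] by (simp add: mult_2)
  have c: "block_diag V V \<in> carrier_mat (?N + ?N) (?N + ?N)" "block_diag W W \<in> carrier_mat (?N + ?N) (?N + ?N)"
    "block_diag B0 B1 \<in> carrier_mat (?N + ?N) (?N + ?N)"
    "block_diag (1\<^sub>m ?N) (mat_diag ?N e) \<in> carrier_mat (?N + ?N) (?N + ?N)"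
    using VW AB by auto
  have bd: "block_diag (1\<^sub>m ?N) (mat_diag ?N e) * block_diag B0 B1 = block_diag B0 (mat_diag ?N e * B1)"
    using AB by (subst block_diag_mult[of _ ?N _ ?N]) (auto simp: left_mult_one_mat[of _ ?N ?N])
  have "U = block_diag V V * (mux ?N (\<lambda>j. rz (t j)) * (block_diag W W
      * (G * block_diag B0 (mat_diag ?N e * B1))))"
    unfolding bd[symmetric] AB(5) VW(3) G(3) using c Gc
    by (simp add: assoc_mult_mat[of _ "?N + ?N" "?N + ?N" _ "?N + ?N" _ "?N + ?N"])
  then show ?thesis
    by (rule that[OF VW(1,2) AB(3) unitary_mult[OF G(2) AB(4)] G(1,4)])
qed

text \<open>The trailing identity gives the last block the same shape as the others, so that
  \<open>push_diagonal\<close> applies to it as well.\<close>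

lemma quantum_shannon_decomposition:
  assumes U: "unitary (2 ^ n + 2 ^ n) U" and n: "n > 0"
  obtains W4 W3 W2 W1 G s t where
    "unitary (2 ^ n) W4" "unitary (2 ^ n) W3" "unitary (2 ^ n) W2" "unitary (2 ^ n) W1"
    "implementable (Suc n) (2 ^ n - 1) G"
    "\<forall>d. G * block_diag (mat_diag (2 ^ n) d) (mat_diag (2 ^ n) d)
       = block_diag (mat_diag (2 ^ n) d) (mat_diag (2 ^ n) d) * G"
    "U = block_diag W4 W4 * (mux (2 ^ n) (\<lambda>j. rz (s j)) * (block_diag W3 W3 * (G * (block_diag W2 W2
       * (mux (2 ^ n) (\<lambda>j. rz (t j)) * (block_diag W1 W1 * 1\<^sub>m (2 ^ n + 2 ^ n)))))))"
proof -
  let ?N = "2 ^ n :: nat"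
  obtain V W B0 B1 G t where *: "unitary ?N V" "unitary ?N W" "unitary ?N B0" "unitary ?N B1"
    "implementable (Suc n) (2 ^ n - 1) G"
    "\<forall>d. G * block_diag (mat_diag ?N d) (mat_diag ?N d) = block_diag (mat_diag ?N d) (mat_diag ?N d) * G"
    "U = block_diag V V * (mux ?N (\<lambda>j. rz (t j)) * (block_diag W W * (G * block_diag B0 B1)))"
    by (rule cosine_sine_circuit[OF U n])
  obtain V' W' t' where VW: "unitary ?N V'" "unitary ?N W'"
    "block_diag B0 B1 = block_diag V' V' * mux ?N (\<lambda>j. rz (t' j)) * block_diag W' W'"
    using demultiplexing[OF *(3,4)] by blast
  have c: "block_diag V' V' \<in> carrier_mat (?N + ?N) (?N + ?N)" "block_diag W' W' \<in> carrier_mat (?N + ?N) (?N + ?N)"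
    using VW by auto
  have bd: "block_diag B0 B1 = block_diag V' V' * (mux ?N (\<lambda>j. rz (t' j)) * (block_diag W' W' * 1\<^sub>m (?N + ?N)))"
    unfolding VW(3) using c
    by (simp add: assoc_mult_mat[of _ "?N + ?N" "?N + ?N" _ "?N + ?N" _ "?N + ?N"]
        right_mult_one_mat[of _ "?N + ?N" "?N + ?N"])
  show ?thesis by (rule that[OF *(1,2) VW(1,2) *(5,6) *(7)[unfolded bd]])
qed

text \<open>Three of the four blocks are built up to a diagonal, which moves on to the next. The
  last block is left open as \<open>W\<close>: the caller builds it up to a diagonal or
  exactly.\<close>

lemma shannon_implementable:
  assumes n: "n > 0"
    and k: "\<And>U. unitary (2 ^ n) U \<Longrightarrow> \<exists>C d. implementable n k C \<and> unitary (2 ^ n) (mat_diag (2 ^ n) d) \<and> U = C * mat_diag (2 ^ n) d"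
    and U: "unitary (2 ^ Suc n) U"
  obtains C W where "implementable (Suc n) (3 * k + 3 * 2 ^ n - 1) C" "unitary (2 ^ n) W" "U = C * block_diag W W"
proof -
  let ?N = "2 ^ n :: nat"
  note assoc = assoc_mult_mat[of _ "?N + ?N" "?N + ?N" _ "?N + ?N" _ "?N + ?N"]
  have U': "unitary (?N + ?N) U" using U by (simp add: mult_2)
  obtain W4 W3 W2 W1 G s t where W: "unitary ?N W4" "unitary ?N W3" "unitary ?N W2" "unitary ?N W1"
    and G: "implementable (Suc n) (2 ^ n - 1) G"
      "\<forall>d. G * block_diag (mat_diag ?N d) (mat_diag ?N d) = block_diag (mat_diag ?N d) (mat_diag ?N d) * G"
    and eq: "U = block_diag W4 W4 * (mux ?N (\<lambda>j. rz (s j)) * (block_diag W3 W3 * (G * (block_diag W2 W2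
       * (mux ?N (\<lambda>j. rz (t j)) * (block_diag W1 W1 * 1\<^sub>m (?N + ?N)))))))"
    by (rule quantum_shannon_decomposition[OF U' n])
  define S where "S = mux ?N (\<lambda>j. rz (s j))"
  define T where "T = mux ?N (\<lambda>j. rz (t j))"
  obtain C4 d4 where 4: "implementable n k C4" "unitary ?N (mat_diag ?N d4)" "W4 = C4 * mat_diag ?N d4"
    using k[OF W(1)] by blast
  obtain C3 d3 where 3: "implementable n k C3" "unitary ?N (mat_diag ?N d3)" "mat_diag ?N d4 * W3 = C3 * mat_diag ?N d3"
    using k[OF unitary_mult[OF 4(2) W(2)]] by blast
  obtain C2 d2 where 2: "implementable n k C2" "unitary ?N (mat_diag ?N d2)" "mat_diag ?N d3 * W2 = C2 * mat_diag ?N d2"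
    using k[OF unitary_mult[OF 3(2) W(3)]] by blast
  define X where "X = mat_diag ?N d2 * W1"
  have X: "unitary ?N X" unfolding X_def using 2(2) W(4) by (rule unitary_mult)
  have Cc: "C4 \<in> carrier_mat ?N ?N" "C3 \<in> carrier_mat ?N ?N" "C2 \<in> carrier_mat ?N ?N"
    using 4(1) 3(1) 2(1) implementable_carrier by auto
  have Gc: "G \<in> carrier_mat (?N + ?N) (?N + ?N)" using implementable_carrier[OF G(1)] by (simp add: mult_2)
  have STc: "S \<in> carrier_mat (?N + ?N) (?N + ?N)" "T \<in> carrier_mat (?N + ?N) (?N + ?N)"
    by (auto simp: S_def T_def)
  have Wc: "W4 \<in> carrier_mat ?N ?N" "W3 \<in> carrier_mat ?N ?N" "W2 \<in> carrier_mat ?N ?N" "W1 \<in> carrier_mat ?N ?N"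
    using W by auto
  have comm: "S * block_diag (mat_diag ?N d) (mat_diag ?N d) = block_diag (mat_diag ?N d) (mat_diag ?N d) * S"
    "T * block_diag (mat_diag ?N d) (mat_diag ?N d) = block_diag (mat_diag ?N d) (mat_diag ?N d) * T" for d
    unfolding S_def T_def by (rule mux_rz_commute)+
  have lift: "block_diag A A \<in> carrier_mat (?N + ?N) (?N + ?N)" if "A \<in> carrier_mat ?N ?N" for A
    using that by simp
  define R1 where "R1 = block_diag W1 W1 * 1\<^sub>m (?N + ?N)"
  have R1: "R1 \<in> carrier_mat (?N + ?N) (?N + ?N)" using lift[OF Wc(4)] by (simp add: R1_def)
  define R2 where "R2 = G * (block_diag W2 W2 * (T * R1))"
  have R2: "R2 \<in> carrier_mat (?N + ?N) (?N + ?N)"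
    using lift[OF Wc(3)] STc Gc R1 by (simp add: R2_def)
  have "U = block_diag W4 W4 * (S * (block_diag W3 W3 * R2))"
    unfolding eq R2_def R1_def S_def T_def ..
  also have "\<dots> = block_diag C4 C4 * (S * (block_diag (C3 * mat_diag ?N d3) (C3 * mat_diag ?N d3) * R2))"
    unfolding 4(3) using push_diagonal[OF Cc(1) mat_diag_dim Wc(2) STc(1) R2 comm(1)] by (simp only: 3(3))
  also have "block_diag (C3 * mat_diag ?N d3) (C3 * mat_diag ?N d3) * R2
      = block_diag C3 C3 * (G * (block_diag (C2 * mat_diag ?N d2) (C2 * mat_diag ?N d2) * (T * R1)))"
    unfolding R2_def
    using push_diagonal[OF Cc(2) mat_diag_dim Wc(3) Gc mult_carrier_square[OF STc(2) R1] spec[OF G(2)]] by (simp only: 2(3))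
  also have "block_diag (C2 * mat_diag ?N d2) (C2 * mat_diag ?N d2) * (T * R1)
      = block_diag C2 C2 * (T * (block_diag X X * 1\<^sub>m (?N + ?N)))"
    unfolding R1_def X_def using push_diagonal[OF Cc(3) mat_diag_dim Wc(4) STc(2) one_carrier_mat comm(2)] .
  also have "block_diag X X * 1\<^sub>m (?N + ?N) = block_diag X X"
    using lift[OF unitary_carrier[OF X]] by (simp add: right_mult_one_mat[of _ "?N + ?N" "?N + ?N"])
  finally have "U = block_diag C4 C4 * S * block_diag C3 C3 * G * block_diag C2 C2 * T * block_diag X X"
    using lift[OF Cc(1)] lift[OF Cc(2)] lift[OF Cc(3)] lift[OF unitary_carrier[OF X]] STc Gc by (simp add: assoc)
  moreover have "implementable (Suc n) (k + 2 ^ n + k + (2 ^ n - 1) + k + 2 ^ n)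
      (block_diag C4 C4 * S * block_diag C3 C3 * G * block_diag C2 C2 * T)"
    unfolding S_def T_def using 4(1) 3(1) 2(1) G(1) n
    by (intro implementable_mult implementable_lift implementable_mux_rz)
  moreover have "k + 2 ^ n + k + (2 ^ n - 1) + k + 2 ^ n \<le> 3 * k + 3 * 2 ^ n - 1"
    using one_le_power[of "2 :: nat" n] by simp
  ultimately show ?thesis using that X implementable_mono by blast
qed

text \<open>The count is four times the previous one plus two multiplexed z-rotations and a
  shortened y-rotation. The diagonal of the last block, copied to both values of the top qubit, is
  again diagonal.\<close>

lemma implementable_up_to_diagonal:
  assumes "2 \<le> n"
  shows "\<exists>k. real k \<le> 23 / 48 * 4 ^ n - 3 / 2 * 2 ^ n + 1 / 3 \<and>
    (\<forall>U. unitary (2 ^ n) U \<longrightarrow>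
      (\<exists>C d. implementable n k C \<and> unitary (2 ^ n) (mat_diag (2 ^ n) d) \<and> U = C * mat_diag (2 ^ n) d))"
  using assms
proof (induction n rule: dec_induct)
  case base
  show ?case using two_qubit_up_to_diagonal by (intro exI[of _ 2]) (simp, metis)
next
  case (step n)
  then obtain k where k: "real k \<le> 23 / 48 * 4 ^ n - 3 / 2 * 2 ^ n + 1 / 3"
    "\<And>U. unitary (2 ^ n) U \<Longrightarrow> \<exists>C d. implementable n k C \<and> unitary (2 ^ n) (mat_diag (2 ^ n) d) \<and> U = C * mat_diag (2 ^ n) d"
    by blast
  have n: "n > 0" using step by simp
  let ?N = "2 ^ n :: nat"
  have "\<exists>C d. implementable (Suc n) (3 * k + 3 * 2 ^ n - 1 + k) C
      \<and> unitary (2 ^ Suc n) (mat_diag (2 ^ Suc n) d) \<and> U = C * mat_diag (2 ^ Suc n) d"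
    if U: "unitary (2 ^ Suc n) U" for U
  proof -
    obtain C W where C: "implementable (Suc n) (3 * k + 3 * 2 ^ n - 1) C" "unitary ?N W" "U = C * block_diag W W"
      using shannon_implementable[OF n k(2) U] by blast
    obtain C1 d where 1: "implementable n k C1" "unitary ?N (mat_diag ?N d)" "W = C1 * mat_diag ?N d"
      using k(2)[OF C(2)] by blast
    define e where "e i = (if i < ?N then d i else d (i - ?N))" for i
    have e: "mat_diag (2 ^ Suc n) e = block_diag (mat_diag ?N d) (mat_diag ?N d)"
      by (simp add: block_diag_mat_diag e_def[abs_def] mult_2)
    have C1c: "C1 \<in> carrier_mat ?N ?N" using implementable_carrier[OF 1(1)] .
    have Cc: "C \<in> carrier_mat (?N + ?N) (?N + ?N)" using implementable_carrier[OF C(1)] by (simp add: mult_2)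
    have "block_diag W W = block_diag C1 C1 * mat_diag (2 ^ Suc n) e"
      unfolding 1(3) e using C1c by (simp add: block_diag_mult[of _ ?N _ ?N])
    then have "U = C * block_diag C1 C1 * mat_diag (2 ^ Suc n) e"
      unfolding C(3) e using Cc C1c
      by (simp add: assoc_mult_mat[of _ "?N + ?N" "?N + ?N" _ "?N + ?N" _ "?N + ?N"])
    moreover have "implementable (Suc n) (3 * k + 3 * 2 ^ n - 1 + k) (C * block_diag C1 C1)"
      using C(1) 1(1) by (intro implementable_mult implementable_lift)
    moreover have "unitary (2 ^ Suc n) (mat_diag (2 ^ Suc n) e)"
      unfolding e using block_diag_unitary[OF 1(2) 1(2)] by (simp add: mult_2)
    ultimately show ?thesis by blast
  qed
  moreover have "real (3 * k + 3 * 2 ^ n - 1 + k) \<le> 23 / 48 * 4 ^ Suc n - 3 / 2 * 2 ^ Suc n + 1 / 3"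
  proof -
    have "(1 :: nat) \<le> 2 ^ n" by simp
    then have "(1 :: nat) \<le> 3 * k + 3 * 2 ^ n" by linarith
    then have "real (3 * k + 3 * 2 ^ n - 1 + k) = 4 * real k + 3 * 2 ^ n - 1"
      by (simp add: of_nat_diff)
    then show ?thesis using k(1) by simp
  qed
  ultimately show ?case by blast
qed

text \<open>Only the last of the four blocks is built exactly, so the surcharge of one CNOT from the
  two-qubit case is passed on once per level and never multiplied; hence 4/3 in place of
  1/3.\<close>

lemma implementable_unitary:
  assumes "2 \<le> n"
  shows "\<exists>k. real k \<le> 23 / 48 * 4 ^ n - 3 / 2 * 2 ^ n + 4 / 3 \<and> (\<forall>U. unitary (2 ^ n) U \<longrightarrow> implementable n k U)"
  using assms
proof (induction n rule: dec_induct)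
  case base
  show ?case using two_qubit_three_cnots by (intro exI[of _ 3]) simp
next
  case (step n)
  then obtain l where l: "real l \<le> 23 / 48 * 4 ^ n - 3 / 2 * 2 ^ n + 4 / 3"
    "\<And>U. unitary (2 ^ n) U \<Longrightarrow> implementable n l U" by blast
  obtain k where k: "real k \<le> 23 / 48 * 4 ^ n - 3 / 2 * 2 ^ n + 1 / 3"
    "\<And>U. unitary (2 ^ n) U \<Longrightarrow> \<exists>C d. implementable n k C \<and> unitary (2 ^ n) (mat_diag (2 ^ n) d) \<and> U = C * mat_diag (2 ^ n) d"
    using implementable_up_to_diagonal[OF step(1)] by blast
  have n: "n > 0" using step by simp
  have "implementable (Suc n) (3 * k + 3 * 2 ^ n - 1 + l) U" if U: "unitary (2 ^ Suc n) U" for U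
  proof -
    obtain C W where C: "implementable (Suc n) (3 * k + 3 * 2 ^ n - 1) C" "unitary (2 ^ n) W" "U = C * block_diag W W"
      using shannon_implementable[OF n k(2) U] by blast
    then show ?thesis using l(2)[OF C(2)] by (simp only: implementable_mult implementable_lift)
  qed
  moreover have "real (3 * k + 3 * 2 ^ n - 1 + l) \<le> 23 / 48 * 4 ^ Suc n - 3 / 2 * 2 ^ Suc n + 4 / 3"
  proof -
    have "(1 :: nat) \<le> 2 ^ n" by simp
    then have "(1 :: nat) \<le> 3 * k + 3 * 2 ^ n" by linarith
    then have "real (3 * k + 3 * 2 ^ n - 1 + l) = 3 * real k + real l + 3 * 2 ^ n - 1"
      by (simp add: of_nat_diff)
    then show ?thesis using k(1) l(1) by simp
  qed
  ultimately show ?case by blast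
qed

section \<open>Isometries as the first columns of unitaries\<close>

lemma iso_embed_carrier [simp]: "iso_embed n m \<in> carrier_mat (2 ^ n) (2 ^ m)"
  by (simp add: iso_embed_def)

lemma mult_iso_embed_index:
  assumes "A \<in> carrier_mat (2 ^ n) (2 ^ n)" "m \<le> n" "i < 2 ^ n" "j < 2 ^ m"
  shows "(A * iso_embed n m) $$ (i, j) = A $$ (i, j)"
proof -
  have "(2 :: nat) ^ m \<le> 2 ^ n" using assms(2) by (intro power_increasing) auto
  then have j: "j < 2 ^ n" by (rule less_le_trans[OF assms(4)])
  have "(A * iso_embed n m) $$ (i, j) = (\<Sum>k<2 ^ n. A $$ (i, k) * (if k = j then 1 else 0))"
    using assms by (subst index_mult_mat_sum) (auto simp: iso_embed_def intro!: sum.cong)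
  then show ?thesis using j by (simp add: if_distrib sum.delta cong: if_cong)
qed

text \<open>The top qubit starts in state 0, so that only the upper block acts.\<close>

lemma block_diag_iso_embed:
  assumes X: "X \<in> carrier_mat (2 ^ n) (2 ^ n)" "X' \<in> carrier_mat (2 ^ n) (2 ^ n)"
    and Y: "Y \<in> carrier_mat (2 ^ n) (2 ^ n)" "Y' \<in> carrier_mat (2 ^ n) (2 ^ n)"
    and m: "m \<le> n" and eq: "X * iso_embed n m = X' * iso_embed n m"
  shows "block_diag X Y * iso_embed (Suc n) m = block_diag X' Y' * iso_embed (Suc n) m"
proof (rule eq_matI)
  fix i j
  assume "i < dim_row (block_diag X' Y' * iso_embed (Suc n) m)" "j < dim_col (block_diag X' Y' * iso_embed (Suc n) m)"
  then have ij: "i < 2 ^ Suc n" "j < 2 ^ m" using X Y by (auto simp: block_diag_def iso_embed_def)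
  have "(2 :: nat) ^ m \<le> 2 ^ n" using m by (intro power_increasing) auto
  then have j: "j < 2 ^ n" by (rule less_le_trans[OF ij(2)])
  have bd: "block_diag X Y \<in> carrier_mat (2 ^ Suc n) (2 ^ Suc n)" "block_diag X' Y' \<in> carrier_mat (2 ^ Suc n) (2 ^ Suc n)"
    using block_diag_carrier[OF X(1) Y(1)] block_diag_carrier[OF X(2) Y(2)] by (simp_all add: mult_2)
  have "X $$ (i, j) = X' $$ (i, j)" if "i < 2 ^ n"
    using arg_cong[OF eq, of "\<lambda>M. M $$ (i, j)"] X m that ij by (simp only: mult_iso_embed_index)
  then have "block_diag X Y $$ (i, j) = block_diag X' Y' $$ (i, j)"
    using X Y ij j by (simp add: block_diag_def)
  then show "(block_diag X Y * iso_embed (Suc n) m) $$ (i, j) = (block_diag X' Y' * iso_embed (Suc n) m) $$ (i, j)"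
    using bd m ij by (simp only: mult_iso_embed_index le_SucI)
qed (use X Y in \<open>auto simp: block_diag_def\<close>)

text \<open>Stated for a unitary of which only the first \<open>2 ^ m\<close> columns matter, so
  that the hypothesis applies directly to the upper block, multiplied by the diagonal it absorbs.
  The induction adds qubits in state 0 to a full unitary on \<open>m\<close> qubits.\<close>

lemma implementable_isometry:
  assumes m: "2 \<le> m" and n: "m \<le> n"
  shows "\<exists>k. real k \<le> 23 / 144 * (4 ^ m + 2 * 4 ^ n) - 2 ^ (m - 1) - 2 ^ n + 1 / 3 * (real m - real n + 4) \<and>
    (\<forall>U. unitary (2 ^ n) U \<longrightarrow> (\<exists>C. implementable n k C \<and> C * iso_embed n m = U * iso_embed n m))"
  using n
proof (induction n rule: dec_induct)
  case base
  \<comment> \<open>For n = m the claimed bound is that for unitaries, with 3/2 2^m written as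
    2^(m-1) + 2^m.\<close>
  have "(2 :: real) * 2 ^ (m - 1) = 2 ^ m" using m by (simp flip: power_Suc)
  moreover obtain k where k: "real k \<le> 23 / 48 * 4 ^ m - 3 / 2 * 2 ^ m + 4 / 3"
    "\<And>U. unitary (2 ^ m) U \<Longrightarrow> implementable m k U"
    using implementable_unitary[OF m] by blast
  ultimately have "real k \<le> 23 / 144 * (4 ^ m + 2 * 4 ^ m) - 2 ^ (m - 1) - 2 ^ m + 1 / 3 * (real m - real m + 4)"
    by (simp add: field_simps)
  then show ?case using k(2) by blast
next
  case (step n)
  let ?N = "2 ^ n :: nat"
  note assoc = assoc_mult_mat[of _ "?N + ?N" "?N + ?N" _ "?N + ?N" _ "2 ^ m"]
  obtain l where l: "real l \<le> 23 / 144 * (4 ^ m + 2 * 4 ^ n) - 2 ^ (m - 1) - 2 ^ n + 1 / 3 * (real m - real n + 4)"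
    "\<And>U. unitary (2 ^ n) U \<Longrightarrow> \<exists>C. implementable n l C \<and> C * iso_embed n m = U * iso_embed n m"
    using step.IH by blast
  obtain k where k: "real k \<le> 23 / 48 * 4 ^ n - 3 / 2 * 2 ^ n + 1 / 3"
    "\<And>U. unitary (2 ^ n) U \<Longrightarrow> \<exists>C d. implementable n k C \<and> unitary (2 ^ n) (mat_diag (2 ^ n) d) \<and> U = C * mat_diag (2 ^ n) d"
    using implementable_up_to_diagonal[of n] step m by force
  have n0: "n > 0" using step m by simp
  define K where "K = k + 2 ^ n + k + (2 ^ n - 1) + l"
  have "\<exists>C. implementable (Suc n) K C \<and> C * iso_embed (Suc n) m = U * iso_embed (Suc n) m"
    if U: "unitary (2 ^ Suc n) U" for U
  proof -
    have U': "unitary (?N + ?N) U" using U by (simp add: mult_2)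
    obtain V W B0 B1 G t where W: "unitary ?N V" "unitary ?N W" "unitary ?N B0" "unitary ?N B1"
      and G: "implementable (Suc n) (2 ^ n - 1) G"
        "\<forall>d. G * block_diag (mat_diag ?N d) (mat_diag ?N d) = block_diag (mat_diag ?N d) (mat_diag ?N d) * G"
      and eq: "U = block_diag V V * (mux ?N (\<lambda>j. rz (t j)) * (block_diag W W * (G * block_diag B0 B1)))"
      by (rule cosine_sine_circuit[OF U' n0])
    define T where "T = mux ?N (\<lambda>j. rz (t j))"
    have T: "implementable (Suc n) (2 ^ n) T" unfolding T_def by (rule implementable_mux_rz[OF n0])
    have Tc: "T \<in> carrier_mat (?N + ?N) (?N + ?N)" by (simp add: T_def)
    have Gc: "G \<in> carrier_mat (?N + ?N) (?N + ?N)" using implementable_carrier[OF G(1)] by (simp add: mult_2)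
    obtain C2 d2 where 2: "implementable n k C2" "unitary ?N (mat_diag ?N d2)" "V = C2 * mat_diag ?N d2"
      using k(2)[OF W(1)] by blast
    obtain C1 d1 where 1: "implementable n k C1" "unitary ?N (mat_diag ?N d1)" "mat_diag ?N d2 * W = C1 * mat_diag ?N d1"
      using k(2)[OF unitary_mult[OF 2(2) W(2)]] by blast
    obtain C0 where 0: "implementable n l C0" "C0 * iso_embed n m = (mat_diag ?N d1 * B0) * iso_embed n m"
      using l(2)[OF unitary_mult[OF 1(2) W(3)]] by blast
    have Cc: "C2 \<in> carrier_mat ?N ?N" "C1 \<in> carrier_mat ?N ?N" "C0 \<in> carrier_mat ?N ?N"
      using 2(1) 1(1) 0(1) implementable_carrier by auto
    have Wc: "V \<in> carrier_mat ?N ?N" "W \<in> carrier_mat ?N ?N" "B0 \<in> carrier_mat ?N ?N" "B1 \<in> carrier_mat ?N ?N"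
      using W by auto
    have lift: "block_diag A B \<in> carrier_mat (?N + ?N) (?N + ?N)"
      if "A \<in> carrier_mat ?N ?N" "B \<in> carrier_mat ?N ?N" for A B using that by simp
    define J where "J = iso_embed (Suc n) m"
    have J: "J \<in> carrier_mat (?N + ?N) (2 ^ m)" using iso_embed_carrier[of "Suc n" m] by (simp add: J_def mult_2)
    have "U = block_diag C2 C2 * (T * (block_diag (C1 * mat_diag ?N d1) (C1 * mat_diag ?N d1) * (G * block_diag B0 B1)))"
      unfolding eq T_def[symmetric] 2(3)
      using push_diagonal[OF Cc(1) mat_diag_dim Wc(2) Tc mult_carrier_square[OF Gc lift[OF Wc(3,4)]]
          mux_rz_commute[of ?N t, folded T_def]] by (simp only: 1(3))
    also have "block_diag (C1 * mat_diag ?N d1) (C1 * mat_diag ?N d1) * (G * block_diag B0 B1)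
        = block_diag C1 C1 * (block_diag (mat_diag ?N d1) (mat_diag ?N d1) * G * block_diag B0 B1)"
      using Cc Gc lift[OF Wc(3,4)] lift[OF Cc(2) Cc(2)] lift[of "mat_diag ?N d1" "mat_diag ?N d1"]
      by (simp add: block_diag_mult[of _ ?N _ ?N, symmetric] assoc_mult_mat[of _ "?N + ?N" "?N + ?N" _ "?N + ?N" _ "?N + ?N"])
    also have "block_diag (mat_diag ?N d1) (mat_diag ?N d1) * G * block_diag B0 B1
        = G * block_diag (mat_diag ?N d1 * B0) (mat_diag ?N d1 * B1)"
      unfolding spec[OF G(2), symmetric] using Gc Wc lift[OF Wc(3,4)] lift[of "mat_diag ?N d1" "mat_diag ?N d1"]
      by (simp add: block_diag_mult[of _ ?N _ ?N] assoc_mult_mat[of _ "?N + ?N" "?N + ?N" _ "?N + ?N" _ "?N + ?N"])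
    finally have "U * J = block_diag C2 C2 * (T * (block_diag C1 C1 * (G * (block_diag (mat_diag ?N d1 * B0) (mat_diag ?N d1 * B1) * J))))"
      using Tc Gc J Wc lift[OF Cc(1) Cc(1)] lift[OF Cc(2) Cc(2)] lift[of "mat_diag ?N d1 * B0" "mat_diag ?N d1 * B1"]
      by (simp add: assoc)
    \<comment> \<open>The lower block is never reached from the embedded inputs, so it may be
      replaced by a second copy of \<open>C0\<close>. This turns the multiplexed pair into a circuit
      on the lower qubits alone.\<close>
    also have "block_diag (mat_diag ?N d1 * B0) (mat_diag ?N d1 * B1) * J = block_diag C0 C0 * J"
      unfolding J_def using Cc(3) Wc 0(2) step(1) by (intro block_diag_iso_embed) auto
    also have "block_diag C2 C2 * (T * (block_diag C1 C1 * (G * (block_diag C0 C0 * J))))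
        = (block_diag C2 C2 * T * block_diag C1 C1 * G * block_diag C0 C0) * J"
      using Tc Gc J lift[OF Cc(1) Cc(1)] lift[OF Cc(2) Cc(2)] lift[OF Cc(3) Cc(3)] by (simp add: assoc)
    finally have "U * J = (block_diag C2 C2 * T * block_diag C1 C1 * G * block_diag C0 C0) * J" .
    moreover have "implementable (Suc n) K (block_diag C2 C2 * T * block_diag C1 C1 * G * block_diag C0 C0)"
      unfolding K_def using 2(1) 1(1) 0(1) G(1) T by (intro implementable_mult implementable_lift)
    ultimately show ?thesis unfolding J_def by metis
  qed
  moreover have "real K \<le> 23 / 144 * (4 ^ m + 2 * 4 ^ Suc n) - 2 ^ (m - 1) - 2 ^ Suc n + 1 / 3 * (real m - real (Suc n) + 4)"
  proof -
    have "real (2 ^ n - 1) = 2 ^ n - 1" by (simp add: of_nat_diff)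
    then have "real K = 2 * real k + real l + 2 * 2 ^ n - 1" by (simp only: K_def of_nat_add of_nat_power of_nat_numeral)
    then show ?thesis using k(1) l(1) by (simp add: field_simps)
  qed
  ultimately show ?case by blast
qed

lemma isometry_extension:
  assumes V: "is_isometry m n V" and m: "m \<le> n"
  obtains U where "unitary (2 ^ n) U" "U * iso_embed n m = V"
proof -
  have Vc: "V \<in> carrier_mat (2 ^ n) (2 ^ m)" and VV: "mat_adjoint V * V = 1\<^sub>m (2 ^ m)"
    using V by (auto simp: is_isometry_def)
  have mn: "(2 :: nat) ^ m \<le> 2 ^ n" using m by (intro power_increasing) auto
  have "col V i \<bullet>c col V j = (if i = j then 1 else 0)" if ij: "i < 2 ^ m" "j < 2 ^ m" for i j
  proof -
    have "(mat_adjoint V * V) $$ (j, i) = (\<Sum>k<2 ^ n. cnj (V $$ (k, j)) * V $$ (k, i))"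
      using Vc ij by (subst index_mult_mat_sum) auto
    then show ?thesis using Vc ij unfolding VV
      by (auto simp: scalar_prod_def atLeast0LessThan conjugate_complex_def mult.commute)
  qed
  then have "orthonormal (2 ^ n) (col V) {..<2 ^ m}" using Vc by (auto simp: orthonormal_def)
  then obtain U where U: "unitary (2 ^ n) U" "\<forall>i\<in>{..<2 ^ m}. \<forall>j<2 ^ n. U $$ (j, i) = col V i $ j"
    by (rule unitary_completion[of _ _ _ False]) (use mn in auto)
  have "U * iso_embed n m = V"
  proof (rule eq_matI)
    fix i j assume "i < dim_row V" "j < dim_col V"
    then have ij: "i < 2 ^ n" "j < 2 ^ m" using Vc by auto
    show "(U * iso_embed n m) $$ (i, j) = V $$ (i, j)"
      unfolding mult_iso_embed_index[OF unitary_carrier[OF U(1)] m ij] using U(2) ij Vc by simp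
  qed (use Vc unitary_carrier[OF U(1)] in \<open>auto simp: iso_embed_def\<close>)
  with U(1) that show ?thesis by blast
qed

theorem theorem7:
  fixes m n :: nat and V :: "complex mat"
  assumes "2 \<le> m" and "m \<le> n" and "is_isometry m n V"
  shows "\<exists>gs. decomposes m n gs V \<and>
    real (cnot_count gs) \<le> 23 / 144 * (4 ^ m + 2 * 4 ^ n) - 2 ^ (m - 1) - 2 ^ n
                             + 1 / 3 * (real m - real n + 4)"
proof -
  obtain U where U: "unitary (2 ^ n) U" "U * iso_embed n m = V"
    using isometry_extension[OF assms(3,2)] by blast
  obtain k C where k: "real k \<le> 23 / 144 * (4 ^ m + 2 * 4 ^ n) - 2 ^ (m - 1) - 2 ^ n + 1 / 3 * (real m - real n + 4)"
    and C: "implementable n k C" "C * iso_embed n m = V"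
    using implementable_isometry[OF assms(1,2)] U by metis
  obtain gs where gs: "\<forall>g\<in>set gs. valid_gate n g" "circuit_unitary n gs = C" "cnot_count gs \<le> k"
    using C(1) by (auto simp: implementable_def)
  \<comment> \<open>The global phase can be taken to be 1, as all phases were realized by
    gates.\<close>
  have "1 \<cdot>\<^sub>m V = V" by (intro eq_matI) auto
  then have "decomposes m n gs V"
    using gs C(2) unfolding decomposes_def by (auto intro!: exI[of _ 1])
  moreover have "real (cnot_count gs) \<le> real k" using gs(3) by simp
  ultimately show ?thesis using k by (intro exI[of _ gs]) linarith
qed

end
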